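(* Let $\underline{C}$ be a triangulated category that has all small coproducts. Let $\mathcal{P}$ be a finite weakly negative set of objects of $\underline{C}$ that compactly generates $\underline{C}$; here weak negativity means that $\underline{C}(P,P'[i])=\{0\}$ for all $P,P'\in\mathcal{P}$ and all $i>1$. 1. Then $\underline{C}$ is weakly approximable in the sense of Neeman. 2. Moreover, if $\mathcal{P}=\bigcup_{0\le i\le n}\mathcal{P}_i$ for some integer $n\ge 0$ and some subsets $\mathcal{P}_i$ such that $\underline{C}(P,P'[1])=\{0\}$ for all $P\in\mathcal{P}_i$ and $P'\in\mathcal{P}_j$ whenever $i\le j$, then $\underline{C}$ is also approximable in the sense of Neeman.
   Context: All coproducts are small. $\underline{C}(X,Y)$ denotes the group of morphisms from $X$ to $Y$. An object $M$ is compact if $\underline{C}(M,-):\underline{C}\to\mathrm{Ab}$ respects coproducts. A class of objects is extension-closed if it contains $0$ and, for each distinguished triangle $X\to Z\to Y\to X[1]$ with $X,Y$ in the class, $Z$ is in the class. For a class $\mathcal{P}$ of objects, $[\mathcal{P}]^{\mathrm{cl}}$ is the smallest class of objects of $\underline{C}$ that contains $\mathcal{P}$, is extension-closed, and is closed with respect to small coproducts. A class $\mathcal{P}$ compactly generates $\underline{C}$ if all elements of $\mathcal{P}$ are compact and $[\bigcup_{i\in\mathbb{Z}}\mathcal{P}[i]]^{\mathrm{cl}}=\operatorname{Obj}\underline{C}$. For classes $\mathcal{X},\mathcal{Y}$ of objects, $\mathcal{X}\star\mathcal{Y}$ is the class of all $Z$ fitting into a distinguished triangle $X\to Z\to Y\to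 X[1]$ with $X\in\mathcal{X}$, $Y\in\mathcal{Y}$; this operation is associative. $t$-structures are in the cohomological convention: a $t$-structure $t$ is a pair $(\underline{C}^{t\ge 0},\underline{C}^{t\le 0})$ of classes of objects closed under isomorphisms with $\underline{C}^{t\ge 0}\subset\underline{C}^{t\ge 0}[1]$, $\underline{C}^{t\le 0}[1]\subset \underline{C}^{t\le 0}$, no non-zero morphisms from $\underline{C}^{t\le 0}[1]$ to $\underline{C}^{t\ge 0}$, and such that each object $M$ fits into a distinguished triangle $L\to M\to R\to L[1]$ with $L\in\underline{C}^{t\le 0}$ and $R\in\underline{C}^{t\ge 0}[-1]$. Put $\underline{C}^{t\le i}=\underline{C}^{t\le 0}[-i]$. For an object $G$ and an integer $m\ge 0$, let $G[-m,m]$ be the class of all small coproducts of (copies of) objects $G[s]$ with $-m\le s\le m$. For $k\geq 1$ let $\overline{\langle G\rangle}^{[-m,m]}_{k}$ be the class of all retracts (direct summands) in $\underline{C}$ of elements of the $k$-th $\star$-power of $G[-m,m]$, and let $\overline{\langle G\rangle}^{[-m,m]}$ be the class of all retracts of elements of $[\{G[s]:-m\le s\le m\}]^{\mathrm{cl}}$. Definition (Neeman). A triangulated category $\underline{C}$ with small coproducts is weakly approximable if there exist an object $G$ such that $\{G\}$ compactly generates $\underline{C}$, a $t$-structure $t$ on $\underline{C}$, and an integer $m>0$ such that: (i) $G[m]\in\underline{C}^{t\le 0}$ and $\underline{C}(G[-m],X)=\{0\}$ for all $X\in\underline{C}^{t\le 0}$; (ii) for every $F\in\underline{C}^{t\le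 0}$ there exists a distinguished triangle $E\to F\to D\to E[1]$ with $D\in\underline{C}^{t\le -1}$ and $E\in\overline{\langle G\rangle}^{[-m,m]}$. It is approximable if $G$, $t$, $m$ can be chosen so that (i) holds and in (ii) one can always take $E\in\overline{\langle G\rangle}^{[-m,m]}_{m}$. *)

theory Defs
  imports "HOL-Algebra.Free_Abelian_Groups"
begin

unbundle cardinal_syntax

section \<open>Categories, coproducts, additive categories\<close>

text \<open>Hom-sets are indexed by objects and need not be disjoint.\<close>

record ('o, 'm) category =
  Obj :: "'o set"
  Hom :: "'o \<Rightarrow> 'o \<Rightarrow> 'm set"
  Id :: "'o \<Rightarrow> 'm"
  Comp :: "'m \<Rightarrow> 'm \<Rightarrow> 'm"  (infixr \<open>\<cdot>\<index>\<close> 70)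

locale category =
  fixes C :: "('o, 'm, 'z) category_scheme" (structure)
  assumes Id_in: "X \<in> Obj C \<Longrightarrow> Id C X \<in> Hom C X X"
    and Comp_in: "\<lbrakk>X \<in> Obj C; Y \<in> Obj C; Z \<in> Obj C; f \<in> Hom C X Y; g \<in> Hom C Y Z\<rbrakk>
      \<Longrightarrow> g \<cdot> f \<in> Hom C X Z"
    and Id_left: "\<lbrakk>X \<in> Obj C; Y \<in> Obj C; f \<in> Hom C X Y\<rbrakk> \<Longrightarrow> Id C Y \<cdot> f = f"
    and Id_right: "\<lbrakk>X \<in> Obj C; Y \<in> Obj C; f \<in> Hom C X Y\<rbrakk> \<Longrightarrow> f \<cdot> Id C X = f"
    and Comp_assoc: "\<lbrakk>W \<in> Obj C; X \<in> Obj C; Y \<in> Obj C; Z \<in> Obj C;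
      f \<in> Hom C W X; g \<in> Hom C X Y; h \<in> Hom C Y Z\<rbrakk> \<Longrightarrow> (h \<cdot> g) \<cdot> f = h \<cdot> (g \<cdot> f)"

definition is_iso :: "('o, 'm, 'z) category_scheme \<Rightarrow> 'o \<Rightarrow> 'o \<Rightarrow> 'm \<Rightarrow> bool" where
  "is_iso C X Y f \<longleftrightarrow> f \<in> Hom C X Y \<and>
     (\<exists>g\<in>Hom C Y X. g \<cdot>\<^bsub>C\<^esub> f = Id C X \<and> f \<cdot>\<^bsub>C\<^esub> g = Id C Y)"

definition iso_closed :: "('o, 'm, 'z) category_scheme \<Rightarrow> 'o set \<Rightarrow> bool" where
  "iso_closed C A \<longleftrightarrow> (\<forall>X\<in>A. \<forall>Y\<in>Obj C. (\<exists>f. is_iso C X Y f) \<longrightarrow> Y \<in> A)"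

definition retracts :: "('o, 'm, 'z) category_scheme \<Rightarrow> 'o set \<Rightarrow> 'o set" where
  "retracts C A = {X \<in> Obj C. \<exists>Z\<in>A. \<exists>i\<in>Hom C X Z. \<exists>p\<in>Hom C Z X. p \<cdot>\<^bsub>C\<^esub> i = Id C X}"

definition zero_object :: "('o, 'm, 'z) category_scheme \<Rightarrow> 'o \<Rightarrow> bool" where
  "zero_object C N \<longleftrightarrow> N \<in> Obj C \<and>
     (\<forall>X\<in>Obj C. (\<exists>!f. f \<in> Hom C X N) \<and> (\<exists>!f. f \<in> Hom C N X))"

definition is_coproduct ::
  "('o, 'm, 'z) category_scheme \<Rightarrow> 'i set \<Rightarrow> ('i \<Rightarrow> 'o) \<Rightarrow> 'o \<Rightarrow> ('i \<Rightarrow> 'm) \<Rightarrow> bool" where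
  "is_coproduct C I X Z \<iota> \<longleftrightarrow> Z \<in> Obj C \<and>
     (\<forall>i\<in>I. X i \<in> Obj C \<and> \<iota> i \<in> Hom C (X i) Z) \<and>
     (\<forall>Y\<in>Obj C. \<forall>f. (\<forall>i\<in>I. f i \<in> Hom C (X i) Y) \<longrightarrow>
        (\<exists>!h. h \<in> Hom C Z Y \<and> (\<forall>i\<in>I. h \<cdot>\<^bsub>C\<^esub> \<iota> i = f i)))"

record ('o, 'm) preadd_category = "('o, 'm) category" +
  Add :: "'m \<Rightarrow> 'm \<Rightarrow> 'm"
  Zero :: "'o \<Rightarrow> 'o \<Rightarrow> 'm"

definition hom_group :: "('o, 'm, 'z) preadd_category_scheme \<Rightarrow> 'o \<Rightarrow> 'o \<Rightarrow> 'm monoid" where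
  "hom_group C X Y = \<lparr>carrier = Hom C X Y, mult = Add C, one = Zero C X Y\<rparr>"

definition Hom_trivial :: "('o, 'm, 'z) preadd_category_scheme \<Rightarrow> 'o \<Rightarrow> 'o \<Rightarrow> bool" where
  "Hom_trivial C X Y \<longleftrightarrow> Hom C X Y = {Zero C X Y}"

locale additive_category = category C
  for C :: "('o, 'm, 'z) preadd_category_scheme" (structure) +
  assumes hom_comm_group: "\<lbrakk>X \<in> Obj C; Y \<in> Obj C\<rbrakk> \<Longrightarrow> comm_group (hom_group C X Y)"
    and Comp_Add: "\<lbrakk>X \<in> Obj C; Y \<in> Obj C; Z \<in> Obj C;
      f \<in> Hom C X Y; g \<in> Hom C Y Z; g' \<in> Hom C Y Z\<rbrakk>
      \<Longrightarrow> Add C g g' \<cdot> f = Add C (g \<cdot> f) (g' \<cdot> f)"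
    and Add_Comp: "\<lbrakk>X \<in> Obj C; Y \<in> Obj C; Z \<in> Obj C;
      f \<in> Hom C X Y; f' \<in> Hom C X Y; g \<in> Hom C Y Z\<rbrakk>
      \<Longrightarrow> g \<cdot> Add C f f' = Add C (g \<cdot> f) (g \<cdot> f')"
    and ex_zero_object: "\<exists>N. zero_object C N"
    and ex_binary_coproduct: "\<lbrakk>X \<in> Obj C; Y \<in> Obj C\<rbrakk>
      \<Longrightarrow> \<exists>Z \<iota>. is_coproduct C (UNIV :: bool set) (\<lambda>b. if b then X else Y) Z \<iota>"


section \<open>Triangulated categories\<close>

text \<open>\<open>ShO\<close> and \<open>ShM\<close> are the translation \<open>[1]\<close> on objects and on morphisms; the tuple
  \<open>(X, Y, Z, f, g, h)\<close> stands for the triangle \<open>X \<rightarrow> Y \<rightarrow> Z \<rightarrow> X[1]\<close> with maps \<open>f\<close>, \<open>g\<close>, \<open>h\<close>.\<close>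

record ('o, 'm) tri_category = "('o, 'm) preadd_category" +
  ShO :: "'o \<Rightarrow> 'o"
  ShM :: "'m \<Rightarrow> 'm"
  Dist :: "('o \<times> 'o \<times> 'o \<times> 'm \<times> 'm \<times> 'm) set"

text \<open>The translation is an additive automorphism of the category (Verdier's axioms TR1--TR4).\<close>

locale triangulated_category = additive_category C
  for C :: "('o, 'm, 'z) tri_category_scheme" (structure) +
  assumes ShO_bij: "bij_betw (ShO C) (Obj C) (Obj C)"
    and ShM_bij: "\<lbrakk>X \<in> Obj C; Y \<in> Obj C\<rbrakk>
      \<Longrightarrow> bij_betw (ShM C) (Hom C X Y) (Hom C (ShO C X) (ShO C Y))"
    and ShM_Id: "X \<in> Obj C \<Longrightarrow> ShM C (Id C X) = Id C (ShO C X)"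
    and ShM_Comp: "\<lbrakk>X \<in> Obj C; Y \<in> Obj C; Z \<in> Obj C; f \<in> Hom C X Y; g \<in> Hom C Y Z\<rbrakk>
      \<Longrightarrow> ShM C (g \<cdot> f) = ShM C g \<cdot> ShM C f"
    and ShM_Add: "\<lbrakk>X \<in> Obj C; Y \<in> Obj C; f \<in> Hom C X Y; g \<in> Hom C X Y\<rbrakk>
      \<Longrightarrow> ShM C (Add C f g) = Add C (ShM C f) (ShM C g)"
    and Dist_wf: "(X, Y, Z, f, g, h) \<in> Dist C \<Longrightarrow> X \<in> Obj C \<and> Y \<in> Obj C \<and> Z \<in> Obj C \<and>
      f \<in> Hom C X Y \<and> g \<in> Hom C Y Z \<and> h \<in> Hom C Z (ShO C X)"
    and TR1_iso: "\<lbrakk>(X, Y, Z, f, g, h) \<in> Dist C; X' \<in> Obj C; Y' \<in> Obj C; Z' \<in> Obj C;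
      f' \<in> Hom C X' Y'; g' \<in> Hom C Y' Z'; h' \<in> Hom C Z' (ShO C X');
      is_iso C X X' a; is_iso C Y Y' b; is_iso C Z Z' c;
      b \<cdot> f = f' \<cdot> a; c \<cdot> g = g' \<cdot> b; ShM C a \<cdot> h = h' \<cdot> c\<rbrakk>
      \<Longrightarrow> (X', Y', Z', f', g', h') \<in> Dist C"
    and TR1_Id: "\<lbrakk>X \<in> Obj C; zero_object C N\<rbrakk>
      \<Longrightarrow> (X, X, N, Id C X, Zero C X N, Zero C N (ShO C X)) \<in> Dist C"
    and TR1_cone: "\<lbrakk>X \<in> Obj C; Y \<in> Obj C; f \<in> Hom C X Y\<rbrakk>
      \<Longrightarrow> \<exists>Z g h. (X, Y, Z, f, g, h) \<in> Dist C"
    and TR2: "\<lbrakk>X \<in> Obj C; Y \<in> Obj C; Z \<in> Obj C;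
      f \<in> Hom C X Y; g \<in> Hom C Y Z; h \<in> Hom C Z (ShO C X)\<rbrakk>
      \<Longrightarrow> (X, Y, Z, f, g, h) \<in> Dist C \<longleftrightarrow>
        (Y, Z, ShO C X, g, h, inv\<^bsub>hom_group C (ShO C X) (ShO C Y)\<^esub> (ShM C f)) \<in> Dist C"
    and TR3: "\<lbrakk>(X, Y, Z, f, g, h) \<in> Dist C; (X', Y', Z', f', g', h') \<in> Dist C;
      a \<in> Hom C X X'; b \<in> Hom C Y Y'; b \<cdot> f = f' \<cdot> a\<rbrakk>
      \<Longrightarrow> \<exists>c\<in>Hom C Z Z'. c \<cdot> g = g' \<cdot> b \<and> ShM C a \<cdot> h = h' \<cdot> c"
    and TR4: "\<lbrakk>(X, Y, U, f, p, p') \<in> Dist C; (Y, Z, W, g, q, q') \<in> Dist C;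
      (X, Z, V, g \<cdot> f, r, r') \<in> Dist C\<rbrakk>
      \<Longrightarrow> \<exists>u\<in>Hom C U V. \<exists>v\<in>Hom C V W. (U, V, W, u, v, ShM C p \<cdot> q') \<in> Dist C \<and>
        u \<cdot> p = r \<cdot> g \<and> r' \<cdot> u = p' \<and> v \<cdot> r = q \<and> q' \<cdot> v = ShM C f \<cdot> r'"

text \<open>\<open>shift C i X\<close> is \<open>X[i]\<close>.\<close>

definition shift :: "('o, 'm, 'z) tri_category_scheme \<Rightarrow> int \<Rightarrow> 'o \<Rightarrow> 'o" where
  "shift C i = (if 0 \<le> i then ShO C ^^ nat i else inv_into (Obj C) (ShO C) ^^ nat (- i))"


section \<open>Small coproducts and compact objects\<close>

text \<open>A set is small if its cardinality is less than a fixed uncountable regular cardinal \<open>\<kappa>\<close>.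
  For \<open>\<kappa>\<close> strongly inaccessible this is smallness with respect to a Grothendieck universe.
  Up to bijection, every small set is a subset of the field of \<open>\<kappa>\<close>, so
  families indexed by sets over the type underlying \<open>\<kappa>\<close> are sufficient.\<close>

definition smallness_cardinal :: "'u rel \<Rightarrow> bool" where
  "smallness_cardinal \<kappa> \<longleftrightarrow> Card_order \<kappa> \<and> regularCard \<kappa> \<and> natLeq <o \<kappa>"

definition small :: "'u rel \<Rightarrow> 'a set \<Rightarrow> bool" where
  "small \<kappa> A \<longleftrightarrow> |A| <o \<kappa>"

definition has_small_coproducts :: "'u rel \<Rightarrow> ('o, 'm, 'z) category_scheme \<Rightarrow> bool" where
  "has_small_coproducts \<kappa> C \<longleftrightarrow> (\<forall>(I :: 'u set) X. small \<kappa> I \<longrightarrow> (\<forall>i\<in>I. X i \<in> Obj C) \<longrightarrow>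
     (\<exists>Z \<iota>. is_coproduct C I X Z \<iota>))"

text \<open>\<open>C(M, -)\<close> respects coproducts: the canonical homomorphism from the direct sum of the groups
  \<open>C(M, X\<^sub>i)\<close> to \<open>C(M, \<Coprod>X\<^sub>i)\<close> is an isomorphism.\<close>

definition compact_object ::
  "'u rel \<Rightarrow> ('o, 'm, 'z) preadd_category_scheme \<Rightarrow> 'o \<Rightarrow> bool" where
  "compact_object \<kappa> C M \<longleftrightarrow> M \<in> Obj C \<and>
     (\<forall>(I :: 'u set) X Z \<iota>. small \<kappa> I \<longrightarrow> is_coproduct C I X Z \<iota> \<longrightarrow>
        (\<lambda>g. gfinprod (hom_group C M Z) (\<lambda>i. \<iota> i \<cdot>\<^bsub>C\<^esub> g i) I)
          \<in> iso (sum_group I (\<lambda>i. hom_group C M (X i))) (hom_group C M Z))"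

text \<open>Local smallness, only demanded for morphisms out of compact objects. Requiring all hom-sets
  to be small is a stronger condition; together with the existence of small coproducts it forces
  \<open>\<kappa>\<close> to be strongly inaccessible unless all objects are zero, because
  \<open>C(\<Coprod>\<^sub>I X, X)\<close> is the \<open>I\<close>-fold power of \<open>C(X, X)\<close>.\<close>

definition compact_homs_small :: "'u rel \<Rightarrow> ('o, 'm, 'z) preadd_category_scheme \<Rightarrow> bool" where
  "compact_homs_small \<kappa> C \<longleftrightarrow>
     (\<forall>M X. compact_object \<kappa> C M \<longrightarrow> X \<in> Obj C \<longrightarrow> small \<kappa> (Hom C M X))"


section \<open>Classes of objects\<close>

definition ext_closed :: "('o, 'm, 'z) tri_category_scheme \<Rightarrow> 'o set \<Rightarrow> bool" where
  "ext_closed C A \<longleftrightarrow> (\<forall>N. zero_object C N \<longrightarrow> N \<in> A) \<and>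
     (\<forall>X Z Y f g h. (X, Z, Y, f, g, h) \<in> Dist C \<longrightarrow> X \<in> A \<longrightarrow> Y \<in> A \<longrightarrow> Z \<in> A)"

definition coprod_closed :: "'u rel \<Rightarrow> ('o, 'm, 'z) category_scheme \<Rightarrow> 'o set \<Rightarrow> bool" where
  "coprod_closed \<kappa> C A \<longleftrightarrow> (\<forall>(I :: 'u set) X Z \<iota>.
     small \<kappa> I \<longrightarrow> (\<forall>i\<in>I. X i \<in> A) \<longrightarrow> is_coproduct C I X Z \<iota> \<longrightarrow> Z \<in> A)"

definition cl :: "'u rel \<Rightarrow> ('o, 'm, 'z) tri_category_scheme \<Rightarrow> 'o set \<Rightarrow> 'o set" where
  "cl \<kappa> C P = \<Inter> {A. A \<subseteq> Obj C \<and> P \<subseteq> A \<and> ext_closed C A \<and> coprod_closed \<kappa> C A}"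

definition compactly_generates ::
  "'u rel \<Rightarrow> ('o, 'm, 'z) tri_category_scheme \<Rightarrow> 'o set \<Rightarrow> bool" where
  "compactly_generates \<kappa> C P \<longleftrightarrow>
     (\<forall>M\<in>P. compact_object \<kappa> C M) \<and> cl \<kappa> C (\<Union>i. shift C i ` P) = Obj C"

definition star :: "('o, 'm, 'z) tri_category_scheme \<Rightarrow> 'o set \<Rightarrow> 'o set \<Rightarrow> 'o set" where
  "star C A B = {Z. \<exists>X\<in>A. \<exists>Y\<in>B. \<exists>f g h. (X, Z, Y, f, g, h) \<in> Dist C}"

text \<open>The \<open>k\<close>-th \<open>\<star>\<close>-power; only meaningful for \<open>k \<ge> 1\<close>.\<close>

definition star_power :: "('o, 'm, 'z) tri_category_scheme \<Rightarrow> 'o set \<Rightarrow> nat \<Rightarrow> 'o set" where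
  "star_power C A k = (star C A ^^ (k - 1)) A"

definition weakly_negative :: "('o, 'm, 'z) tri_category_scheme \<Rightarrow> 'o set \<Rightarrow> bool" where
  "weakly_negative C P \<longleftrightarrow> (\<forall>M\<in>P. \<forall>M'\<in>P. \<forall>i>1. Hom_trivial C M (shift C i M'))"


section \<open>t-structures and approximability\<close>

text \<open>\<open>tge\<close> and \<open>tle\<close> are the classes \<open>C\<^bsup>t\<ge>0\<^esup>\<close> and \<open>C\<^bsup>t\<le>0\<^esup>\<close> (cohomological convention).\<close>

definition t_structure ::
  "('o, 'm, 'z) tri_category_scheme \<Rightarrow> 'o set \<Rightarrow> 'o set \<Rightarrow> bool" where
  "t_structure C tge tle \<longleftrightarrow> tge \<subseteq> Obj C \<and> tle \<subseteq> Obj C \<and> iso_closed C tge \<and> iso_closed C tle \<and>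
     tge \<subseteq> shift C 1 ` tge \<and> shift C 1 ` tle \<subseteq> tle \<and>
     (\<forall>X\<in>shift C 1 ` tle. \<forall>Y\<in>tge. Hom_trivial C X Y) \<and>
     (\<forall>M\<in>Obj C. \<exists>L\<in>tle. \<exists>R\<in>shift C (-1) ` tge. \<exists>f g h. (L, M, R, f, g, h) \<in> Dist C)"

definition t_le :: "('o, 'm, 'z) tri_category_scheme \<Rightarrow> 'o set \<Rightarrow> int \<Rightarrow> 'o set" where
  "t_le C tle i = shift C (- i) ` tle"

text \<open>The class \<open>G[-m, m]\<close>.\<close>

definition shift_coproducts ::
  "'u rel \<Rightarrow> ('o, 'm, 'z) tri_category_scheme \<Rightarrow> 'o \<Rightarrow> nat \<Rightarrow> 'o set" where
  "shift_coproducts \<kappa> C G m = {Z. \<exists>(I :: 'u set) s \<iota>. small \<kappa> I \<and>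
     (\<forall>i\<in>I. - int m \<le> s i \<and> s i \<le> int m) \<and> is_coproduct C I (\<lambda>i. shift C (s i) G) Z \<iota>}"

definition gen_bounded ::
  "'u rel \<Rightarrow> ('o, 'm, 'z) tri_category_scheme \<Rightarrow> 'o \<Rightarrow> nat \<Rightarrow> nat \<Rightarrow> 'o set" where
  "gen_bounded \<kappa> C G m k = retracts C (star_power C (shift_coproducts \<kappa> C G m) k)"

definition gen ::
  "'u rel \<Rightarrow> ('o, 'm, 'z) tri_category_scheme \<Rightarrow> 'o \<Rightarrow> nat \<Rightarrow> 'o set" where
  "gen \<kappa> C G m = retracts C (cl \<kappa> C ((\<lambda>s. shift C s G) ` {- int m..int m}))"

definition approx_orthogonality ::
  "('o, 'm, 'z) tri_category_scheme \<Rightarrow> 'o \<Rightarrow> 'o set \<Rightarrow> nat \<Rightarrow> bool" where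
  "approx_orthogonality C G tle m \<longleftrightarrow> shift C (int m) G \<in> tle \<and>
     (\<forall>X\<in>tle. Hom_trivial C (shift C (- int m) G) X)"

definition weakly_approximable ::
  "'u rel \<Rightarrow> ('o, 'm, 'z) tri_category_scheme \<Rightarrow> bool" where
  "weakly_approximable \<kappa> C \<longleftrightarrow> (\<exists>G\<in>Obj C. \<exists>tge tle. \<exists>m>0.
     compactly_generates \<kappa> C {G} \<and> t_structure C tge tle \<and> approx_orthogonality C G tle m \<and>
     (\<forall>F\<in>tle. \<exists>E\<in>gen \<kappa> C G m. \<exists>D\<in>t_le C tle (-1). \<exists>f g h. (E, F, D, f, g, h) \<in> Dist C))"

definition approximable ::
  "'u rel \<Rightarrow> ('o, 'm, 'z) tri_category_scheme \<Rightarrow> bool" where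
  "approximable \<kappa> C \<longleftrightarrow> (\<exists>G\<in>Obj C. \<exists>tge tle. \<exists>m>0.
     compactly_generates \<kappa> C {G} \<and> t_structure C tge tle \<and> approx_orthogonality C G tle m \<and>
     (\<forall>F\<in>tle. \<exists>E\<in>gen_bounded \<kappa> C G m m. \<exists>D\<in>t_le C tle (-1). \<exists>f g h.
        (E, F, D, f, g, h) \<in> Dist C))"

end

theory Submission
  imports Defs
begin

text \<open>
  Put \<open>S = {M[i] : M \<in> P, i \<ge> 0}\<close>. Since \<open>S\<close> consists of compact objects and is stable under
  \<open>[1]\<close>, the class \<open>U = [S]\<^sup>c\<^sup>l\<close> is the left part \<open>C\<^bsup>t\<le>0\<^esup>\<close> of a t-structure. Weak negativity gives
  \<open>C(K, U[2]) = 0\<close> for \<open>K = [P]\<^sup>c\<^sup>l\<close>, so extensions of objects of \<open>K\<close> by objects of \<open>U[1]\<close> split and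
  \<open>U[1] \<star> K \<subseteq> K \<star> U[1]\<close>. Hence \<open>K \<star> U[1]\<close> is closed under extensions and coproducts; it contains
  \<open>S\<close>, and therefore \<open>U \<subseteq> K \<star> U[1]\<close>. For the sum \<open>G\<close> of the elements of \<open>P\<close>, the set \<open>{G}\<close> is again
  weakly negative and generates, and applying this to \<open>{G}\<close> gives weak approximability.

  For approximability, let \<open>B\<^sub>i\<close> be the class of coproducts of elements of \<open>P\<^sub>i\<close>. By the same splitting
  argument \<open>B\<^sub>0 \<star> \<dots> \<star> B\<^sub>n\<close> is closed under extensions and coproducts, so it can replace
  \<open>[P]\<^sup>c\<^sup>l\<close>. Each \<open>M \<in> P\<close> is a retract of \<open>G\<close>, and the cone of \<open>G \<rightarrow> M\<close>, being a retract of \<open>G[1]\<close>,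
  lies in \<open>U[1]\<close>. With \<open>A\<close> the class of coproducts of copies of \<open>G\<close> this gives \<open>B\<^sub>i \<subseteq> A \<star> U[1]\<close>, and
  moving the factors \<open>U[1]\<close> to the right yields \<open>U \<subseteq> A \<star> \<dots> \<star> A \<star> U[1]\<close> with \<open>n + 1\<close> factors \<open>A\<close>.
\<close>

section \<open>Additive categories\<close>

text \<open>That \<open>U\<close> is the left part of a t-structure is proved without a
  representability theorem: the truncation of an object is a countable homotopy colimit of objects
  of \<open>U\<close>, for which smallness of hom-sets out of compact objects suffices. The
  recurring obstacle is that the axioms provide third maps of triangles without uniqueness. So
  coproducts of distinguished triangles do not come for free, and closure of
  \<open>A \<star> B\<close> under coproducts requires correcting arbitrary fill-ins by differences.
  Vanishing on generated classes is obtained by devissage: the orthogonal classes are closed under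
  extensions and coproducts, where compactness of the generators takes care of coproducts in the
  second variable. Weak negativity concerns exponents \<open>i > 1\<close>, hence \<open>m\<close>
  has to be at least \<open>2\<close>. The first part uses \<open>m = 2\<close>; the second uses
  \<open>m = n + 2\<close>, which also accommodates the \<open>n + 1\<close> factors. In the second
  part the t-structure remains the one generated by \<open>P\<close>, since the filtration is a
  filtration of \<open>P\<close>; \<open>G\<close> enters through the factors of the
  \<open>\<star>\<close>-product.\<close>

context category
begin

text \<open>Hom-sets may overlap and composition is a total function, so a morphism is carried
  together with membership of its source and target in \<open>Obj C\<close>; the facts below then
  chain without separate side conditions.\<close>

definition mor :: "'m \<Rightarrow> 'o \<Rightarrow> 'o \<Rightarrow> bool"  (\<open>\<langle>_ : _ \<rightarrow> _\<rangle>\<close>) where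
  "\<langle>f : X \<rightarrow> Y\<rangle> \<longleftrightarrow> X \<in> Obj C \<and> Y \<in> Obj C \<and> f \<in> Hom C X Y"

lemma mor_Obj: "\<langle>f : X \<rightarrow> Y\<rangle> \<Longrightarrow> X \<in> Obj C" "\<langle>f : X \<rightarrow> Y\<rangle> \<Longrightarrow> Y \<in> Obj C"
  by (auto simp: mor_def)

lemma mor_Hom: "\<langle>f : X \<rightarrow> Y\<rangle> \<Longrightarrow> f \<in> Hom C X Y"
  by (auto simp: mor_def)

lemma mor_Id [simp, intro]: "X \<in> Obj C \<Longrightarrow> \<langle>Id C X : X \<rightarrow> X\<rangle>"
  by (simp add: mor_def Id_in)

lemma mor_comp [intro]: "\<langle>f : X \<rightarrow> Y\<rangle> \<Longrightarrow> \<langle>g : Y \<rightarrow> Z\<rangle> \<Longrightarrow> \<langle>g \<cdot> f : X \<rightarrow> Z\<rangle>"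
  by (auto simp: mor_def intro: Comp_in)

lemma comp_Id: "\<langle>f : X \<rightarrow> Y\<rangle> \<Longrightarrow> Id C Y \<cdot> f = f" "\<langle>f : X \<rightarrow> Y\<rangle> \<Longrightarrow> f \<cdot> Id C X = f"
  by (auto simp: mor_def Id_left Id_right)

lemma comp_assoc:
  "\<langle>f : W \<rightarrow> X\<rangle> \<Longrightarrow> \<langle>g : X \<rightarrow> Y\<rangle> \<Longrightarrow> \<langle>h : Y \<rightarrow> Z\<rangle> \<Longrightarrow> (h \<cdot> g) \<cdot> f = h \<cdot> (g \<cdot> f)"
  by (auto simp: mor_def intro: Comp_assoc)

lemma zero_object_Obj: "zero_object C N \<Longrightarrow> N \<in> Obj C"
  by (simp add: zero_object_def)

lemma is_coproduct_Obj: "is_coproduct C I X Z \<iota> \<Longrightarrow> Z \<in> Obj C"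
  "is_coproduct C I X Z \<iota> \<Longrightarrow> i \<in> I \<Longrightarrow> X i \<in> Obj C"
  by (auto simp: is_coproduct_def)

lemma is_coproduct_mor: "is_coproduct C I X Z \<iota> \<Longrightarrow> i \<in> I \<Longrightarrow> \<langle>\<iota> i : X i \<rightarrow> Z\<rangle>"
  by (auto simp: is_coproduct_def mor_def)

lemma is_coproduct_ext:
  assumes "is_coproduct C I X Z \<iota>" "\<langle>h : Z \<rightarrow> Y\<rangle>" "\<langle>h' : Z \<rightarrow> Y\<rangle>"
    and "\<And>i. i \<in> I \<Longrightarrow> h \<cdot> \<iota> i = h' \<cdot> \<iota> i"
  shows "h = h'"
proof -
  have "\<exists>!k. k \<in> Hom C Z Y \<and> (\<forall>i\<in>I. k \<cdot> \<iota> i = h' \<cdot> \<iota> i)"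
    using assms mor_comp[OF is_coproduct_mor[OF assms(1)] assms(3)]
    unfolding is_coproduct_def mor_def by auto
  with assms show ?thesis
    unfolding mor_def by blast
qed

lemma is_coproduct_desc:
  assumes "is_coproduct C I X Z \<iota>" "Y \<in> Obj C" "\<And>i. i \<in> I \<Longrightarrow> \<langle>f i : X i \<rightarrow> Y\<rangle>"
  obtains h where "\<langle>h : Z \<rightarrow> Y\<rangle>" "\<And>i. i \<in> I \<Longrightarrow> h \<cdot> \<iota> i = f i"
  using assms unfolding is_coproduct_def mor_def by blast

lemma is_coproductI:
  assumes "Z \<in> Obj C" and "\<And>i. i \<in> I \<Longrightarrow> \<langle>\<iota> i : X i \<rightarrow> Z\<rangle>"
    and ex: "\<And>Y f. Y \<in> Obj C \<Longrightarrow> (\<And>i. i \<in> I \<Longrightarrow> \<langle>f i : X i \<rightarrow> Y\<rangle>)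
      \<Longrightarrow> \<exists>h. \<langle>h : Z \<rightarrow> Y\<rangle> \<and> (\<forall>i\<in>I. h \<cdot> \<iota> i = f i)"
    and un: "\<And>Y h h'. \<langle>h : Z \<rightarrow> Y\<rangle> \<Longrightarrow> \<langle>h' : Z \<rightarrow> Y\<rangle>
      \<Longrightarrow> (\<And>i. i \<in> I \<Longrightarrow> h \<cdot> \<iota> i = h' \<cdot> \<iota> i) \<Longrightarrow> h = h'"
  shows "is_coproduct C I X Z \<iota>"
  unfolding is_coproduct_def
proof (intro conjI ballI allI impI)
  fix Y f assume Y: "Y \<in> Obj C" and f: "\<forall>i\<in>I. f i \<in> Hom C (X i) Y"
  then have "\<exists>h. \<langle>h : Z \<rightarrow> Y\<rangle> \<and> (\<forall>i\<in>I. h \<cdot> \<iota> i = f i)"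
    using assms(2) by (intro ex) (auto simp: mor_def)
  then show "\<exists>!h. h \<in> Hom C Z Y \<and> (\<forall>i\<in>I. h \<cdot> \<iota> i = f i)"
    using un[of _ Y] assms(1) Y by (auto simp: mor_def)
qed (use assms(1,2) in \<open>auto simp: mor_def\<close>)

text \<open>Needed because \<open>has_small_coproducts\<close> and \<open>compact_object\<close>
  speak of index sets over the type underlying \<kappa>, while the proof uses families over pairs,
  disjoint unions and natural numbers.\<close>

lemma is_coproduct_reindex:
  assumes "bij_betw \<phi> J I" "is_coproduct C I X Z \<iota>"
  shows "is_coproduct C J (X \<circ> \<phi>) Z (\<iota> \<circ> \<phi>)"
proof (rule is_coproductI)
  have \<phi>: "\<phi> j \<in> I" if "j \<in> J" for j using assms(1) that by (auto simp: bij_betw_def)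
  show "Z \<in> Obj C" using assms(2) by (rule is_coproduct_Obj)
  show "\<langle>(\<iota> \<circ> \<phi>) j : (X \<circ> \<phi>) j \<rightarrow> Z\<rangle>" if "j \<in> J" for j
    using is_coproduct_mor[OF assms(2) \<phi>[OF that]] by simp
  have inv: "inv_into J \<phi> i \<in> J" "\<phi> (inv_into J \<phi> i) = i" if "i \<in> I" for i
    using assms(1) that by (auto simp: bij_betw_def inv_into_into f_inv_into_f)
  have inv': "inv_into J \<phi> (\<phi> j) = j" if "j \<in> J" for j
    using assms(1) that by (auto simp: bij_betw_def)
  show "\<exists>h. \<langle>h : Z \<rightarrow> Y\<rangle> \<and> (\<forall>j\<in>J. h \<cdot> (\<iota> \<circ> \<phi>) j = f j)"
    if Y: "Y \<in> Obj C" and f: "\<And>j. j \<in> J \<Longrightarrow> \<langle>f j : (X \<circ> \<phi>) j \<rightarrow> Y\<rangle>" for Y f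
  proof -
    have "\<langle>f (inv_into J \<phi> i) : X i \<rightarrow> Y\<rangle>" if "i \<in> I" for i
      using f[OF inv(1)[OF that]] inv(2)[OF that] by simp
    then obtain h where "\<langle>h : Z \<rightarrow> Y\<rangle>" "\<And>i. i \<in> I \<Longrightarrow> h \<cdot> \<iota> i = f (inv_into J \<phi> i)"
      using is_coproduct_desc[OF assms(2) Y, of "\<lambda>i. f (inv_into J \<phi> i)"] by blast
    then show ?thesis using \<phi> inv' by auto
  qed
  show "h = h'" if "\<langle>h : Z \<rightarrow> Y\<rangle>" "\<langle>h' : Z \<rightarrow> Y\<rangle>"
    "\<And>j. j \<in> J \<Longrightarrow> h \<cdot> (\<iota> \<circ> \<phi>) j = h' \<cdot> (\<iota> \<circ> \<phi>) j" for Y h h'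
    using that(3)[OF inv(1)] inv(2) by (intro is_coproduct_ext[OF assms(2) that(1,2)]) auto
qed

lemma is_coproduct_cong:
  assumes "is_coproduct C I X Z \<iota>" "\<And>i. i \<in> I \<Longrightarrow> X i = X' i" "\<And>i. i \<in> I \<Longrightarrow> \<iota> i = \<iota>' i"
  shows "is_coproduct C I X' Z \<iota>'"
  using assms unfolding is_coproduct_def by simp

lemma zero_object_coproduct:
  assumes "zero_object C N" shows "is_coproduct C {} X N \<iota>"
  using assms unfolding is_coproduct_def zero_object_def by auto

text \<open>A map out of \<open>Z\<close> is determined in two layers, first on each
  \<open>Y i\<close> and then on the summands of \<open>Y i\<close>.\<close>

lemma is_coproduct_Sigma:
  assumes Z: "is_coproduct C I Y Z \<iota>"
    and Y: "\<And>i. i \<in> I \<Longrightarrow> is_coproduct C (J i) (X i) (Y i) (\<epsilon> i)"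
  shows "is_coproduct C (Sigma I J) (\<lambda>(i, j). X i j) Z (\<lambda>(i, j). \<iota> i \<cdot> \<epsilon> i j)"
proof (rule is_coproductI)
  show "Z \<in> Obj C" using Z by (rule is_coproduct_Obj)
  show "\<langle>(case ij of (i, j) \<Rightarrow> \<iota> i \<cdot> \<epsilon> i j) : case ij of (i, j) \<Rightarrow> X i j \<rightarrow> Z\<rangle>"
    if "ij \<in> Sigma I J" for ij
    using that is_coproduct_mor[OF Y] is_coproduct_mor[OF Z] by (auto split: prod.split)
  show "\<exists>h. \<langle>h : Z \<rightarrow> T\<rangle> \<and> (\<forall>ij\<in>Sigma I J. h \<cdot> (case ij of (i, j) \<Rightarrow> \<iota> i \<cdot> \<epsilon> i j) = f ij)"
    if T: "T \<in> Obj C" and f: "\<And>ij. ij \<in> Sigma I J \<Longrightarrow> \<langle>f ij : case ij of (i, j) \<Rightarrow> X i j \<rightarrow> T\<rangle>" for T f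
  proof -
    have "\<exists>k. \<langle>k : Y i \<rightarrow> T\<rangle> \<and> (\<forall>j\<in>J i. k \<cdot> \<epsilon> i j = f (i, j))" if "i \<in> I" for i
    proof (rule is_coproduct_desc[OF Y[OF that] T, of "\<lambda>j. f (i, j)"])
      show "\<langle>f (i, j) : X i j \<rightarrow> T\<rangle>" if "j \<in> J i" for j
        using f[of "(i, j)"] \<open>i \<in> I\<close> that by simp
    qed blast
    then obtain k where k: "\<And>i. i \<in> I \<Longrightarrow> \<langle>k i : Y i \<rightarrow> T\<rangle>"
      "\<And>i j. i \<in> I \<Longrightarrow> j \<in> J i \<Longrightarrow> k i \<cdot> \<epsilon> i j = f (i, j)"
      by metis
    obtain h where h: "\<langle>h : Z \<rightarrow> T\<rangle>" "\<And>i. i \<in> I \<Longrightarrow> h \<cdot> \<iota> i = k i"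
      using is_coproduct_desc[OF Z T] k(1) by blast
    have "h \<cdot> (\<iota> i \<cdot> \<epsilon> i j) = f (i, j)" if "i \<in> I" "j \<in> J i" for i j
      using comp_assoc[OF is_coproduct_mor[OF Y[OF that(1)] that(2)] is_coproduct_mor[OF Z that(1)] h(1)]
      by (simp add: h that k)
    with h(1) show ?thesis by auto
  qed
  show "h = h'" if h: "\<langle>h : Z \<rightarrow> T\<rangle>" "\<langle>h' : Z \<rightarrow> T\<rangle>"
    and eq: "\<And>ij. ij \<in> Sigma I J \<Longrightarrow> h \<cdot> (case ij of (i, j) \<Rightarrow> \<iota> i \<cdot> \<epsilon> i j) = h' \<cdot> (case ij of (i, j) \<Rightarrow> \<iota> i \<cdot> \<epsilon> i j)"
  for T h h'
  proof (rule is_coproduct_ext[OF Z h], rule is_coproduct_ext[OF Y])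
    fix i j assume i: "i \<in> I" and j: "j \<in> J i"
    show "(h \<cdot> \<iota> i) \<cdot> \<epsilon> i j = (h' \<cdot> \<iota> i) \<cdot> \<epsilon> i j"
      using eq[of "(i, j)"] i j
        comp_assoc[OF is_coproduct_mor[OF Y[OF i] j] is_coproduct_mor[OF Z i] h(1)]
        comp_assoc[OF is_coproduct_mor[OF Y[OF i] j] is_coproduct_mor[OF Z i] h(2)] by simp
  qed (use h is_coproduct_mor[OF Z] in auto)
qed

end

section \<open>Arithmetic of hom-groups, zero objects and projections\<close>

context additive_category
begin

abbreviation add :: "'m \<Rightarrow> 'm \<Rightarrow> 'm"  (infixl \<open>\<boxplus>\<close> 65) where
  "f \<boxplus> g \<equiv> Add C f g"

text \<open>\<open>Add\<close> does not record source and target, but an inverse is taken in one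
  particular hom-group, so both objects are arguments.\<close>

definition neg :: "'o \<Rightarrow> 'o \<Rightarrow> 'm \<Rightarrow> 'm" where
  "neg X Y f = inv\<^bsub>hom_group C X Y\<^esub> f"

lemma mor_Zero [simp, intro]: "X \<in> Obj C \<Longrightarrow> Y \<in> Obj C \<Longrightarrow> \<langle>Zero C X Y : X \<rightarrow> Y\<rangle>"
proof -
  assume XY: "X \<in> Obj C" "Y \<in> Obj C"
  interpret G: comm_group "hom_group C X Y" using hom_comm_group[OF XY] .
  show ?thesis using G.one_closed XY by (simp add: mor_def hom_group_def)
qed

lemma mor_add [intro]: "\<langle>f : X \<rightarrow> Y\<rangle> \<Longrightarrow> \<langle>g : X \<rightarrow> Y\<rangle> \<Longrightarrow> \<langle>f \<boxplus> g : X \<rightarrow> Y\<rangle>"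
proof -
  assume fg: "\<langle>f : X \<rightarrow> Y\<rangle>" "\<langle>g : X \<rightarrow> Y\<rangle>"
  interpret G: comm_group "hom_group C X Y" using hom_comm_group[OF mor_Obj[OF fg(1)]] .
  show ?thesis using G.m_closed fg by (simp add: mor_def hom_group_def)
qed

lemma mor_neg [intro]: "\<langle>f : X \<rightarrow> Y\<rangle> \<Longrightarrow> \<langle>neg X Y f : X \<rightarrow> Y\<rangle>"
proof -
  assume f: "\<langle>f : X \<rightarrow> Y\<rangle>"
  interpret G: comm_group "hom_group C X Y" using hom_comm_group[OF mor_Obj[OF f(1)]] .
  show ?thesis using G.inv_closed[of f] f by (simp add: mor_def hom_group_def neg_def)
qed

lemma add_Zero:
  assumes "\<langle>f : X \<rightarrow> Y\<rangle>"
  shows "f \<boxplus> Zero C X Y = f" "Zero C X Y \<boxplus> f = f"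
proof -
  interpret G: comm_group "hom_group C X Y" using hom_comm_group[OF mor_Obj[OF assms(1)]] .
  show "f \<boxplus> Zero C X Y = f" "Zero C X Y \<boxplus> f = f"
    using G.r_one[of f] G.l_one[of f] assms by (simp_all add: mor_def hom_group_def)
qed

lemma add_neg:
  assumes "\<langle>f : X \<rightarrow> Y\<rangle>"
  shows "f \<boxplus> neg X Y f = Zero C X Y" "neg X Y f \<boxplus> f = Zero C X Y"
proof -
  interpret G: comm_group "hom_group C X Y" using hom_comm_group[OF mor_Obj[OF assms(1)]] .
  show "f \<boxplus> neg X Y f = Zero C X Y" "neg X Y f \<boxplus> f = Zero C X Y"
    using G.r_inv[of f] G.l_inv[of f] assms by (simp_all add: mor_def hom_group_def neg_def)
qed

lemma add_assoc:
  assumes "\<langle>f : X \<rightarrow> Y\<rangle>" "\<langle>g : X \<rightarrow> Y\<rangle>" "\<langle>h : X \<rightarrow> Y\<rangle>"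
  shows "f \<boxplus> g \<boxplus> h = f \<boxplus> (g \<boxplus> h)"
proof -
  interpret G: comm_group "hom_group C X Y" using hom_comm_group[OF mor_Obj[OF assms(1)]] .
  show ?thesis using G.m_assoc[of f g h] assms by (simp add: mor_def hom_group_def)
qed

lemma add_commute:
  assumes "\<langle>f : X \<rightarrow> Y\<rangle>" "\<langle>g : X \<rightarrow> Y\<rangle>"
  shows "f \<boxplus> g = g \<boxplus> f"
proof -
  interpret G: comm_group "hom_group C X Y" using hom_comm_group[OF mor_Obj[OF assms(1)]] .
  show ?thesis using G.m_comm[of f g] assms by (simp add: mor_def hom_group_def)
qed

lemma add_eq_self:
  assumes "\<langle>f : X \<rightarrow> Y\<rangle>" "\<langle>g : X \<rightarrow> Y\<rangle>" "f \<boxplus> g = f"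
  shows "g = Zero C X Y"
proof -
  interpret G: comm_group "hom_group C X Y" using hom_comm_group[OF mor_Obj[OF assms(1)]] .
  show ?thesis using G.l_cancel_one'[of f g] assms by (simp add: mor_def hom_group_def)
qed

lemma neg_unique:
  assumes "\<langle>f : X \<rightarrow> Y\<rangle>" "\<langle>g : X \<rightarrow> Y\<rangle>" "f \<boxplus> g = Zero C X Y"
  shows "g = neg X Y f"
proof -
  interpret G: comm_group "hom_group C X Y" using hom_comm_group[OF mor_Obj[OF assms(1)]] .
  show ?thesis using G.inv_unique'[of f g] G.m_comm[of f g] assms
    by (simp add: mor_def hom_group_def neg_def)
qed

lemma neg_neg:
  assumes "\<langle>f : X \<rightarrow> Y\<rangle>" shows "neg X Y (neg X Y f) = f"
  using neg_unique[OF mor_neg[OF assms] assms] add_neg(2)[OF assms] by simp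

lemma comp_add:
  "\<langle>f : X \<rightarrow> Y\<rangle> \<Longrightarrow> \<langle>f' : X \<rightarrow> Y\<rangle> \<Longrightarrow> \<langle>g : Y \<rightarrow> Z\<rangle> \<Longrightarrow> g \<cdot> (f \<boxplus> f') = g \<cdot> f \<boxplus> g \<cdot> f'"
  by (auto simp: mor_def intro: Add_Comp)

lemma add_comp:
  "\<langle>f : X \<rightarrow> Y\<rangle> \<Longrightarrow> \<langle>g : Y \<rightarrow> Z\<rangle> \<Longrightarrow> \<langle>g' : Y \<rightarrow> Z\<rangle> \<Longrightarrow> (g \<boxplus> g') \<cdot> f = g \<cdot> f \<boxplus> g' \<cdot> f"
  by (auto simp: mor_def intro: Comp_Add)

lemma comp_Zero:
  assumes "\<langle>g : Y \<rightarrow> Z\<rangle>" "X \<in> Obj C" shows "g \<cdot> Zero C X Y = Zero C X Z"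
proof -
  have z: "\<langle>Zero C X Y : X \<rightarrow> Y\<rangle>" using assms mor_Obj by blast
  have "g \<cdot> Zero C X Y \<boxplus> g \<cdot> Zero C X Y = g \<cdot> Zero C X Y"
    using comp_add[OF z z assms(1)] add_Zero[OF z] by simp
  then show ?thesis using add_eq_self mor_comp[OF z assms(1)] by blast
qed

lemma Zero_comp:
  assumes "\<langle>f : X \<rightarrow> Y\<rangle>" "Z \<in> Obj C" shows "Zero C Y Z \<cdot> f = Zero C X Z"
proof -
  have z: "\<langle>Zero C Y Z : Y \<rightarrow> Z\<rangle>" using assms mor_Obj by blast
  have "Zero C Y Z \<cdot> f \<boxplus> Zero C Y Z \<cdot> f = Zero C Y Z \<cdot> f"
    using add_comp[OF assms(1) z z] add_Zero[OF z] by simp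
  then show ?thesis using add_eq_self mor_comp[OF assms(1) z] by blast
qed

lemma neg_Zero: "X \<in> Obj C \<Longrightarrow> Y \<in> Obj C \<Longrightarrow> neg X Y (Zero C X Y) = Zero C X Y"
  using neg_unique[of "Zero C X Y" X Y "Zero C X Y"] add_Zero[of "Zero C X Y" X Y] by simp

lemma comp_neg:
  assumes "\<langle>f : X \<rightarrow> Y\<rangle>" "\<langle>g : Y \<rightarrow> Z\<rangle>" shows "g \<cdot> neg X Y f = neg X Z (g \<cdot> f)"
  by (rule neg_unique)
    (use assms comp_add[OF assms(1) mor_neg[OF assms(1)] assms(2)] add_neg(1)[OF assms(1)]
        comp_Zero[OF assms(2)] mor_Obj in \<open>auto simp flip: comp_add\<close>)

lemma neg_comp:
  assumes "\<langle>f : X \<rightarrow> Y\<rangle>" "\<langle>g : Y \<rightarrow> Z\<rangle>" shows "neg Y Z g \<cdot> f = neg X Z (g \<cdot> f)"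
  by (rule neg_unique)
    (use assms add_comp[OF assms(1,2) mor_neg[OF assms(2)]] add_neg(1)[OF assms(2)]
        Zero_comp[OF assms(1)] mor_Obj in \<open>auto simp flip: add_comp\<close>)

lemma neg_eq_Zero:
  assumes "\<langle>f : X \<rightarrow> Y\<rangle>" "neg X Y f = Zero C X Y" shows "f = Zero C X Y"
  using neg_neg[OF assms(1)] assms neg_Zero mor_Obj by metis

definition sub :: "'o \<Rightarrow> 'o \<Rightarrow> 'm \<Rightarrow> 'm \<Rightarrow> 'm" where
  "sub X Y f g = f \<boxplus> neg X Y g"

lemma mor_sub [intro]: "\<langle>f : X \<rightarrow> Y\<rangle> \<Longrightarrow> \<langle>g : X \<rightarrow> Y\<rangle> \<Longrightarrow> \<langle>sub X Y f g : X \<rightarrow> Y\<rangle>"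
  by (auto simp: sub_def)

lemma add_sub:
  assumes "\<langle>f : X \<rightarrow> Y\<rangle>" "\<langle>g : X \<rightarrow> Y\<rangle>" shows "g \<boxplus> sub X Y f g = f"
proof -
  have "g \<boxplus> sub X Y f g = f \<boxplus> neg X Y g \<boxplus> g"
    unfolding sub_def using assms by (intro add_commute) auto
  also have "\<dots> = f \<boxplus> (neg X Y g \<boxplus> g)" using assms by (intro add_assoc) auto
  finally show ?thesis using assms by (simp add: add_neg add_Zero)
qed

lemma sub_eq_Zero_iff:
  assumes "\<langle>f : X \<rightarrow> Y\<rangle>" "\<langle>g : X \<rightarrow> Y\<rangle>" shows "sub X Y f g = Zero C X Y \<longleftrightarrow> f = g"
  using add_sub[OF assms] add_Zero(1)[OF assms(2)] add_neg(1)[OF assms(1)] unfolding sub_def by metis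

text \<open>The form in which a non-canonical map gets corrected: subtracting its known error
  returns the wanted map.\<close>

lemma sub_sub:
  assumes "\<langle>f : X \<rightarrow> Y\<rangle>" "\<langle>g : X \<rightarrow> Y\<rangle>" shows "sub X Y f (sub X Y f g) = g"
proof -
  have "sub X Y f g \<boxplus> g = f"
    using add_commute[OF mor_sub[OF assms] assms(2)] add_sub[OF assms] by simp
  then have "sub X Y f (sub X Y f g) = sub X Y f g \<boxplus> g \<boxplus> neg X Y (sub X Y f g)"
    by (simp add: sub_def)
  also have "\<dots> = g \<boxplus> sub X Y f g \<boxplus> neg X Y (sub X Y f g)"
    using add_commute[OF mor_sub[OF assms] assms(2)] by simp
  also have "\<dots> = g \<boxplus> (sub X Y f g \<boxplus> neg X Y (sub X Y f g))"
    using assms by (intro add_assoc) auto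
  finally show ?thesis using add_neg(1)[OF mor_sub[OF assms]] add_Zero(1)[OF assms(2)] by simp
qed

lemma comp_sub:
  assumes "\<langle>f : X \<rightarrow> Y\<rangle>" "\<langle>f' : X \<rightarrow> Y\<rangle>" "\<langle>g : Y \<rightarrow> Z\<rangle>"
  shows "g \<cdot> sub X Y f f' = sub X Z (g \<cdot> f) (g \<cdot> f')"
  unfolding sub_def comp_add[OF assms(1) mor_neg[OF assms(2)] assms(3)] comp_neg[OF assms(2,3)] ..

lemma sub_comp:
  assumes "\<langle>f : X \<rightarrow> Y\<rangle>" "\<langle>g : Y \<rightarrow> Z\<rangle>" "\<langle>g' : Y \<rightarrow> Z\<rangle>"
  shows "sub Y Z g g' \<cdot> f = sub X Z (g \<cdot> f) (g' \<cdot> f)"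
  unfolding sub_def add_comp[OF assms(1,2) mor_neg[OF assms(3)]] neg_comp[OF assms(1,3)] ..

lemma Hom_trivial_iff:
  assumes "X \<in> Obj C" "Y \<in> Obj C"
  shows "Hom_trivial C X Y \<longleftrightarrow> (\<forall>f. \<langle>f : X \<rightarrow> Y\<rangle> \<longrightarrow> f = Zero C X Y)"
  using mor_Zero[OF assms] unfolding Hom_trivial_def mor_def by auto

lemma Hom_trivialD:
  "Hom_trivial C X Y \<Longrightarrow> \<langle>f : X \<rightarrow> Y\<rangle> \<Longrightarrow> f = Zero C X Y"
  unfolding Hom_trivial_def mor_def by auto

lemma zero_object_to: "zero_object C N \<Longrightarrow> \<langle>f : X \<rightarrow> N\<rangle> \<Longrightarrow> f = Zero C X N"
  using mor_Zero[of X N] unfolding zero_object_def mor_def by blast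

lemma zero_object_from: "zero_object C N \<Longrightarrow> \<langle>f : N \<rightarrow> X\<rangle> \<Longrightarrow> f = Zero C N X"
  using mor_Zero[of N X] unfolding zero_object_def mor_def by blast

lemma zero_object_iff: "zero_object C N \<longleftrightarrow> N \<in> Obj C \<and> Id C N = Zero C N N"
proof
  assume "zero_object C N"
  then show "N \<in> Obj C \<and> Id C N = Zero C N N"
    using zero_object_to zero_object_Obj by blast
next
  assume N: "N \<in> Obj C \<and> Id C N = Zero C N N"
  have "f = Zero C X N" if "\<langle>f : X \<rightarrow> N\<rangle>" for f X
    using comp_Id(1)[OF that] Zero_comp[OF that, of N] N by simp
  moreover have "f = Zero C N X" if "\<langle>f : N \<rightarrow> X\<rangle>" for f X
    using comp_Id(2)[OF that] comp_Zero[OF that, of N] N by simp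
  ultimately show "zero_object C N"
    using N mor_Zero unfolding zero_object_def mor_def by metis
qed

text \<open>The universal property applied to the family that is the identity at \<open>i\<close>
  and zero elsewhere.\<close>

lemma is_coproduct_proj:
  assumes "is_coproduct C I X Z \<iota>" "i \<in> I"
  obtains \<pi> where "\<langle>\<pi> : Z \<rightarrow> X i\<rangle>" "\<pi> \<cdot> \<iota> i = Id C (X i)"
    "\<And>j. j \<in> I \<Longrightarrow> j \<noteq> i \<Longrightarrow> \<pi> \<cdot> \<iota> j = Zero C (X j) (X i)"
proof -
  note [simp] = is_coproduct_Obj[OF assms(1)]
  obtain \<pi> where p: "\<langle>\<pi> : Z \<rightarrow> X i\<rangle>"
    "\<And>j. j \<in> I \<Longrightarrow> \<pi> \<cdot> \<iota> j = (if j = i then Id C (X i) else Zero C (X j) (X i))"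
    by (rule is_coproduct_desc[OF assms(1), of "X i" "\<lambda>j. if j = i then Id C (X i) else Zero C (X j) (X i)"])
      (use assms(2) in auto)
  show thesis
    by (rule that[OF p(1)]) (use p(2) assms(2) in auto)
qed

end

section \<open>Triangulated categories\<close>

context triangulated_category
begin

subsection \<open>The translation\<close>

lemma ShO_Obj [simp, intro]: "X \<in> Obj C \<Longrightarrow> ShO C X \<in> Obj C"
  using ShO_bij by (auto simp: bij_betw_def)

lemma ShO_inj: "X \<in> Obj C \<Longrightarrow> Y \<in> Obj C \<Longrightarrow> ShO C X = ShO C Y \<Longrightarrow> X = Y"
  using ShO_bij by (auto simp: bij_betw_def inj_on_def)

lemma ShO_cases:
  assumes "Y \<in> Obj C" obtains X where "X \<in> Obj C" "Y = ShO C X"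
  using assms ShO_bij by (auto simp: bij_betw_def)

lemma mor_ShM [intro]: "\<langle>f : X \<rightarrow> Y\<rangle> \<Longrightarrow> \<langle>ShM C f : ShO C X \<rightarrow> ShO C Y\<rangle>"
  using ShM_bij[of X Y] by (auto simp: bij_betw_def mor_def)

lemma ShM_inj: "\<langle>f : X \<rightarrow> Y\<rangle> \<Longrightarrow> \<langle>g : X \<rightarrow> Y\<rangle> \<Longrightarrow> ShM C f = ShM C g \<Longrightarrow> f = g"
  using ShM_bij[of X Y] by (auto simp: bij_betw_def mor_def inj_on_def)

lemma ShM_cases:
  assumes "\<langle>g : ShO C X \<rightarrow> ShO C Y\<rangle>" "X \<in> Obj C" "Y \<in> Obj C"
  obtains f where "\<langle>f : X \<rightarrow> Y\<rangle>" "g = ShM C f"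
  using assms ShM_bij[of X Y] by (auto simp: bij_betw_def mor_def)

lemma ShM_comp: "\<langle>f : X \<rightarrow> Y\<rangle> \<Longrightarrow> \<langle>g : Y \<rightarrow> Z\<rangle> \<Longrightarrow> ShM C (g \<cdot> f) = ShM C g \<cdot> ShM C f"
  by (auto simp: mor_def intro: ShM_Comp)

lemma ShM_add: "\<langle>f : X \<rightarrow> Y\<rangle> \<Longrightarrow> \<langle>g : X \<rightarrow> Y\<rangle> \<Longrightarrow> ShM C (f \<boxplus> g) = ShM C f \<boxplus> ShM C g"
  by (auto simp: mor_def intro: ShM_Add)

lemma ShM_Zero:
  assumes "X \<in> Obj C" "Y \<in> Obj C"
  shows "ShM C (Zero C X Y) = Zero C (ShO C X) (ShO C Y)"
proof -
  have "\<langle>ShM C (Zero C X Y) : ShO C X \<rightarrow> ShO C Y\<rangle>" using assms by auto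
  then show ?thesis
    using add_eq_self[of "ShM C (Zero C X Y)" "ShO C X" "ShO C Y" "ShM C (Zero C X Y)"]
      ShM_add[of "Zero C X Y" X Y "Zero C X Y"] add_Zero[of "Zero C X Y" X Y] assms by simp
qed

lemma ShM_eq_Zero:
  assumes "\<langle>f : X \<rightarrow> Y\<rangle>" "ShM C f = Zero C (ShO C X) (ShO C Y)" shows "f = Zero C X Y"
  by (rule ShM_inj[OF assms(1)]) (use assms mor_Obj ShM_Zero in auto)

lemma ShM_neg:
  assumes "\<langle>f : X \<rightarrow> Y\<rangle>" shows "ShM C (neg X Y f) = neg (ShO C X) (ShO C Y) (ShM C f)"
  by (rule neg_unique)
    (use assms ShM_add[OF assms mor_neg[OF assms]] add_neg(1)[OF assms] ShM_Zero mor_Obj in \<open>auto\<close>)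

lemma ShM_sub:
  assumes "\<langle>f : X \<rightarrow> Y\<rangle>" "\<langle>g : X \<rightarrow> Y\<rangle>"
  shows "ShM C (sub X Y f g) = sub (ShO C X) (ShO C Y) (ShM C f) (ShM C g)"
  unfolding sub_def ShM_add[OF assms(1) mor_neg[OF assms(2)]] ShM_neg[OF assms(2)] ..

lemma shift_0 [simp]: "shift C 0 X = X"
  by (simp add: shift_def)

lemma shift_1 [simp]: "shift C 1 = ShO C"
  by (simp add: shift_def fun_eq_iff)

lemma inv_ShO: "X \<in> Obj C \<Longrightarrow> inv_into (Obj C) (ShO C) X \<in> Obj C"
  "X \<in> Obj C \<Longrightarrow> ShO C (inv_into (Obj C) (ShO C) X) = X"
  using ShO_bij by (auto simp: bij_betw_def inv_into_into f_inv_into_f)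

lemma shift_Obj [simp, intro]:
  assumes "X \<in> Obj C" shows "shift C i X \<in> Obj C"
proof -
  have "(ShO C ^^ n) X \<in> Obj C" "(inv_into (Obj C) (ShO C) ^^ n) X \<in> Obj C" for n
    using assms by (induction n) (auto simp: inv_ShO)
  then show ?thesis by (simp add: shift_def)
qed

lemma ShO_shift:
  assumes "X \<in> Obj C" shows "ShO C (shift C i X) = shift C (i + 1) X"
proof (cases "0 \<le> i")
  case True
  then have "nat (i + 1) = Suc (nat i)" by simp
  with True show ?thesis by (simp add: shift_def)
next
  case False
  then obtain n where n: "i = - int (Suc n)"
    by (metis add_diff_cancel_left' le_less_linear negD of_nat_0_le_iff of_nat_Suc)
  have "(inv_into (Obj C) (ShO C) ^^ k) X \<in> Obj C" for k
    using assms by (induction k) (auto simp: inv_ShO)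
  then show ?thesis using n by (simp add: shift_def inv_ShO nat_add_distrib)
qed

lemma shift_shift:
  assumes "X \<in> Obj C" shows "shift C i (shift C j X) = shift C (i + j) X"
proof (induction i rule: int_induct[of _ 0])
  case (step1 i)
  have "shift C (i + 1) (shift C j X) = ShO C (shift C i (shift C j X))"
    using assms by (simp add: ShO_shift)
  also have "\<dots> = shift C (i + j + 1) X" using assms step1 by (simp add: ShO_shift)
  finally show ?case by (simp add: ac_simps)
next
  case (step2 i)
  have "ShO C (shift C (i - 1) (shift C j X)) = shift C i (shift C j X)"
    using assms by (simp add: ShO_shift)
  also have "\<dots> = ShO C (shift C (i - 1 + j) X)"
    using assms step2 by (simp add: ShO_shift)
  finally show ?case using assms by (blast intro: ShO_inj)
qed simp

lemma Hom_trivial_ShO: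
  assumes "X \<in> Obj C" "Y \<in> Obj C"
  shows "Hom_trivial C (ShO C X) (ShO C Y) \<longleftrightarrow> Hom_trivial C X Y"
proof
  assume "Hom_trivial C (ShO C X) (ShO C Y)"
  then show "Hom_trivial C X Y"
    using assms Hom_trivialD ShM_eq_Zero by (metis Hom_trivial_iff mor_ShM)
next
  assume "Hom_trivial C X Y"
  then show "Hom_trivial C (ShO C X) (ShO C Y)"
    using assms by (metis Hom_trivialD Hom_trivial_iff ShM_Zero ShM_cases ShO_Obj)
qed

lemma Hom_trivial_shift:
  assumes "X \<in> Obj C" "Y \<in> Obj C"
  shows "Hom_trivial C (shift C i X) (shift C i Y) \<longleftrightarrow> Hom_trivial C X Y"
proof (induction i rule: int_induct[of _ 0])
  case (step1 i)
  then show ?case using assms Hom_trivial_ShO[of "shift C i X" "shift C i Y"] by (simp add: ShO_shift)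
next
  case (step2 i)
  then show ?case using assms Hom_trivial_ShO[of "shift C (i - 1) X" "shift C (i - 1) Y"]
    by (simp add: ShO_shift)
qed simp

lemma Hom_trivial_shift_left:
  assumes "X \<in> Obj C" "Y \<in> Obj C"
  shows "Hom_trivial C (shift C i X) Y \<longleftrightarrow> Hom_trivial C X (shift C (- i) Y)"
  using Hom_trivial_shift[of X "shift C (- i) Y" i] assms by (simp add: shift_shift)

lemma zero_object_ShO: "zero_object C N \<Longrightarrow> zero_object C (ShO C N)"
  using ShM_Id ShM_Zero by (simp add: zero_object_iff) metis

text \<open>Translation is bijective on objects and on hom-sets, so every cocone under the
  translated family is itself a translate, and the universal property can be transported.\<close>

lemma is_coproduct_ShO:
  assumes "is_coproduct C I X Z \<iota>"
  shows "is_coproduct C I (\<lambda>i. ShO C (X i)) (ShO C Z) (\<lambda>i. ShM C (\<iota> i))"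
proof (rule is_coproductI)
  note [simp] = is_coproduct_Obj[OF assms]
  show "ShO C Z \<in> Obj C" by simp
  show "\<langle>ShM C (\<iota> i) : ShO C (X i) \<rightarrow> ShO C Z\<rangle>" if "i \<in> I" for i
    using is_coproduct_mor[OF assms that] by auto
  show "\<exists>h. \<langle>h : ShO C Z \<rightarrow> Y\<rangle> \<and> (\<forall>i\<in>I. h \<cdot> ShM C (\<iota> i) = f i)"
    if "Y \<in> Obj C" and f: "\<And>i. i \<in> I \<Longrightarrow> \<langle>f i : ShO C (X i) \<rightarrow> Y\<rangle>" for Y f
  proof -
    obtain Y' where Y: "Y' \<in> Obj C" "Y = ShO C Y'" using \<open>Y \<in> Obj C\<close> by (rule ShO_cases)
    have "\<exists>f'. \<langle>f' : X i \<rightarrow> Y'\<rangle> \<and> f i = ShM C f'" if "i \<in> I" for i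
      using f[OF that] Y that by (metis ShM_cases is_coproduct_Obj(2)[OF assms])
    then obtain f' where f': "\<And>i. i \<in> I \<Longrightarrow> \<langle>f' i : X i \<rightarrow> Y'\<rangle>" "\<And>i. i \<in> I \<Longrightarrow> f i = ShM C (f' i)"
      by metis
    obtain h where h: "\<langle>h : Z \<rightarrow> Y'\<rangle>" "\<And>i. i \<in> I \<Longrightarrow> h \<cdot> \<iota> i = f' i"
      using is_coproduct_desc[OF assms Y(1) f'(1)] by blast
    have "ShM C h \<cdot> ShM C (\<iota> i) = f i" if "i \<in> I" for i
      using ShM_comp[OF is_coproduct_mor[OF assms that] h(1)] h(2) f'(2) that by simp
    with h(1) Y show ?thesis by blast
  qed
  show "h = h'" if h: "\<langle>h : ShO C Z \<rightarrow> Y\<rangle>" "\<langle>h' : ShO C Z \<rightarrow> Y\<rangle>"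
    "\<And>i. i \<in> I \<Longrightarrow> h \<cdot> ShM C (\<iota> i) = h' \<cdot> ShM C (\<iota> i)" for Y h h'
  proof -
    obtain Y' where Y: "Y' \<in> Obj C" "Y = ShO C Y'" using mor_Obj(2)[OF h(1)] by (rule ShO_cases)
    obtain k where k: "\<langle>k : Z \<rightarrow> Y'\<rangle>" "h = ShM C k"
      using ShM_cases[of h Z Y'] h(1) Y by auto
    obtain k' where k': "\<langle>k' : Z \<rightarrow> Y'\<rangle>" "h' = ShM C k'"
      using ShM_cases[of h' Z Y'] h(2) Y by auto
    have "k = k'"
    proof (rule is_coproduct_ext[OF assms k(1) k'(1)])
      fix i assume i: "i \<in> I"
      note \<iota> = is_coproduct_mor[OF assms i]
      show "k \<cdot> \<iota> i = k' \<cdot> \<iota> i"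
        by (rule ShM_inj) (use \<iota> k k' h(3)[OF i] in \<open>auto simp: ShM_comp[OF \<iota>]\<close>)
    qed
    then show ?thesis using k k' by simp
  qed
qed

lemma is_coproduct_inv_ShO:
  assumes "is_coproduct C I X Z \<iota>"
  obtains X' Z' \<iota>' where "is_coproduct C I X' Z' \<iota>'" "Z = ShO C Z'"
    "\<And>i. i \<in> I \<Longrightarrow> X i = ShO C (X' i)" "\<And>i. i \<in> I \<Longrightarrow> \<iota> i = ShM C (\<iota>' i)"
proof -
  obtain Z' where Z: "Z' \<in> Obj C" "Z = ShO C Z'"
    using is_coproduct_Obj(1)[OF assms] by (rule ShO_cases)
  have "\<exists>X' \<iota>'. X i = ShO C X' \<and> \<langle>\<iota>' : X' \<rightarrow> Z'\<rangle> \<and> \<iota> i = ShM C \<iota>'" if "i \<in> I" for i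
    using is_coproduct_mor[OF assms that] Z
    by (metis ShM_cases ShO_cases is_coproduct_Obj(2)[OF assms that])
  then obtain X' \<iota>' where X: "\<And>i. i \<in> I \<Longrightarrow> X i = ShO C (X' i)"
    and \<iota>': "\<And>i. i \<in> I \<Longrightarrow> \<langle>\<iota>' i : X' i \<rightarrow> Z'\<rangle>" and \<iota>: "\<And>i. i \<in> I \<Longrightarrow> \<iota> i = ShM C (\<iota>' i)"
    by metis
  have "is_coproduct C I X' Z' \<iota>'"
  proof (rule is_coproductI)
    show "\<exists>h. \<langle>h : Z' \<rightarrow> Y\<rangle> \<and> (\<forall>i\<in>I. h \<cdot> \<iota>' i = f i)"
      if Y: "Y \<in> Obj C" and f: "\<And>i. i \<in> I \<Longrightarrow> \<langle>f i : X' i \<rightarrow> Y\<rangle>" for Y f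
    proof -
      have f': "\<langle>ShM C (f i) : X i \<rightarrow> ShO C Y\<rangle>" if "i \<in> I" for i
        using mor_ShM[OF f[OF that]] X[OF that] by simp
      obtain h where h: "\<langle>h : Z \<rightarrow> ShO C Y\<rangle>" "\<And>i. i \<in> I \<Longrightarrow> h \<cdot> \<iota> i = ShM C (f i)"
        using is_coproduct_desc[OF assms, of "ShO C Y" "\<lambda>i. ShM C (f i)"] f' Y by blast
      obtain k where k: "\<langle>k : Z' \<rightarrow> Y\<rangle>" "h = ShM C k"
        using ShM_cases[of h Z' Y] h(1) Z Y by auto
      have "k \<cdot> \<iota>' i = f i" if i: "i \<in> I" for i
        by (rule ShM_inj) (use k \<iota>'[OF i] f[OF i] h(2)[OF i] \<iota>[OF i] in \<open>auto simp: ShM_comp[OF \<iota>'[OF i]]\<close>)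
      with k(1) show ?thesis by blast
    qed
    show "h = h'" if h: "\<langle>h : Z' \<rightarrow> Y\<rangle>" "\<langle>h' : Z' \<rightarrow> Y\<rangle>" "\<And>i. i \<in> I \<Longrightarrow> h \<cdot> \<iota>' i = h' \<cdot> \<iota>' i" for Y h h'
    proof (rule ShM_inj[OF h(1,2)], rule is_coproduct_ext[OF assms])
      show "\<langle>ShM C h : Z \<rightarrow> ShO C Y\<rangle>" "\<langle>ShM C h' : Z \<rightarrow> ShO C Y\<rangle>" using h Z by auto
      show "ShM C h \<cdot> \<iota> i = ShM C h' \<cdot> \<iota> i" if "i \<in> I" for i
        using ShM_comp[OF \<iota>'[OF that] h(1)] ShM_comp[OF \<iota>'[OF that] h(2)] h(3)[OF that] \<iota>[OF that] by simp
    qed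
  qed (use Z \<iota>' in auto)
  with Z X \<iota> show thesis using that by blast
qed


subsection \<open>Exactness properties of distinguished triangles\<close>

lemma Dist_mor:
  assumes "(X, Y, Z, f, g, h) \<in> Dist C"
  shows "\<langle>f : X \<rightarrow> Y\<rangle>" "\<langle>g : Y \<rightarrow> Z\<rangle>" "\<langle>h : Z \<rightarrow> ShO C X\<rangle>"
  using Dist_wf[OF assms] by (auto simp: mor_def)

lemma Dist_rotate:
  assumes "(X, Y, Z, f, g, h) \<in> Dist C"
  shows "(Y, Z, ShO C X, g, h, neg (ShO C X) (ShO C Y) (ShM C f)) \<in> Dist C"
  using TR2[of X Y Z f g h] assms Dist_wf[OF assms] by (simp add: neg_def)

lemma Dist_unrotate:
  assumes "(Y, Z, ShO C X, g, h, k) \<in> Dist C" "X \<in> Obj C"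
  obtains f where "(X, Y, Z, f, g, h) \<in> Dist C"
proof -
  note m = Dist_mor[OF assms(1)]
  \<comment> \<open>The rotation axiom carries a minus sign, so \<open>f\<close> is the desuspension
    of the negative of \<open>k\<close>.\<close>
  obtain f where f: "\<langle>f : X \<rightarrow> Y\<rangle>" "neg (ShO C X) (ShO C Y) k = ShM C f"
    using ShM_cases[OF mor_neg[OF m(3)]] assms(2) mor_Obj[OF m(1)] by blast
  then have "k = neg (ShO C X) (ShO C Y) (ShM C f)" using neg_neg[OF m(3)] by simp
  then have "(X, Y, Z, f, g, h) \<in> Dist C"
    using TR2[of X Y Z f g h] assms(1) m f(1) by (simp add: mor_def neg_def)
  then show thesis by (rule that)
qed

lemma Dist_zero_Id:
  assumes "W \<in> Obj C" "zero_object C N"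
  shows "(N, W, W, Zero C N W, Id C W, Zero C W (ShO C N)) \<in> Dist C"
proof -
  note [simp] = assms(1) zero_object_Obj[OF assms(2)]
  have "(W, W, ShO C N, Id C W, Zero C W (ShO C N), Zero C (ShO C N) (ShO C W)) \<in> Dist C"
    using TR1_Id[OF assms(1) zero_object_ShO[OF assms(2)]] .
  moreover have "neg (ShO C N) (ShO C W) (ShM C (Zero C N W)) = Zero C (ShO C N) (ShO C W)"
    by (simp add: ShM_Zero neg_Zero)
  ultimately show ?thesis
    using TR2[of N W W "Zero C N W" "Id C W" "Zero C W (ShO C N)"] mor_Hom by (simp add: neg_def)
qed

text \<open>A fill-in from the triangle \<open>X -> X -> 0\<close> shows that \<open>g f\<close>
  factors through a zero object. The other two composites are the same fact for the rotated
  triangles, up to a sign.\<close>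

lemma Dist_comp_zero:
  assumes "(X, Y, Z, f, g, h) \<in> Dist C"
  shows "g \<cdot> f = Zero C X Z" "h \<cdot> g = Zero C Y (ShO C X)"
    "ShM C f \<cdot> h = Zero C Z (ShO C Y)"
proof -
  have *: "g \<cdot> f = Zero C X Z" if d: "(X, Y, Z, f, g, h) \<in> Dist C" for X Y Z f g h
  proof -
    obtain N where N: "zero_object C N" using ex_zero_object by blast
    note m = Dist_mor[OF d]
    note [simp] = zero_object_Obj[OF N] mor_Obj[OF m(1)] mor_Obj[OF m(2)]
    obtain c where c: "c \<in> Hom C N Z" "c \<cdot> Zero C X N = g \<cdot> f"
      using TR3[OF TR1_Id[OF mor_Obj(1)[OF m(1)] N] d, of "Id C X" f] m(1) comp_Id[OF m(1)] Id_in[of X]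
      by (auto simp: mor_def)
    then have "\<langle>c : N \<rightarrow> Z\<rangle>" by (simp add: mor_def)
    then show ?thesis using comp_Zero[of c N Z X] c by simp
  qed
  note m = Dist_mor[OF assms]
  show "g \<cdot> f = Zero C X Z" using *[OF assms] .
  show "h \<cdot> g = Zero C Y (ShO C X)" using *[OF Dist_rotate[OF assms]] .
  have "neg (ShO C X) (ShO C Y) (ShM C f) \<cdot> h = Zero C Z (ShO C Y)"
    using *[OF Dist_rotate[OF Dist_rotate[OF assms]]] .
  then show "ShM C f \<cdot> h = Zero C Z (ShO C Y)"
    using neg_comp[OF m(3) mor_ShM[OF m(1)]] neg_eq_Zero[OF mor_comp[OF m(3) mor_ShM[OF m(1)]]] by simp
qed

text \<open>Comparison with the triangle \<open>0 -> W -> W\<close>. The factorization need not be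
  unique, which is why later arguments have to correct their choices.\<close>

lemma Dist_weak_cokernel:
  assumes d: "(X, Y, Z, f, g, h) \<in> Dist C" and b: "\<langle>b : Y \<rightarrow> W\<rangle>" "b \<cdot> f = Zero C X W"
  obtains c where "\<langle>c : Z \<rightarrow> W\<rangle>" "c \<cdot> g = b"
proof -
  obtain N where N: "zero_object C N" using ex_zero_object by blast
  note m = Dist_mor[OF d]
  note [simp] = zero_object_Obj[OF N] mor_Obj[OF m(1)] mor_Obj[OF m(2)] mor_Obj[OF b(1)]
  have "b \<cdot> f = Zero C N W \<cdot> Zero C X N" using b(2) comp_Zero[of "Zero C N W" N W X] by simp
  then obtain c where "c \<in> Hom C Z W" "c \<cdot> g = Id C W \<cdot> b"
    using TR3[OF d Dist_zero_Id[OF _ N, of W], of "Zero C X N" b] b(1) by (auto simp: mor_Hom)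
  then show thesis using that[of c] comp_Id[OF b(1)] by (simp add: mor_def)
qed

lemma Dist_weak_cokernel2:
  assumes "(X, Y, Z, f, g, h) \<in> Dist C" "\<langle>b : Z \<rightarrow> W\<rangle>" "b \<cdot> g = Zero C Y W"
  obtains c where "\<langle>c : ShO C X \<rightarrow> W\<rangle>" "c \<cdot> h = b"
  using Dist_weak_cokernel[OF Dist_rotate[OF assms(1)] assms(2,3)] that by blast

text \<open>Two rotations reduce this to \<open>Dist_weak_cokernel\<close>, but they turn
  \<open>f[1]\<close> into its negative; the witness is therefore negated.\<close>

lemma Dist_weak_cokernel3:
  assumes d: "(X, Y, Z, f, g, h) \<in> Dist C" and b: "\<langle>b : ShO C X \<rightarrow> W\<rangle>" "b \<cdot> h = Zero C Z W"
  obtains c where "\<langle>c : ShO C Y \<rightarrow> W\<rangle>" "c \<cdot> ShM C f = b"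
proof -
  note f = mor_ShM[OF Dist_mor(1)[OF d]]
  obtain c where c: "\<langle>c : ShO C Y \<rightarrow> W\<rangle>" "c \<cdot> neg (ShO C X) (ShO C Y) (ShM C f) = b"
    using Dist_weak_cokernel2[OF Dist_rotate[OF d] b] by blast
  have "neg (ShO C Y) W c \<cdot> ShM C f = b"
    using c comp_neg[OF f c(1)] neg_comp[OF f c(1)] by simp
  with c(1) show thesis by (intro that) auto
qed

text \<open>The fill-in axiom produces third maps, so the map \<open>W -> X\<close> is sought one
  step further along: \<open>W -> 0 -> W[1]\<close> is compared with \<open>Y -> Z -> X[1]\<close>,
  and the result is translated back. The two signs cancel.\<close>

lemma Dist_weak_kernel:
  assumes d: "(X, Y, Z, f, g, h) \<in> Dist C" and a: "\<langle>a : W \<rightarrow> Y\<rangle>" "g \<cdot> a = Zero C W Z"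
  obtains x where "\<langle>x : W \<rightarrow> X\<rangle>" "f \<cdot> x = a"
proof -
  obtain N where N: "zero_object C N" using ex_zero_object by blast
  note m = Dist_mor[OF d]
  note [simp] = zero_object_Obj[OF N] mor_Obj[OF m(1)] mor_Obj[OF m(2)] mor_Obj[OF a(1)]
  have W: "(W, N, ShO C W, Zero C W N, Zero C N (ShO C W), neg (ShO C W) (ShO C W) (Id C (ShO C W)))
      \<in> Dist C"
    using Dist_rotate[OF TR1_Id[OF _ N, of W]] ShM_Id[of W] by simp
  have eq: "Zero C N Z \<cdot> Zero C W N = g \<cdot> a" using a(2) comp_Zero[of "Zero C N Z" N Z W] by simp
  have "Zero C N Z \<in> Hom C N Z" by (rule mor_Hom) simp
  then obtain c where c: "c \<in> Hom C (ShO C W) (ShO C X)"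
    "ShM C a \<cdot> neg (ShO C W) (ShO C W) (Id C (ShO C W)) = neg (ShO C X) (ShO C Y) (ShM C f) \<cdot> c"
    using TR3[OF W Dist_rotate[OF d] mor_Hom[OF a(1)] _ eq] by blast
  then have cm: "\<langle>c : ShO C W \<rightarrow> ShO C X\<rangle>" by (simp add: mor_def)
  then obtain x where x: "\<langle>x : W \<rightarrow> X\<rangle>" "c = ShM C x"
    by (rule ShM_cases) simp_all
  have fx: "\<langle>ShM C (f \<cdot> x) : ShO C W \<rightarrow> ShO C Y\<rangle>" using m(1) x(1) by auto
  have aW: "\<langle>ShM C a : ShO C W \<rightarrow> ShO C Y\<rangle>" using a(1) by auto
  have A: "ShM C a \<cdot> neg (ShO C W) (ShO C W) (Id C (ShO C W)) = neg (ShO C W) (ShO C Y) (ShM C a)"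
    using comp_neg[of "Id C (ShO C W)" "ShO C W" "ShO C W" "ShM C a" "ShO C Y"] aW comp_Id(2)[OF aW] by simp
  have B: "neg (ShO C X) (ShO C Y) (ShM C f) \<cdot> c = neg (ShO C W) (ShO C Y) (ShM C (f \<cdot> x))"
    using neg_comp[OF cm mor_ShM[OF m(1)]] ShM_comp[OF x(1) m(1)] x(2) by simp
  have "neg (ShO C W) (ShO C Y) (ShM C a) = neg (ShO C W) (ShO C Y) (ShM C (f \<cdot> x))"
    by (rule trans[OF A[symmetric] trans[OF c(2) B]])
  then have "ShM C a = ShM C (f \<cdot> x)"
    using neg_neg[OF fx] neg_neg[OF aW] by metis
  then have "a = f \<cdot> x" by (rule ShM_inj[OF a(1) mor_comp[OF x(1) m(1)]])
  then show thesis using that[OF x(1)] by simp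
qed

lemma Dist_weak_kernel2:
  assumes "(X, Y, Z, f, g, h) \<in> Dist C" "\<langle>a : W \<rightarrow> Z\<rangle>" "h \<cdot> a = Zero C W (ShO C X)"
  obtains x where "\<langle>x : W \<rightarrow> Y\<rangle>" "g \<cdot> x = a"
  using Dist_weak_kernel[OF Dist_rotate[OF assms(1)] assms(2,3)] that by blast


subsection \<open>The operation \<open>\<star>\<close> on classes of objects\<close>

text \<open>Membership in a \<open>\<star>\<close>-product asks only for the existence of maps, and
  forgetting them removes the signs of rotation.\<close>

definition tri :: "'o \<Rightarrow> 'o \<Rightarrow> 'o \<Rightarrow> bool" where
  "tri X Y Z \<longleftrightarrow> (\<exists>f g h. (X, Y, Z, f, g, h) \<in> Dist C)"

lemma triI: "(X, Y, Z, f, g, h) \<in> Dist C \<Longrightarrow> tri X Y Z"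
  by (auto simp: tri_def)

lemma star_iff: "Z \<in> star C A B \<longleftrightarrow> (\<exists>X\<in>A. \<exists>Y\<in>B. tri X Z Y)"
  by (auto simp: star_def tri_def)

lemma tri_Obj: "tri X Y Z \<Longrightarrow> X \<in> Obj C" "tri X Y Z \<Longrightarrow> Y \<in> Obj C" "tri X Y Z \<Longrightarrow> Z \<in> Obj C"
  by (auto simp: tri_def dest: Dist_wf)

lemma star_Obj: "star C A B \<subseteq> Obj C"
  by (auto simp: star_iff dest: tri_Obj)

lemma star_mono: "A \<subseteq> A' \<Longrightarrow> B \<subseteq> B' \<Longrightarrow> star C A B \<subseteq> star C A' B'"
  by (meson star_iff subset_iff)

lemma tri_rotate: "tri X Y Z \<Longrightarrow> tri Y Z (ShO C X)"
  unfolding tri_def by (metis Dist_rotate)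

lemma tri_unrotate:
  assumes "tri Y Z (ShO C X)" "X \<in> Obj C" shows "tri X Y Z"
proof -
  obtain g h k where d: "(Y, Z, ShO C X, g, h, k) \<in> Dist C" using assms(1) by (auto simp: tri_def)
  obtain f where "(X, Y, Z, f, g, h) \<in> Dist C" using d assms(2) by (rule Dist_unrotate)
  then show ?thesis by (rule triI)
qed

lemma tri_ShO_iff:
  assumes "X \<in> Obj C" "Y \<in> Obj C" "Z \<in> Obj C"
  shows "tri (ShO C X) (ShO C Y) (ShO C Z) \<longleftrightarrow> tri X Y Z"
proof
  assume "tri (ShO C X) (ShO C Y) (ShO C Z)"
  then show "tri X Y Z"
    by (rule tri_unrotate[OF tri_unrotate[OF tri_unrotate[OF _ assms(3)] assms(2)] assms(1)])
next
  assume "tri X Y Z"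
  then show "tri (ShO C X) (ShO C Y) (ShO C Z)" by (rule tri_rotate[OF tri_rotate[OF tri_rotate]])
qed

lemma tri_Id: "X \<in> Obj C \<Longrightarrow> zero_object C N \<Longrightarrow> tri X X N" "X \<in> Obj C \<Longrightarrow> zero_object C N \<Longrightarrow> tri N X X"
  by (rule triI, erule (1) TR1_Id, rule triI, erule (1) Dist_zero_Id)

text \<open>The octahedral axiom for the composite \<open>A -> Z -> T\<close>.\<close>

lemma tri_assoc_right:
  assumes "tri A Z B" "tri Z T D"
  obtains V where "tri A T V" "tri B V D"
proof -
  obtain f p p' where 1: "(A, Z, B, f, p, p') \<in> Dist C" using assms(1) by (auto simp: tri_def)
  obtain g q q' where 2: "(Z, T, D, g, q, q') \<in> Dist C" using assms(2) by (auto simp: tri_def)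
  have "g \<cdot> f \<in> Hom C A T" using mor_comp[OF Dist_mor(1)[OF 1] Dist_mor(1)[OF 2]] by (rule mor_Hom)
  then obtain V r r' where 3: "(A, T, V, g \<cdot> f, r, r') \<in> Dist C"
    using TR1_cone[OF tri_Obj(1)[OF assms(1)] tri_Obj(2)[OF assms(2)]] by blast
  obtain u v where "(B, V, D, u, v, ShM C p \<cdot> q') \<in> Dist C" using TR4[OF 1 2 3] by blast
  with 3 show thesis by (intro that triI)
qed

text \<open>The octahedral axiom for the composite \<open>T -> V -> D\<close> of the rotated
  triangles. The cone of this composite is \<open>Z[1]\<close>, so \<open>Z\<close> arises by
  desuspension.\<close>

lemma tri_assoc_left:
  assumes "tri A T V" "tri B V D"
  obtains Z where "tri A Z B" "tri Z T D"
proof -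
  obtain f p p' where 1: "(T, V, ShO C A, f, p, p') \<in> Dist C"
    using tri_rotate[OF assms(1)] by (auto simp: tri_def)
  obtain g q q' where 2: "(V, D, ShO C B, g, q, q') \<in> Dist C"
    using tri_rotate[OF assms(2)] by (auto simp: tri_def)
  have "g \<cdot> f \<in> Hom C T D" using mor_comp[OF Dist_mor(1)[OF 1] Dist_mor(1)[OF 2]] by (rule mor_Hom)
  then obtain Z' r r' where 3: "(T, D, Z', g \<cdot> f, r, r') \<in> Dist C"
    using TR1_cone[OF tri_Obj(2)[OF assms(1)] tri_Obj(3)[OF assms(2)]] by blast
  obtain u v where 4: "(ShO C A, Z', ShO C B, u, v, ShM C p \<cdot> q') \<in> Dist C" using TR4[OF 1 2 3] by blast
  obtain Z where Z: "Z \<in> Obj C" "Z' = ShO C Z" using tri_Obj(3)[OF triI[OF 3]] by (rule ShO_cases)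
  have "tri A Z B" using triI[OF 4] Z tri_ShO_iff[of A Z B] tri_Obj[OF assms(1)] tri_Obj[OF assms(2)] by simp
  moreover have "tri Z T D" using triI[OF 3] Z tri_unrotate by blast
  ultimately show thesis by (rule that)
qed

lemma star_assoc: "star C (star C A B) D = star C A (star C B D)"
proof (intro equalityI subsetI)
  fix T assume "T \<in> star C (star C A B) D"
  then obtain X Y Z W where "X \<in> A" "Y \<in> B" "W \<in> D" and t: "tri X Z Y" "tri Z T W"
    by (auto simp: star_iff)
  moreover obtain V where "tri X T V" "tri Y V W" using t by (rule tri_assoc_right)
  ultimately show "T \<in> star C A (star C B D)" by (meson star_iff)
next
  fix T assume "T \<in> star C A (star C B D)"
  then obtain X Y V W where "X \<in> A" "Y \<in> B" "W \<in> D" and t: "tri X T V" "tri Y V W"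
    by (auto simp: star_iff)
  moreover obtain Z where "tri X Z Y" "tri Z T W" using t by (rule tri_assoc_left)
  ultimately show "T \<in> star C (star C A B) D" by (meson star_iff)
qed

lemma Dist_split:
  assumes d: "(X, Z, Y, f, g, h) \<in> Dist C" and h: "h = Zero C Y (ShO C X)"
  obtains s where "\<langle>s : Y \<rightarrow> Z\<rangle>" "g \<cdot> s = Id C Y"
proof -
  note m = Dist_mor[OF d]
  have "h \<cdot> Id C Y = Zero C Y (ShO C X)" using comp_Id(2)[OF m(3)] h by simp
  then show thesis using Dist_weak_kernel2[OF d mor_Id] mor_Obj[OF m(3)] that by blast
qed

lemma Dist_split':
  assumes d: "(X, Z, Y, f, g, h) \<in> Dist C" and h: "h = Zero C Y (ShO C X)"
  obtains r where "\<langle>r : Z \<rightarrow> X\<rangle>" "r \<cdot> f = Id C X"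
proof -
  note m = Dist_mor[OF d]
  note [simp] = mor_Obj[OF m(1)]
  have "Id C (ShO C X) \<cdot> h = Zero C Y (ShO C X)" using comp_Id(1)[OF m(3)] h by simp
  then obtain c where c: "\<langle>c : ShO C Z \<rightarrow> ShO C X\<rangle>" "c \<cdot> ShM C f = Id C (ShO C X)"
    using Dist_weak_cokernel3[OF d mor_Id] by auto
  then obtain r where r: "\<langle>r : Z \<rightarrow> X\<rangle>" "c = ShM C r" using ShM_cases[of c Z X] by auto
  have "r \<cdot> f = Id C X"
    by (rule ShM_inj) (use r m c in \<open>auto simp: ShM_comp[OF m(1) r(1)] ShM_Id\<close>)
  with r(1) show thesis by (rule that)
qed

text \<open>The connecting map vanishes, so \<open>g\<close> has a section \<open>s\<close>; the
  octahedral axiom for the identity \<open>g s\<close> relates the cone \<open>W\<close> of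
  \<open>s\<close> to \<open>X\<close>. That \<open>W\<close> and \<open>X\<close> are isomorphic is
  recorded as \<open>tri X W N\<close> with \<open>N\<close> zero, so that an extension-closed class
  containing \<open>X\<close> contains \<open>W\<close>.\<close>

lemma tri_swap:
  assumes "tri X Z Y" "Hom_trivial C Y (ShO C X)" "zero_object C N"
  obtains W where "tri Y Z W" "tri X W N"
proof -
  obtain f g h where d: "(X, Z, Y, f, g, h) \<in> Dist C" using assms(1) by (auto simp: tri_def)
  note m = Dist_mor[OF d]
  obtain s where s: "\<langle>s : Y \<rightarrow> Z\<rangle>" "g \<cdot> s = Id C Y"
    using Dist_split[OF d] Hom_trivialD[OF assms(2) m(3)] by blast
  obtain W p p' where 1: "(Y, Z, W, s, p, p') \<in> Dist C"
    using TR1_cone s(1) unfolding mor_def by blast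
  have 3: "(Y, Y, N, g \<cdot> s, Zero C Y N, Zero C N (ShO C Y)) \<in> Dist C"
    using TR1_Id[OF mor_Obj(2)[OF m(2)] assms(3)] s(2) by simp
  have "tri W N (ShO C X)" using TR4[OF 1 Dist_rotate[OF d] 3] triI by blast
  then have "tri X W N" using tri_unrotate mor_Obj[OF m(1)] by blast
  with triI[OF 1] show thesis by (rule that)
qed

end

section \<open>Small sets\<close>

lemma small_ordLeq: "small \<kappa> A \<Longrightarrow> |B| \<le>o |A| \<Longrightarrow> small \<kappa> B"
  unfolding small_def by (rule ordLeq_ordLess_trans)

lemma small_subset: "small \<kappa> A \<Longrightarrow> B \<subseteq> A \<Longrightarrow> small \<kappa> B"
  by (rule small_ordLeq[OF _ card_of_mono1])

lemma small_image: "small \<kappa> A \<Longrightarrow> small \<kappa> (f ` A)"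
  by (rule small_ordLeq[OF _ card_of_image])

text \<open>Here uncountability of \<kappa> enters. It provides the coproducts of sequences for
  homotopy colimits and makes the set of all shifts of finitely many objects small.\<close>

lemma small_countable:
  assumes "smallness_cardinal \<kappa>" "countable A" shows "small \<kappa> A"
proof -
  obtain f :: "_ \<Rightarrow> nat" where "inj_on f A" using assms(2) by (auto simp: countable_def)
  then have "|A| \<le>o |UNIV :: nat set|" using card_of_ordLeq[of A "UNIV :: nat set"] by blast
  moreover have "|UNIV :: nat set| =o natLeq" by (rule card_of_nat)
  moreover have "natLeq <o \<kappa>" using assms(1) by (simp add: smallness_cardinal_def)
  ultimately show ?thesis
    unfolding small_def using ordLeq_ordIso_trans ordLeq_ordLess_trans by blast
qed

text \<open>An infinite regular cardinal is stable. Nested coproducts and index sets of pairs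
  (generator, morphism) rely on this.\<close>

lemma small_Sigma:
  assumes "smallness_cardinal \<kappa>" "small \<kappa> I" "\<And>i. i \<in> I \<Longrightarrow> small \<kappa> (J i)"
  shows "small \<kappa> (Sigma I J)"
proof -
  have \<kappa>: "Card_order \<kappa>" "regularCard \<kappa>" "natLeq <o \<kappa>"
    using assms(1) by (auto simp: smallness_cardinal_def)
  have "infinite (Field \<kappa>)"
    using \<kappa>(1,3) by (metis cinfinite_def cinfinite_mono natLeq_cinfinite ordLess_imp_ordLeq)
  then have "stable \<kappa>" using regularCard_stable \<kappa> by blast
  then show ?thesis using stable_elim assms(2,3) unfolding small_def by blast
qed

lemma small_inj:
  fixes \<kappa> :: "'u rel"
  assumes "smallness_cardinal \<kappa>" "small \<kappa> A"
  obtains f :: "_ \<Rightarrow> 'u" where "inj_on f A"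
proof -
  have "|A| \<le>o |Field \<kappa>|"
    using assms card_of_Field_ordIso ordIso_symmetric ordLess_imp_ordLeq ordLeq_ordIso_trans
    unfolding small_def smallness_cardinal_def by blast
  then show thesis using that card_of_ordLeq[of A "Field \<kappa>"] by blast
qed


section \<open>Coproducts and compact objects\<close>

lemma hom_group_simps:
  "carrier (hom_group C X Y) = Hom C X Y" "mult (hom_group C X Y) = Add C" "one (hom_group C X Y) = Zero C X Y"
  by (simp_all add: hom_group_def)

locale cocomplete_triangulated_category = triangulated_category C
  for C :: "('o, 'm, 'z) tri_category_scheme" (structure) +
  fixes \<kappa> :: "'u rel"
  assumes smallness_cardinal: "smallness_cardinal \<kappa>"
    and compact_homs_small: "compact_homs_small \<kappa> C"
    and has_small_coproducts: "has_small_coproducts \<kappa> C"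
begin

section \<open>Change of index sets, and compactness as an induction principle\<close>

lemma ex_coproduct:
  assumes "small \<kappa> I" "\<And>i. i \<in> I \<Longrightarrow> X i \<in> Obj C"
  obtains Z \<iota> where "is_coproduct C I X Z \<iota>"
proof -
  obtain f :: "_ \<Rightarrow> 'u" where f: "inj_on f I" using small_inj[OF smallness_cardinal assms(1)] .
  have "small \<kappa> (f ` I)" using small_image[OF assms(1)] .
  moreover have "\<forall>j\<in>f ` I. X (inv_into I f j) \<in> Obj C" using assms(2) by (auto simp: f)
  ultimately have "\<exists>Z \<iota>. is_coproduct C (f ` I) (\<lambda>j. X (inv_into I f j)) Z \<iota>"
    using has_small_coproducts unfolding has_small_coproducts_def by simp
  then obtain Z \<iota> where "is_coproduct C (f ` I) (\<lambda>j. X (inv_into I f j)) Z \<iota>" by blast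
  then have "is_coproduct C I ((\<lambda>j. X (inv_into I f j)) \<circ> f) Z (\<iota> \<circ> f)"
    using f by (intro is_coproduct_reindex) (auto simp: bij_betw_def)
  then have "is_coproduct C I X Z (\<iota> \<circ> f)"
    by (rule is_coproduct_cong) (use f in auto)
  then show thesis by (rule that)
qed

lemma reindex_coproduct:
  assumes "small \<kappa> I" "is_coproduct C I X Z \<iota>"
  obtains J :: "'u set" and \<phi> where "small \<kappa> J" "bij_betw \<phi> J I" "is_coproduct C J (X \<circ> \<phi>) Z (\<iota> \<circ> \<phi>)"
proof -
  obtain f :: "_ \<Rightarrow> 'u" where f: "inj_on f I" using small_inj[OF smallness_cardinal assms(1)] .
  have "bij_betw (inv_into I f) (f ` I) I" using f by (intro bij_betw_inv_into) (simp add: bij_betw_def)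
  with small_image[OF assms(1), of f] show thesis
    using is_coproduct_reindex[OF _ assms(2)] by (intro that[of "f ` I" "inv_into I f"])
qed

lemma coprod_closedD:
  assumes "coprod_closed \<kappa> C A" "small \<kappa> I" "is_coproduct C I X Z \<iota>" "\<And>i. i \<in> I \<Longrightarrow> X i \<in> A"
  shows "Z \<in> A"
proof -
  obtain J :: "'u set" and \<phi> where J: "small \<kappa> J" "bij_betw \<phi> J I" "is_coproduct C J (X \<circ> \<phi>) Z (\<iota> \<circ> \<phi>)"
    using reindex_coproduct[OF assms(2,3)] .
  moreover have "\<forall>j\<in>J. (X \<circ> \<phi>) j \<in> A" using J(2) assms(4) by (auto simp: bij_betw_def)
  ultimately show ?thesis using assms(1) unfolding coprod_closed_def by blast
qed

text \<open>Lets later arguments about maps out of compact objects avoid formal sums: whatever holds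
  for the summands and passes to sums holds for the total.\<close>

lemma gfinprod_hom_induct:
  assumes "M \<in> Obj C" "Z \<in> Obj C" and u: "\<And>i. i \<in> A \<Longrightarrow> \<langle>u i : M \<rightarrow> Z\<rangle>"
    and zero: "Q (Zero C M Z)"
    and add: "\<And>a b. \<langle>a : M \<rightarrow> Z\<rangle> \<Longrightarrow> \<langle>b : M \<rightarrow> Z\<rangle> \<Longrightarrow> Q a \<Longrightarrow> Q b \<Longrightarrow> Q (a \<boxplus> b)"
    and gen: "\<And>i. i \<in> A \<Longrightarrow> Q (u i)"
  shows "Q (gfinprod (hom_group C M Z) u A)"
proof -
  interpret G: comm_group "hom_group C M Z" using hom_comm_group assms(1,2) .
  have fin: "finprod (hom_group C M Z) u F \<in> carrier (hom_group C M Z) \<and> Q (finprod (hom_group C M Z) u F)"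
    if "finite F" "F \<subseteq> A" for F
    using that
  proof (induction F rule: finite_induct)
    case empty
    then show ?case using zero mor_Hom[OF mor_Zero[OF assms(1,2)]] by (simp add: hom_group_simps)
  next
    case (insert i F)
    have c: "u k \<in> carrier (hom_group C M Z)" if "k \<in> A" for k
      using u[OF that] by (simp add: hom_group_simps mor_def)
    have "finprod (hom_group C M Z) u (insert i F) = u i \<boxplus> finprod (hom_group C M Z) u F"
      using insert c by (subst G.finprod_insert) (auto simp: hom_group_simps)
    moreover have "\<langle>finprod (hom_group C M Z) u F : M \<rightarrow> Z\<rangle>"
      using insert assms(1,2) by (simp add: mor_def hom_group_simps)
    moreover have "\<langle>u i : M \<rightarrow> Z\<rangle>" "Q (u i)" using insert u gen by auto
    ultimately show ?case using insert add mor_Hom[OF mor_add] by (simp add: hom_group_simps)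
  qed
  \<comment> \<open>\<open>gfinprod\<close> has the neutral element as default value for infinite
    support, so the hypothesis \<open>zero\<close> covers that case.\<close>
  show ?thesis
    unfolding gfinprod_def using fin[of "{x \<in> A. u x \<noteq> \<one>\<^bsub>hom_group C M Z\<^esub>}"] zero
    by (auto simp: hom_group_simps)
qed

lemma carrier_hom_sum_group:
  assumes "M \<in> Obj C" "\<And>i. i \<in> I \<Longrightarrow> X i \<in> Obj C"
  shows "g \<in> carrier (sum_group I (\<lambda>i. hom_group C M (X i))) \<longleftrightarrow>
    g \<in> extensional I \<and> (\<forall>i\<in>I. \<langle>g i : M \<rightarrow> X i\<rangle>) \<and> finite {i \<in> I. g i \<noteq> Zero C M (X i)}"
proof -
  have "group (hom_group C M (X i))" if "i \<in> I" for i
    using hom_comm_group[OF assms(1) assms(2)[OF that]] by (rule comm_group.axioms)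
  then show ?thesis
    using assms by (subst carrier_sum_group) (auto simp: hom_group_simps mor_def PiE_def)
qed

text \<open>Split off the \<open>j\<close>-th summand, which \<open>p\<close> returns as
  \<open>g j\<close>; all remaining summands are killed by \<open>p\<close>.\<close>

lemma proj_gfinprod:
  assumes M: "M \<in> Obj C" and Z: "is_coproduct C I X Z \<iota>"
    and g: "\<And>i. i \<in> I \<Longrightarrow> \<langle>g i : M \<rightarrow> X i\<rangle>" "finite {i \<in> I. g i \<noteq> Zero C M (X i)}"
    and j: "j \<in> I" and p: "\<langle>p : Z \<rightarrow> X j\<rangle>" "p \<cdot> \<iota> j = Id C (X j)"
      "\<And>i. i \<in> I \<Longrightarrow> i \<noteq> j \<Longrightarrow> p \<cdot> \<iota> i = Zero C (X i) (X j)"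
  shows "p \<cdot> gfinprod (hom_group C M Z) (\<lambda>i. \<iota> i \<cdot> g i) I = g j"
proof -
  note O = is_coproduct_Obj[OF Z]
  interpret G: comm_group "hom_group C M Z" using hom_comm_group M O(1) .
  let ?u = "\<lambda>i. \<iota> i \<cdot> g i"
  have u: "\<langle>?u i : M \<rightarrow> Z\<rangle>" if "i \<in> I" for i using g(1)[OF that] is_coproduct_mor[OF Z that] by (rule mor_comp)
  have pu: "p \<cdot> ?u i = (p \<cdot> \<iota> i) \<cdot> g i" if "i \<in> I" for i
    using comp_assoc[OF g(1)[OF that] is_coproduct_mor[OF Z that] p(1)] by simp
  let ?r = "gfinprod (hom_group C M Z) ?u (I - {j})"
  have u': "?u i \<in> carrier (hom_group C M Z)" if "i \<in> I" for i
    using u[OF that] by (simp add: hom_group_simps mor_def)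
  have r: "\<langle>?r : M \<rightarrow> Z\<rangle>"
    using G.gfinprod_closed[of ?u "I - {j}"] u' M O(1) by (auto simp: hom_group_simps mor_def Pi_def)
  have "?u i = Zero C M Z" if "i \<in> I" "g i = Zero C M (X i)" for i
    using comp_Zero[OF is_coproduct_mor[OF Z that(1)] M] that by simp
  then have "finite {i \<in> I - {j}. ?u i \<noteq> \<one>\<^bsub>hom_group C M Z\<^esub>}"
    by (intro finite_subset[OF _ g(2)]) (auto simp: hom_group_simps)
  then have "gfinprod (hom_group C M Z) ?u (insert j (I - {j})) = ?u j \<boxplus> ?r"
    using u' j by (subst G.gfinprod_insert) (auto simp: hom_group_simps)
  then have eq: "gfinprod (hom_group C M Z) ?u I = ?u j \<boxplus> ?r" using j by (simp add: insert_absorb)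
  have "p \<cdot> ?r = Zero C M (X j)"
  proof (rule gfinprod_hom_induct[where Q = "\<lambda>x. p \<cdot> x = Zero C M (X j)", OF M O(1)])
    show "p \<cdot> Zero C M Z = Zero C M (X j)" using comp_Zero[OF p(1) M] .
    show "p \<cdot> (a \<boxplus> b) = Zero C M (X j)" if "\<langle>a : M \<rightarrow> Z\<rangle>" "\<langle>b : M \<rightarrow> Z\<rangle>"
      "p \<cdot> a = Zero C M (X j)" "p \<cdot> b = Zero C M (X j)" for a b
      using comp_add[OF that(1,2) p(1)] that(3,4) add_Zero[OF mor_Zero[OF M O(2)[OF j]]] by simp
    show "p \<cdot> ?u i = Zero C M (X j)" if "i \<in> I - {j}" for i
      using pu p(3) that Zero_comp[OF g(1) O(2)[OF j]] by auto
  qed (use u in auto)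
  moreover have "p \<cdot> ?u j = g j" using pu[OF j] p(2) comp_Id[OF g(1)[OF j]] by simp
  ultimately show ?thesis
    using eq comp_add[OF u[OF j] r p(1)] add_Zero[OF g(1)[OF j]] by simp
qed

lemma compact_object_Obj: "compact_object \<kappa> C M \<Longrightarrow> M \<in> Obj C"
  by (simp add: compact_object_def)

lemma compact_object_gfinprod:
  fixes I :: "'u set"
  assumes "compact_object \<kappa> C M" "small \<kappa> I" "is_coproduct C I X Z \<iota>" "\<langle>f : M \<rightarrow> Z\<rangle>"
  obtains g where "\<And>i. i \<in> I \<Longrightarrow> \<langle>g i : M \<rightarrow> X i\<rangle>" "finite {i \<in> I. g i \<noteq> Zero C M (X i)}"
    "f = gfinprod (hom_group C M Z) (\<lambda>i. \<iota> i \<cdot> g i) I"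
proof -
  have "(\<lambda>g. gfinprod (hom_group C M Z) (\<lambda>i. \<iota> i \<cdot> g i) I)
      \<in> iso (sum_group I (\<lambda>i. hom_group C M (X i))) (hom_group C M Z)"
    using assms(1-3) unfolding compact_object_def by blast
  then have "(\<lambda>g. gfinprod (hom_group C M Z) (\<lambda>i. \<iota> i \<cdot> g i) I) `
      carrier (sum_group I (\<lambda>i. hom_group C M (X i))) = Hom C M Z"
    by (simp add: iso_def bij_betw_def hom_group_simps)
  then obtain g where g: "g \<in> carrier (sum_group I (\<lambda>i. hom_group C M (X i)))"
    "f = gfinprod (hom_group C M Z) (\<lambda>i. \<iota> i \<cdot> g i) I"
    using mor_Hom[OF assms(4)] by (metis (no_types, lifting) imageE)
  with that show thesis
    using carrier_hom_sum_group[of M I X g] assms mor_Obj is_coproduct_Obj[OF assms(3)] by blast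
qed

text \<open>The working form of compactness: every map into the coproduct is a finite sum of maps
  through single summands. It is the surjectivity half of the definition.\<close>

lemma compact_object_induct:
  assumes M: "compact_object \<kappa> C M" and I: "small \<kappa> I" and Z: "is_coproduct C I X Z \<iota>"
    and f: "\<langle>f : M \<rightarrow> Z\<rangle>" and zero: "Q (Zero C M Z)"
    and add: "\<And>a b. \<langle>a : M \<rightarrow> Z\<rangle> \<Longrightarrow> \<langle>b : M \<rightarrow> Z\<rangle> \<Longrightarrow> Q a \<Longrightarrow> Q b \<Longrightarrow> Q (a \<boxplus> b)"
    and gen: "\<And>i g. i \<in> I \<Longrightarrow> \<langle>g : M \<rightarrow> X i\<rangle> \<Longrightarrow> Q (\<iota> i \<cdot> g)"
  shows "Q f"
proof -
  obtain J :: "'u set" and \<phi> where J: "small \<kappa> J" "bij_betw \<phi> J I" "is_coproduct C J (X \<circ> \<phi>) Z (\<iota> \<circ> \<phi>)"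
    using reindex_coproduct[OF I Z] .
  obtain g where g: "\<And>j. j \<in> J \<Longrightarrow> \<langle>g j : M \<rightarrow> (X \<circ> \<phi>) j\<rangle>"
    "f = gfinprod (hom_group C M Z) (\<lambda>j. (\<iota> \<circ> \<phi>) j \<cdot> g j) J"
    using compact_object_gfinprod[OF M J(1,3) f] by blast
  have "\<phi> j \<in> I" if "j \<in> J" for j using J(2) that by (auto simp: bij_betw_def)
  then show ?thesis
    unfolding g(2) using g(1) is_coproduct_mor[OF J(3)]
    by (intro gfinprod_hom_induct[where Q = Q] zero add mor_comp[OF g(1)])
      (auto simp: mor_Obj[OF f] gen)
qed

text \<open>Projections need not detect zero maps into an infinite coproduct in general. They do for
  compact \<open>M\<close>, because the components of \<open>f\<close> in the direct sum are
  recovered by the projections.\<close>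

lemma compact_object_eq_Zero:
  assumes M: "compact_object \<kappa> C M" and I: "small \<kappa> I" and Z: "is_coproduct C I X Z \<iota>"
    and f: "\<langle>f : M \<rightarrow> Z\<rangle>"
    and p: "\<And>i. i \<in> I \<Longrightarrow> \<langle>p i : Z \<rightarrow> X i\<rangle>" "\<And>i. i \<in> I \<Longrightarrow> p i \<cdot> \<iota> i = Id C (X i)"
      "\<And>i j. i \<in> I \<Longrightarrow> j \<in> I \<Longrightarrow> i \<noteq> j \<Longrightarrow> p j \<cdot> \<iota> i = Zero C (X i) (X j)"
    and pf: "\<And>i. i \<in> I \<Longrightarrow> p i \<cdot> f = Zero C M (X i)"
  shows "f = Zero C M Z"
proof -
  note [simp] = compact_object_Obj[OF M] is_coproduct_Obj[OF Z]
  obtain J :: "'u set" and \<phi> where J: "small \<kappa> J" "bij_betw \<phi> J I" "is_coproduct C J (X \<circ> \<phi>) Z (\<iota> \<circ> \<phi>)"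
    using reindex_coproduct[OF I Z] .
  obtain g where g: "\<And>j. j \<in> J \<Longrightarrow> \<langle>g j : M \<rightarrow> (X \<circ> \<phi>) j\<rangle>"
    "finite {j \<in> J. g j \<noteq> Zero C M ((X \<circ> \<phi>) j)}"
    "f = gfinprod (hom_group C M Z) (\<lambda>j. (\<iota> \<circ> \<phi>) j \<cdot> g j) J"
    using compact_object_gfinprod[OF M J(1,3) f] by blast
  have \<phi>: "\<phi> j \<in> I" if "j \<in> J" for j using J(2) that by (auto simp: bij_betw_def)
  have g0: "g j = Zero C M ((X \<circ> \<phi>) j)" if j: "j \<in> J" for j
  proof -
    have "p (\<phi> j) \<cdot> f = g j"
      unfolding g(3)
    proof (rule proj_gfinprod[OF _ J(3) g(1,2) j])
      show "p (\<phi> j) \<cdot> (\<iota> \<circ> \<phi>) i = Zero C ((X \<circ> \<phi>) i) ((X \<circ> \<phi>) j)" if "i \<in> J" "i \<noteq> j" for i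
        using p(3)[of "\<phi> i" "\<phi> j"] that j \<phi> J(2) by (auto simp: bij_betw_def inj_on_def)
    qed (use p \<phi> j in auto)
    then show ?thesis using pf[OF \<phi>[OF j]] by simp
  qed
  show ?thesis
    unfolding g(3)
  proof (rule gfinprod_hom_induct[where Q = "\<lambda>x. x = Zero C M Z"])
    show "(\<iota> \<circ> \<phi>) j \<cdot> g j = Zero C M Z" "\<langle>(\<iota> \<circ> \<phi>) j \<cdot> g j : M \<rightarrow> Z\<rangle>" if "j \<in> J" for j
      using g0[OF that] comp_Zero[OF is_coproduct_mor[OF J(3) that]] by simp_all
  qed (use add_Zero[OF mor_Zero] in auto)
qed

text \<open>Converse of \<open>compact_object_induct\<close>. Injectivity of the canonical
  homomorphism follows from the projections for every object \<open>M\<close>; surjectivity is the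
  induction principle applied to membership in the image.\<close>

lemma compact_objectI:
  assumes M: "M \<in> Obj C"
    and ind: "\<And>(I :: 'u set) X Z \<iota> f Q. small \<kappa> I \<Longrightarrow> is_coproduct C I X Z \<iota> \<Longrightarrow> \<langle>f : M \<rightarrow> Z\<rangle>
      \<Longrightarrow> Q (Zero C M Z)
      \<Longrightarrow> (\<And>a b. \<langle>a : M \<rightarrow> Z\<rangle> \<Longrightarrow> \<langle>b : M \<rightarrow> Z\<rangle> \<Longrightarrow> Q a \<Longrightarrow> Q b \<Longrightarrow> Q (a \<boxplus> b))
      \<Longrightarrow> (\<And>i g. i \<in> I \<Longrightarrow> \<langle>g : M \<rightarrow> X i\<rangle> \<Longrightarrow> Q (\<iota> i \<cdot> g)) \<Longrightarrow> Q f"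
  shows "compact_object \<kappa> C M"
  unfolding compact_object_def
proof (intro conjI allI impI)
  show "M \<in> Obj C" by fact
  fix I :: "'u set" and X Z \<iota>
  assume I: "small \<kappa> I" and Z: "is_coproduct C I X Z \<iota>"
  note O = is_coproduct_Obj[OF Z]
  let ?S = "sum_group I (\<lambda>i. hom_group C M (X i))" and ?G = "hom_group C M Z"
  let ?h = "\<lambda>g. gfinprod ?G (\<lambda>i. \<iota> i \<cdot> g i) I"
  interpret G: comm_group ?G using hom_comm_group M O(1) .
  have car: "g \<in> carrier ?S \<longleftrightarrow> g \<in> extensional I \<and> (\<forall>i\<in>I. \<langle>g i : M \<rightarrow> X i\<rangle>) \<and>
      finite {i \<in> I. g i \<noteq> Zero C M (X i)}" for g
    by (rule carrier_hom_sum_group[OF M O(2)])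
  have grp: "group (hom_group C M (X i))" if "i \<in> I" for i
    using hom_comm_group[OF M O(2)[OF that]] by (rule comm_group.axioms)
  have hom: "?h \<in> hom ?S ?G"
  proof (rule G.hom_group_sum)
    fix i assume i: "i \<in> I"
    show "(\<cdot>) (\<iota> i) \<in> hom (hom_group C M (X i)) ?G"
    proof (rule homI)
      fix x y assume "x \<in> carrier (hom_group C M (X i))" "y \<in> carrier (hom_group C M (X i))"
      then have xy: "\<langle>x : M \<rightarrow> X i\<rangle>" "\<langle>y : M \<rightarrow> X i\<rangle>" using M O(2)[OF i] by (auto simp: hom_group_simps mor_def)
      show "\<iota> i \<cdot> x \<in> carrier ?G"
        using mor_Hom[OF mor_comp[OF xy(1) is_coproduct_mor[OF Z i]]] by (simp add: hom_group_simps)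
      show "\<iota> i \<cdot> (x \<otimes>\<^bsub>hom_group C M (X i)\<^esub> y) = (\<iota> i \<cdot> x) \<otimes>\<^bsub>?G\<^esub> (\<iota> i \<cdot> y)"
        using comp_add[OF xy is_coproduct_mor[OF Z i]] by (simp add: hom_group_simps)
    qed
  qed (use grp in auto)
  have inj: "inj_on ?h (carrier ?S)"
  proof (rule inj_onI)
    fix g g' assume g: "g \<in> carrier ?S" and g': "g' \<in> carrier ?S" and eq: "?h g = ?h g'"
    have "g j = g' j" if j: "j \<in> I" for j
    proof -
      obtain \<pi> where \<pi>: "\<langle>\<pi> : Z \<rightarrow> X j\<rangle>" "\<pi> \<cdot> \<iota> j = Id C (X j)"
        "\<And>i. i \<in> I \<Longrightarrow> i \<noteq> j \<Longrightarrow> \<pi> \<cdot> \<iota> i = Zero C (X i) (X j)"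
        using is_coproduct_proj[OF Z j] by blast
      show ?thesis
        using proj_gfinprod[OF M Z _ _ j \<pi>, of g] proj_gfinprod[OF M Z _ _ j \<pi>, of g'] g g' eq
        unfolding car by simp
    qed
    then show "g = g'" using g g' unfolding car by (auto intro: extensionalityI)
  qed
  have "\<exists>g\<in>carrier ?S. f = ?h g" if f: "\<langle>f : M \<rightarrow> Z\<rangle>" for f
  proof (rule ind[OF I Z f, where Q = "\<lambda>f. \<exists>g\<in>carrier ?S. f = ?h g"])
    have S: "group ?S" using grp by simp
    have "?h \<one>\<^bsub>?S\<^esub> = Zero C M Z"
      using hom_one[OF hom S G.is_group] unfolding hom_group_simps(3) .
    then show "\<exists>g\<in>carrier ?S. Zero C M Z = ?h g"
      by (rule bexI[OF sym monoid.one_closed[OF group.is_monoid[OF S]]])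
    show "\<exists>g\<in>carrier ?S. a \<boxplus> b = ?h g" if "\<exists>g\<in>carrier ?S. a = ?h g" "\<exists>g\<in>carrier ?S. b = ?h g" for a b
    proof -
      obtain g g' where "g \<in> carrier ?S" "g' \<in> carrier ?S" "a = ?h g" "b = ?h g'"
        using \<open>\<exists>g\<in>carrier ?S. a = ?h g\<close> \<open>\<exists>g\<in>carrier ?S. b = ?h g\<close> by blast
      moreover from this have "?h (g \<otimes>\<^bsub>?S\<^esub> g') = ?h g \<boxplus> ?h g'"
        using hom_mult[OF hom] by (simp add: hom_group_simps)
      moreover have "g \<otimes>\<^bsub>?S\<^esub> g' \<in> carrier ?S"
        using calculation(1,2) group.is_monoid[OF S] by (rule monoid.m_closed[rotated])
      ultimately show ?thesis by (intro bexI[of _ "g \<otimes>\<^bsub>?S\<^esub> g'"]) (simp_all only:)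
    qed
    fix i g assume i: "i \<in> I" and g: "\<langle>g : M \<rightarrow> X i\<rangle>"
    define d where "d = (\<lambda>k\<in>I. if k = i then g else Zero C M (X k))"
    have "{k \<in> I. d k \<noteq> Zero C M (X k)} \<subseteq> {i}" by (auto simp: d_def)
    then have "finite {k \<in> I. d k \<noteq> Zero C M (X k)}" by (rule finite_subset) simp
    moreover have "\<langle>d k : M \<rightarrow> X k\<rangle>" if "k \<in> I" for k
      using that g mor_Zero[OF M O(2)[OF that]] by (simp add: d_def)
    ultimately have "d \<in> carrier ?S" unfolding car by (simp add: d_def)
    moreover have "\<iota> i \<cdot> g = ?h d"
    proof -
      have c: "\<iota> i \<cdot> g \<in> carrier ?G"
        using mor_Hom[OF mor_comp[OF g is_coproduct_mor[OF Z i]]] by (simp add: hom_group_simps)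
      have zero: "\<iota> k \<cdot> Zero C M (X k) = \<one>\<^bsub>?G\<^esub>" if "k \<in> I" for k
        using comp_Zero[OF is_coproduct_mor[OF Z that] M] by (simp add: hom_group_simps)
      have "gfinprod ?G (\<lambda>k. \<iota> k \<cdot> d k) {i} = ?h d"
      proof (rule G.gfinprod_mono_neutral_cong_left)
        show "\<iota> k \<cdot> d k = \<one>\<^bsub>?G\<^esub>" if "k \<in> I - {i}" for k using that zero by (simp add: d_def)
        show "(\<lambda>k. \<iota> k \<cdot> d k) \<in> I \<rightarrow> carrier ?G"
          using c zero G.one_closed by (auto simp: d_def)
      qed (use i in auto)
      then show ?thesis using c i by (simp add: d_def)
    qed
    ultimately show "\<exists>g'\<in>carrier ?S. \<iota> i \<cdot> g = ?h g'" by blast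
  qed
  then have "carrier ?G \<subseteq> ?h ` carrier ?S"
    using M O(1) unfolding hom_group_simps(1) mor_def by blast
  then have "?h ` carrier ?S = carrier ?G"
    using hom_carrier[OF hom] by (rule equalityI[rotated])
  with hom inj show "?h \<in> iso ?S ?G" by (simp add: iso_def bij_betw_def)
qed


section \<open>Invariance of compactness under translation\<close>

lemma compact_object_ShO:
  assumes "compact_object \<kappa> C M" shows "compact_object \<kappa> C (ShO C M)"
proof (rule compact_objectI)
  note M = compact_object_Obj[OF assms]
  show "ShO C M \<in> Obj C" using M by simp
  fix I :: "'u set" and X Z \<iota> f Q
  assume I: "small \<kappa> I" and Z: "is_coproduct C I X Z \<iota>" and f: "\<langle>f : ShO C M \<rightarrow> Z\<rangle>"
    and zero: "Q (Zero C (ShO C M) Z)"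
    and add: "\<And>a b. \<langle>a : ShO C M \<rightarrow> Z\<rangle> \<Longrightarrow> \<langle>b : ShO C M \<rightarrow> Z\<rangle> \<Longrightarrow> Q a \<Longrightarrow> Q b \<Longrightarrow> Q (a \<boxplus> b)"
    and gen: "\<And>i g. i \<in> I \<Longrightarrow> \<langle>g : ShO C M \<rightarrow> X i\<rangle> \<Longrightarrow> Q (\<iota> i \<cdot> g)"
  obtain X' Z' \<iota>' where Z': "is_coproduct C I X' Z' \<iota>'" and eq: "Z = ShO C Z'"
    "\<And>i. i \<in> I \<Longrightarrow> X i = ShO C (X' i)" "\<And>i. i \<in> I \<Longrightarrow> \<iota> i = ShM C (\<iota>' i)"
    using is_coproduct_inv_ShO[OF Z] by blast
  note Zo = is_coproduct_Obj(1)[OF Z']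
  obtain f' where f': "\<langle>f' : M \<rightarrow> Z'\<rangle>" "f = ShM C f'"
    using f[unfolded eq(1)] M Zo by (rule ShM_cases)
  show "Q f"
    unfolding f'(2)
  proof (rule compact_object_induct[OF assms I Z' f'(1), where Q = "\<lambda>f. Q (ShM C f)"])
    show "Q (ShM C (Zero C M Z'))" using zero by (simp add: ShM_Zero M Zo eq(1))
    show "Q (ShM C (a \<boxplus> b))" if "\<langle>a : M \<rightarrow> Z'\<rangle>" "\<langle>b : M \<rightarrow> Z'\<rangle>" "Q (ShM C a)" "Q (ShM C b)" for a b
      using add[unfolded eq(1), OF mor_ShM[OF that(1)] mor_ShM[OF that(2)] that(3,4)]
      by (simp add: ShM_add[OF that(1,2)])
    show "Q (ShM C (\<iota>' i \<cdot> g))" if "i \<in> I" "\<langle>g : M \<rightarrow> X' i\<rangle>" for i g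
      using gen[OF that(1), of "ShM C g"] mor_ShM[OF that(2)] that(1)
      by (simp add: eq ShM_comp[OF that(2) is_coproduct_mor[OF Z' that(1)]])
  qed
qed

lemma compact_object_inv_ShO:
  assumes M: "M \<in> Obj C" and c: "compact_object \<kappa> C (ShO C M)" shows "compact_object \<kappa> C M"
proof (rule compact_objectI[OF M])
  fix I :: "'u set" and X Z \<iota> f Q
  assume I: "small \<kappa> I" and Z: "is_coproduct C I X Z \<iota>" and f: "\<langle>f : M \<rightarrow> Z\<rangle>"
    and zero: "Q (Zero C M Z)"
    and add: "\<And>a b. \<langle>a : M \<rightarrow> Z\<rangle> \<Longrightarrow> \<langle>b : M \<rightarrow> Z\<rangle> \<Longrightarrow> Q a \<Longrightarrow> Q b \<Longrightarrow> Q (a \<boxplus> b)"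
    and gen: "\<And>i g. i \<in> I \<Longrightarrow> \<langle>g : M \<rightarrow> X i\<rangle> \<Longrightarrow> Q (\<iota> i \<cdot> g)"
  note O = is_coproduct_Obj[OF Z]
  \<comment> \<open>The induction runs over the translated map, so the property of \<open>f\<close>
    is restated for every preimage under \<open>ShM\<close>.\<close>
  have "\<forall>f'. \<langle>f' : M \<rightarrow> Z\<rangle> \<longrightarrow> ShM C f = ShM C f' \<longrightarrow> Q f'"
  proof (rule compact_object_induct[OF c I is_coproduct_ShO[OF Z] mor_ShM[OF f],
        where Q = "\<lambda>u. \<forall>f'. \<langle>f' : M \<rightarrow> Z\<rangle> \<longrightarrow> u = ShM C f' \<longrightarrow> Q f'"]; (intro allI impI)?)
    fix f' assume f': "\<langle>f' : M \<rightarrow> Z\<rangle>"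
    show "Q f'" if "Zero C (ShO C M) (ShO C Z) = ShM C f'"
      using ShM_eq_Zero[OF f'] that zero by simp
    show "Q f'" if ab: "\<langle>a : ShO C M \<rightarrow> ShO C Z\<rangle>" "\<langle>b : ShO C M \<rightarrow> ShO C Z\<rangle>"
      "\<forall>f'. \<langle>f' : M \<rightarrow> Z\<rangle> \<longrightarrow> a = ShM C f' \<longrightarrow> Q f'" "\<forall>f'. \<langle>f' : M \<rightarrow> Z\<rangle> \<longrightarrow> b = ShM C f' \<longrightarrow> Q f'"
      "a \<boxplus> b = ShM C f'" for a b
    proof -
      obtain a' where a': "\<langle>a' : M \<rightarrow> Z\<rangle>" "a = ShM C a'" using ab(1) M O(1) by (rule ShM_cases)
      obtain b' where b': "\<langle>b' : M \<rightarrow> Z\<rangle>" "b = ShM C b'" using ab(2) M O(1) by (rule ShM_cases)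
      have "f' = a' \<boxplus> b'"
        using ShM_inj[OF f' mor_add[OF a'(1) b'(1)]] ShM_add[OF a'(1) b'(1)] ab(5) a'(2) b'(2) by simp
      then show ?thesis using add[OF a'(1) b'(1)] ab(3,4) a' b' by simp
    qed
    show "Q f'" if i: "i \<in> I" and g: "\<langle>g : ShO C M \<rightarrow> ShO C (X i)\<rangle>" and eq: "ShM C (\<iota> i) \<cdot> g = ShM C f'" for i g
    proof -
      obtain g' where g': "\<langle>g' : M \<rightarrow> X i\<rangle>" "g = ShM C g'" using g M O(2)[OF i] by (rule ShM_cases)
      note \<iota> = is_coproduct_mor[OF Z i]
      have "f' = \<iota> i \<cdot> g'"
        using ShM_inj[OF f' mor_comp[OF g'(1) \<iota>]] ShM_comp[OF g'(1) \<iota>] eq g'(2) by simp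
      then show ?thesis using gen[OF i g'(1)] by simp
    qed
  qed
  then show "Q f" using f by blast
qed

lemma compact_object_shift:
  assumes "compact_object \<kappa> C M" shows "compact_object \<kappa> C (shift C i M)"
proof (induction i rule: int_induct[of _ 0])
  case (step1 i)
  then show ?case using compact_object_ShO ShO_shift[OF compact_object_Obj[OF assms]] by metis
next
  case (step2 i)
  then show ?case
    using compact_object_inv_ShO[of "shift C (i - 1) M"] ShO_shift[OF compact_object_Obj[OF assms], of "i - 1"]
      compact_object_Obj[OF assms] by simp
qed (use assms in simp)

lemma small_Hom: "compact_object \<kappa> C M \<Longrightarrow> X \<in> Obj C \<Longrightarrow> small \<kappa> (Hom C M X)"
  using compact_homs_small by (simp add: compact_homs_small_def)


section \<open>Extension-closed and coproduct-closed classes\<close>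

lemma ext_closedI:
  assumes "\<And>N. zero_object C N \<Longrightarrow> N \<in> A" "\<And>X Z Y. tri X Z Y \<Longrightarrow> X \<in> A \<Longrightarrow> Y \<in> A \<Longrightarrow> Z \<in> A"
  shows "ext_closed C A"
  using assms unfolding ext_closed_def tri_def by blast

lemma ext_closedD: "ext_closed C A \<Longrightarrow> tri X Z Y \<Longrightarrow> X \<in> A \<Longrightarrow> Y \<in> A \<Longrightarrow> Z \<in> A"
  unfolding ext_closed_def tri_def by blast

lemma ext_closed_zero: "ext_closed C A \<Longrightarrow> zero_object C N \<Longrightarrow> N \<in> A"
  unfolding ext_closed_def by blast

lemma ext_closed_left_perp:
  assumes "Y \<in> Obj C" shows "ext_closed C {X \<in> Obj C. Hom_trivial C X Y}"
proof (rule ext_closedI)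
  fix N assume "zero_object C N"
  then show "N \<in> {X \<in> Obj C. Hom_trivial C X Y}"
    using Hom_trivial_iff zero_object_from zero_object_Obj assms by blast
next
  fix X Z X' assume t: "tri X Z X'"
    and X: "X \<in> {X \<in> Obj C. Hom_trivial C X Y}" and X': "X' \<in> {X \<in> Obj C. Hom_trivial C X Y}"
  obtain f g h where d: "(X, Z, X', f, g, h) \<in> Dist C" using t by (auto simp: tri_def)
  note m = Dist_mor[OF d]
  have "b = Zero C Z Y" if b: "\<langle>b : Z \<rightarrow> Y\<rangle>" for b
  proof -
    have "b \<cdot> f = Zero C X Y" using Hom_trivialD mor_comp[OF m(1) b] X by blast
    then obtain c where c: "\<langle>c : X' \<rightarrow> Y\<rangle>" "c \<cdot> g = b" using Dist_weak_cokernel[OF d b] by blast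
    then have "c = Zero C X' Y" using X' Hom_trivialD by blast
    then show ?thesis using c Zero_comp[OF m(2) assms] by simp
  qed
  then show "Z \<in> {X \<in> Obj C. Hom_trivial C X Y}"
    using Hom_trivial_iff assms mor_Obj[OF m(2)] by blast
qed

lemma ext_closed_right_perp:
  assumes "M \<in> Obj C" shows "ext_closed C {Y \<in> Obj C. Hom_trivial C M Y}"
proof (rule ext_closedI)
  fix N assume "zero_object C N"
  then show "N \<in> {Y \<in> Obj C. Hom_trivial C M Y}"
    using Hom_trivial_iff zero_object_to zero_object_Obj assms by blast
next
  fix X Z X' assume t: "tri X Z X'"
    and X: "X \<in> {Y \<in> Obj C. Hom_trivial C M Y}" and X': "X' \<in> {Y \<in> Obj C. Hom_trivial C M Y}"
  obtain f g h where d: "(X, Z, X', f, g, h) \<in> Dist C" using t by (auto simp: tri_def)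
  note m = Dist_mor[OF d]
  have "a = Zero C M Z" if a: "\<langle>a : M \<rightarrow> Z\<rangle>" for a
  proof -
    have "g \<cdot> a = Zero C M X'" using Hom_trivialD mor_comp[OF a m(2)] X' by blast
    then obtain x where x: "\<langle>x : M \<rightarrow> X\<rangle>" "f \<cdot> x = a" using Dist_weak_kernel[OF d a] by blast
    then have "x = Zero C M X" using X Hom_trivialD by blast
    then show ?thesis using x comp_Zero[OF m(1) assms] by simp
  qed
  then show "Z \<in> {Y \<in> Obj C. Hom_trivial C M Y}"
    using Hom_trivial_iff assms mor_Obj[OF m(2)] by blast
qed

lemma coprod_closed_left_perp:
  assumes "Y \<in> Obj C" shows "coprod_closed \<kappa> C {X \<in> Obj C. Hom_trivial C X Y}"
  unfolding coprod_closed_def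
proof (intro allI impI)
  fix I :: "'u set" and X Z \<iota>
  assume X: "\<forall>i\<in>I. X i \<in> {X \<in> Obj C. Hom_trivial C X Y}" and Z: "is_coproduct C I X Z \<iota>"
  note Zo = is_coproduct_Obj(1)[OF Z]
  have "f = Zero C Z Y" if f: "\<langle>f : Z \<rightarrow> Y\<rangle>" for f
  proof (rule is_coproduct_ext[OF Z f mor_Zero[OF Zo assms]])
    fix i assume i: "i \<in> I"
    note \<iota> = is_coproduct_mor[OF Z i]
    show "f \<cdot> \<iota> i = Zero C Z Y \<cdot> \<iota> i"
      using Hom_trivialD[OF _ mor_comp[OF \<iota> f]] Hom_trivialD[OF _ mor_comp[OF \<iota> mor_Zero[OF Zo assms]]] X i
      by simp
  qed
  then show "Z \<in> {X \<in> Obj C. Hom_trivial C X Y}" using Hom_trivial_iff Zo assms by blast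
qed

text \<open>By compactness a map from \<open>M\<close> into the coproduct is a finite sum of maps
  through the summands, each of which is zero.\<close>

lemma coprod_closed_right_perp:
  assumes M: "compact_object \<kappa> C M" shows "coprod_closed \<kappa> C {Y \<in> Obj C. Hom_trivial C M Y}"
  unfolding coprod_closed_def
proof (intro allI impI)
  fix I :: "'u set" and X Z \<iota>
  assume I: "small \<kappa> I" and X: "\<forall>i\<in>I. X i \<in> {Y \<in> Obj C. Hom_trivial C M Y}"
    and Z: "is_coproduct C I X Z \<iota>"
  note Mo = compact_object_Obj[OF M] and Zo = is_coproduct_Obj(1)[OF Z]
  have "f = Zero C M Z" if f: "\<langle>f : M \<rightarrow> Z\<rangle>" for f
  proof (rule compact_object_induct[OF M I Z f, where Q = "\<lambda>f. f = Zero C M Z"])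
    show "\<iota> i \<cdot> g = Zero C M Z" if "i \<in> I" "\<langle>g : M \<rightarrow> X i\<rangle>" for i g
      using Hom_trivialD[OF _ that(2)] X that(1) comp_Zero[OF is_coproduct_mor[OF Z that(1)] Mo] by simp
  qed (use add_Zero[OF mor_Zero[OF Mo Zo]] in simp_all)
  then show "Z \<in> {Y \<in> Obj C. Hom_trivial C M Y}" using Hom_trivial_iff Zo Mo by blast
qed

lemma ext_closed_Inter: "(\<And>A. A \<in> \<A> \<Longrightarrow> ext_closed C A) \<Longrightarrow> ext_closed C (\<Inter>\<A>)"
  by (rule ext_closedI) (blast intro: ext_closedD ext_closed_zero)+

lemma coprod_closed_Inter: "(\<And>A. A \<in> \<A> \<Longrightarrow> coprod_closed \<kappa> C A) \<Longrightarrow> coprod_closed \<kappa> C (\<Inter>\<A>)"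
  unfolding coprod_closed_def by blast

lemma ext_closed_cl: "ext_closed C (cl \<kappa> C S)"
  unfolding cl_def by (rule ext_closed_Inter) simp

lemma coprod_closed_cl: "coprod_closed \<kappa> C (cl \<kappa> C S)"
  unfolding cl_def by (rule coprod_closed_Inter) simp

lemma subset_cl: "S \<subseteq> cl \<kappa> C S"
  unfolding cl_def by blast

lemma cl_least: "A \<subseteq> Obj C \<Longrightarrow> S \<subseteq> A \<Longrightarrow> ext_closed C A \<Longrightarrow> coprod_closed \<kappa> C A \<Longrightarrow> cl \<kappa> C S \<subseteq> A"
  unfolding cl_def by blast

lemma cl_Obj: "S \<subseteq> Obj C \<Longrightarrow> cl \<kappa> C S \<subseteq> Obj C"
proof (rule cl_least)
  show "ext_closed C (Obj C)" by (rule ext_closedI) (auto simp: zero_object_Obj dest: tri_Obj)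
  show "coprod_closed \<kappa> C (Obj C)" unfolding coprod_closed_def is_coproduct_def by blast
qed auto

lemma cl_mono: "S \<subseteq> cl \<kappa> C T \<Longrightarrow> T \<subseteq> Obj C \<Longrightarrow> cl \<kappa> C S \<subseteq> cl \<kappa> C T"
  by (rule cl_least[OF cl_Obj _ ext_closed_cl coprod_closed_cl])

text \<open>Devissage in two rounds. With a generator \<open>M\<close> fixed on the left, the class
  of admissible \<open>Y\<close> is closed because \<open>M\<close> is compact; then, with
  \<open>Y\<close> fixed, the class of admissible \<open>X\<close> is closed as a left
  orthogonal.\<close>

lemma Hom_trivial_cl:
  assumes S: "\<And>M. M \<in> S \<Longrightarrow> compact_object \<kappa> C M" and T: "T \<subseteq> Obj C"
    and triv: "\<And>M N. M \<in> S \<Longrightarrow> N \<in> T \<Longrightarrow> Hom_trivial C M (shift C i N)"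
    and X: "X \<in> cl \<kappa> C S" and Y: "Y \<in> cl \<kappa> C T"
  shows "Hom_trivial C X (shift C i Y)"
proof -
  have Yo: "Y \<in> Obj C" using cl_Obj[OF T] Y by blast
  have SO: "S \<subseteq> Obj C" using S compact_object_Obj by blast
  have 1: "Hom_trivial C M (shift C i Y)" if M: "M \<in> S" for M
  proof -
    note Mo = compact_object_Obj[OF S[OF M]]
    \<comment> \<open>The shift is moved to the left so that the class in question is the right
      orthogonal of the compact object \<open>M[-i]\<close>.\<close>
    note M' = compact_object_shift[OF S[OF M], of "- i"]
    have iff: "Hom_trivial C (shift C (- i) M) N \<longleftrightarrow> Hom_trivial C M (shift C i N)" if "N \<in> Obj C" for N
      using Hom_trivial_shift_left[OF Mo that, of "- i"] by simp
    have "cl \<kappa> C T \<subseteq> {N \<in> Obj C. Hom_trivial C (shift C (- i) M) N}"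
      by (rule cl_least[OF _ _ ext_closed_right_perp[OF compact_object_Obj[OF M']] coprod_closed_right_perp[OF M']])
        (use T triv[OF M] iff in auto)
    then show ?thesis using Y iff[OF Yo] by blast
  qed
  have "cl \<kappa> C S \<subseteq> {X \<in> Obj C. Hom_trivial C X (shift C i Y)}"
    using Yo by (intro cl_least ext_closed_left_perp coprod_closed_left_perp) (use 1 SO in auto)
  then show ?thesis using X by blast
qed

lemma ext_closed_ShO:
  assumes A: "ext_closed C A" "A \<subseteq> Obj C" shows "ext_closed C (ShO C ` A)"
proof (rule ext_closedI)
  fix N assume N: "zero_object C N"
  obtain N' where N': "N' \<in> Obj C" "N = ShO C N'" using zero_object_Obj[OF N] by (rule ShO_cases)
  have "Id C N' = Zero C N' N'"
    using ShM_eq_Zero[OF mor_Id[OF N'(1)]] ShM_Id[OF N'(1)] N N'(2) by (simp add: zero_object_iff)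
  then have "zero_object C N'" using N' by (simp add: zero_object_iff)
  then show "N \<in> ShO C ` A" using ext_closed_zero[OF A(1)] N' by blast
next
  fix X Z Y assume t: "tri X Z Y" and X: "X \<in> ShO C ` A" and Y: "Y \<in> ShO C ` A"
  obtain X' Y' where XY: "X' \<in> A" "X = ShO C X'" "Y' \<in> A" "Y = ShO C Y'" using X Y by blast
  obtain Z' where Z': "Z' \<in> Obj C" "Z = ShO C Z'" using tri_Obj(2)[OF t] by (rule ShO_cases)
  have "tri X' Z' Y'" using t tri_ShO_iff[of X' Z' Y'] XY Z' A(2) by auto
  then show "Z \<in> ShO C ` A" using ext_closedD[OF A(1)] XY Z' by blast
qed

lemma coprod_closed_ShO:
  assumes A: "coprod_closed \<kappa> C A" "A \<subseteq> Obj C" shows "coprod_closed \<kappa> C (ShO C ` A)"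
  unfolding coprod_closed_def
proof (intro allI impI)
  fix I :: "'u set" and X Z \<iota>
  assume I: "small \<kappa> I" and X: "\<forall>i\<in>I. X i \<in> ShO C ` A" and Z: "is_coproduct C I X Z \<iota>"
  obtain X' Z' \<iota>' where Z': "is_coproduct C I X' Z' \<iota>'" "Z = ShO C Z'" "\<And>i. i \<in> I \<Longrightarrow> X i = ShO C (X' i)"
    using is_coproduct_inv_ShO[OF Z] by blast
  have "X' i \<in> A" if i: "i \<in> I" for i
  proof -
    obtain Y where Y: "Y \<in> A" "X i = ShO C Y" using X i by blast
    then have "X' i = Y" using ShO_inj[OF is_coproduct_Obj(2)[OF Z'(1) i]] Z'(3)[OF i] A(2) by auto
    then show ?thesis using Y by simp
  qed
  then show "Z \<in> ShO C ` A" using coprod_closedD[OF A(1) I Z'(1)] Z'(2) by blast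
qed

text \<open>The cone of a coproduct of the first maps of a family of triangles has the universal
  property of the coproduct of their cones.\<close>

lemma coprod_closed_star:
  assumes A: "coprod_closed \<kappa> C A" and B: "coprod_closed \<kappa> C B"
  shows "coprod_closed \<kappa> C (star C A B)"
  unfolding coprod_closed_def
proof (intro allI impI)
  fix I :: "'u set" and Y Z \<epsilon>
  assume I: "small \<kappa> I" and Y: "\<forall>i\<in>I. Y i \<in> star C A B" and Z: "is_coproduct C I Y Z \<epsilon>"
  have "\<exists>X W f g h. X \<in> A \<and> W \<in> B \<and> (X, Y i, W, f, g, h) \<in> Dist C" if "i \<in> I" for i
    using bspec[OF Y that] unfolding star_def by blast
  then obtain X W f g h where XA: "\<And>i. i \<in> I \<Longrightarrow> X i \<in> A" and WB: "\<And>i. i \<in> I \<Longrightarrow> W i \<in> B"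
    and d: "\<And>i. i \<in> I \<Longrightarrow> (X i, Y i, W i, f i, g i, h i) \<in> Dist C"
    by metis
  note m = Dist_mor[OF d]
  obtain S \<iota> where S: "is_coproduct C I X S \<iota>"
    using ex_coproduct[OF I, of X] mor_Obj(1)[OF m(1)] by blast
  note \<iota> = is_coproduct_mor[OF S] and \<epsilon> = is_coproduct_mor[OF Z]
  note SO = is_coproduct_Obj(1)[OF S] and ZO = is_coproduct_Obj(1)[OF Z]
  have "\<langle>\<epsilon> i \<cdot> f i : X i \<rightarrow> Z\<rangle>" if "i \<in> I" for i using m(1)[OF that] \<epsilon>[OF that] by (rule mor_comp)
  then obtain F where F: "\<langle>F : S \<rightarrow> Z\<rangle>" "\<And>i. i \<in> I \<Longrightarrow> F \<cdot> \<iota> i = \<epsilon> i \<cdot> f i"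
    using is_coproduct_desc[OF S ZO, of "\<lambda>i. \<epsilon> i \<cdot> f i"] by blast
  obtain V G H where D: "(S, Z, V, F, G, H) \<in> Dist C"
    using TR1_cone[OF SO ZO mor_Hom[OF F(1)]] by blast
  note M = Dist_mor[OF D]
  note VO = mor_Obj(2)[OF M(2)]
  \<comment> \<open>These fill-ins are arbitrary; any choice of them makes \<open>V\<close> a
    coproduct of the \<open>W i\<close>.\<close>
  have "\<exists>c. \<langle>c : W i \<rightarrow> V\<rangle> \<and> c \<cdot> g i = G \<cdot> \<epsilon> i \<and> ShM C (\<iota> i) \<cdot> h i = H \<cdot> c" if i: "i \<in> I" for i
    using TR3[OF d[OF i] D mor_Hom[OF \<iota>[OF i]] mor_Hom[OF \<epsilon>[OF i]] F(2)[OF i, symmetric]]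
      mor_Obj(2)[OF m(2)[OF i]] VO unfolding mor_def by blast
  then obtain c where c: "\<And>i. i \<in> I \<Longrightarrow> \<langle>c i : W i \<rightarrow> V\<rangle>"
    "\<And>i. i \<in> I \<Longrightarrow> c i \<cdot> g i = G \<cdot> \<epsilon> i" "\<And>i. i \<in> I \<Longrightarrow> ShM C (\<iota> i) \<cdot> h i = H \<cdot> c i"
    by metis
  note S1 = is_coproduct_ShO[OF S] and Z1 = is_coproduct_ShO[OF Z]
  have "is_coproduct C I W V c"
  proof (rule is_coproductI[OF VO c(1)])
    fix T k assume T: "T \<in> Obj C" and k: "\<And>i. i \<in> I \<Longrightarrow> \<langle>k i : W i \<rightarrow> T\<rangle>"
    have kg: "\<langle>k i \<cdot> g i : Y i \<rightarrow> T\<rangle>" if "i \<in> I" for i using m(2)[OF that] k[OF that] by (rule mor_comp)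
    obtain b where b: "\<langle>b : Z \<rightarrow> T\<rangle>" "\<And>i. i \<in> I \<Longrightarrow> b \<cdot> \<epsilon> i = k i \<cdot> g i"
      using is_coproduct_desc[OF Z T, of "\<lambda>i. k i \<cdot> g i"] kg by blast
    have "b \<cdot> F = Zero C S T"
    proof (rule is_coproduct_ext[OF S mor_comp[OF F(1) b(1)] mor_Zero[OF SO T]])
      fix i assume i: "i \<in> I"
      have "(b \<cdot> F) \<cdot> \<iota> i = b \<cdot> (\<epsilon> i \<cdot> f i)" using comp_assoc[OF \<iota>[OF i] F(1) b(1)] F(2)[OF i] by simp
      also have "\<dots> = (k i \<cdot> g i) \<cdot> f i" using comp_assoc[OF m(1)[OF i] \<epsilon>[OF i] b(1)] b(2)[OF i] by simp
      also have "\<dots> = k i \<cdot> (g i \<cdot> f i)" using comp_assoc[OF m(1)[OF i] m(2)[OF i] k[OF i]] .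
      also have "\<dots> = Zero C (X i) T"
        using Dist_comp_zero(1)[OF d[OF i]] comp_Zero[OF k[OF i] mor_Obj(1)[OF m(1)[OF i]]] by simp
      finally show "(b \<cdot> F) \<cdot> \<iota> i = Zero C S T \<cdot> \<iota> i" using Zero_comp[OF \<iota>[OF i] T] by simp
    qed
    \<comment> \<open>\<open>b'\<close> need not restrict to \<open>k i\<close> on
      \<open>W i\<close>. The two agree after composition with \<open>g i\<close>, so their
      difference factors through \<open>h i\<close>.\<close>
    then obtain b' where b': "\<langle>b' : V \<rightarrow> T\<rangle>" "b' \<cdot> G = b" using Dist_weak_cokernel[OF D b(1)] by blast
    have b'c: "\<langle>b' \<cdot> c i : W i \<rightarrow> T\<rangle>" if "i \<in> I" for i using c(1)[OF that] b'(1) by (rule mor_comp)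
    have "\<exists>u. \<langle>u : ShO C (X i) \<rightarrow> T\<rangle> \<and> u \<cdot> h i = sub (W i) T (b' \<cdot> c i) (k i)" if i: "i \<in> I" for i
    proof (rule Dist_weak_cokernel2[OF d[OF i] mor_sub[OF b'c[OF i] k[OF i]]])
      have "(b' \<cdot> c i) \<cdot> g i = b' \<cdot> (G \<cdot> \<epsilon> i)"
        using comp_assoc[OF m(2)[OF i] c(1)[OF i] b'(1)] c(2)[OF i] by simp
      also have "\<dots> = k i \<cdot> g i" using comp_assoc[OF \<epsilon>[OF i] M(2) b'(1)] b'(2) b(2)[OF i] by simp
      finally show "sub (W i) T (b' \<cdot> c i) (k i) \<cdot> g i = Zero C (Y i) T"
        using sub_comp[OF m(2)[OF i] b'c[OF i] k[OF i]] sub_eq_Zero_iff[OF kg[OF i] kg[OF i]] by simp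
    qed blast
    then obtain u where u: "\<And>i. i \<in> I \<Longrightarrow> \<langle>u i : ShO C (X i) \<rightarrow> T\<rangle>"
      "\<And>i. i \<in> I \<Longrightarrow> u i \<cdot> h i = sub (W i) T (b' \<cdot> c i) (k i)" by metis
    obtain v where v: "\<langle>v : ShO C S \<rightarrow> T\<rangle>" "\<And>i. i \<in> I \<Longrightarrow> v \<cdot> ShM C (\<iota> i) = u i"
      using is_coproduct_desc[OF S1 T u(1)] by blast
    have vH: "\<langle>v \<cdot> H : V \<rightarrow> T\<rangle>" using M(3) v(1) by (rule mor_comp)
    \<comment> \<open>The errors \<open>u i\<close> glue to a map \<open>v\<close> on
      \<open>S[1]\<close>, and subtracting \<open>v H\<close> from \<open>b'\<close> removes all of
      them at once.\<close>
    have "sub V T b' (v \<cdot> H) \<cdot> c i = k i" if i: "i \<in> I" for i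
    proof -
      have "(v \<cdot> H) \<cdot> c i = v \<cdot> (ShM C (\<iota> i) \<cdot> h i)" using comp_assoc[OF c(1)[OF i] M(3) v(1)] c(3)[OF i] by simp
      also have "\<dots> = sub (W i) T (b' \<cdot> c i) (k i)"
        using comp_assoc[OF m(3)[OF i] mor_ShM[OF \<iota>[OF i]] v(1)] v(2)[OF i] u(2)[OF i] by simp
      finally show ?thesis
        using sub_comp[OF c(1)[OF i] b'(1) vH] sub_sub[OF b'c[OF i] k[OF i]] by simp
    qed
    then show "\<exists>l. \<langle>l : V \<rightarrow> T\<rangle> \<and> (\<forall>i\<in>I. l \<cdot> c i = k i)" using mor_sub[OF b'(1) vH] by blast
  next
    fix T p q assume p: "\<langle>p : V \<rightarrow> T\<rangle>" and q: "\<langle>q : V \<rightarrow> T\<rangle>" and pq: "\<And>i. i \<in> I \<Longrightarrow> p \<cdot> c i = q \<cdot> c i"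
    define r where "r = sub V T p q"
    have r: "\<langle>r : V \<rightarrow> T\<rangle>" unfolding r_def using p q by (rule mor_sub)
    note T = mor_Obj(2)[OF p]
    have rc: "r \<cdot> c i = Zero C (W i) T" if i: "i \<in> I" for i
      unfolding r_def using sub_comp[OF c(1)[OF i] p q] pq[OF i]
        sub_eq_Zero_iff[OF mor_comp[OF c(1)[OF i] q] mor_comp[OF c(1)[OF i] q]] by simp
    have "r \<cdot> G = Zero C Z T"
    proof (rule is_coproduct_ext[OF Z mor_comp[OF M(2) r] mor_Zero[OF ZO T]])
      fix i assume i: "i \<in> I"
      have "(r \<cdot> G) \<cdot> \<epsilon> i = (r \<cdot> c i) \<cdot> g i"
        using comp_assoc[OF \<epsilon>[OF i] M(2) r] comp_assoc[OF m(2)[OF i] c(1)[OF i] r] c(2)[OF i] by simp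
      then show "(r \<cdot> G) \<cdot> \<epsilon> i = Zero C Z T \<cdot> \<epsilon> i"
        using rc[OF i] Zero_comp[OF m(2)[OF i] T] Zero_comp[OF \<epsilon>[OF i] T] by simp
    qed
    \<comment> \<open>For uniqueness, \<open>r\<close> is factored as \<open>u H\<close>. On each
      summand \<open>u\<close> extends along the translate of \<open>f i\<close>, so
      \<open>u\<close> factors through the translate of \<open>F\<close>, whose composite with
      \<open>H\<close> is zero.\<close>
    then obtain u where u: "\<langle>u : ShO C S \<rightarrow> T\<rangle>" "u \<cdot> H = r" using Dist_weak_cokernel2[OF D r] by blast
    have u\<iota>: "\<langle>u \<cdot> ShM C (\<iota> i) : ShO C (X i) \<rightarrow> T\<rangle>" if "i \<in> I" for i
      using mor_ShM[OF \<iota>[OF that]] u(1) by (rule mor_comp)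
    have "\<exists>v. \<langle>v : ShO C (Y i) \<rightarrow> T\<rangle> \<and> v \<cdot> ShM C (f i) = u \<cdot> ShM C (\<iota> i)" if i: "i \<in> I" for i
    proof (rule Dist_weak_cokernel3[OF d[OF i] u\<iota>[OF i]])
      show "(u \<cdot> ShM C (\<iota> i)) \<cdot> h i = Zero C (W i) T"
        using comp_assoc[OF m(3)[OF i] mor_ShM[OF \<iota>[OF i]] u(1)] c(3)[OF i]
          comp_assoc[OF c(1)[OF i] M(3) u(1)] u(2) rc[OF i] by simp
    qed blast
    then obtain v where v: "\<And>i. i \<in> I \<Longrightarrow> \<langle>v i : ShO C (Y i) \<rightarrow> T\<rangle>"
      "\<And>i. i \<in> I \<Longrightarrow> v i \<cdot> ShM C (f i) = u \<cdot> ShM C (\<iota> i)" by metis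
    obtain w where w: "\<langle>w : ShO C Z \<rightarrow> T\<rangle>" "\<And>i. i \<in> I \<Longrightarrow> w \<cdot> ShM C (\<epsilon> i) = v i"
      using is_coproduct_desc[OF Z1 T v(1)] by blast
    have "u = w \<cdot> ShM C F"
    proof (rule is_coproduct_ext[OF S1 u(1) mor_comp[OF mor_ShM[OF F(1)] w(1)]])
      fix i assume i: "i \<in> I"
      have "(w \<cdot> ShM C F) \<cdot> ShM C (\<iota> i) = w \<cdot> ShM C (F \<cdot> \<iota> i)"
        using comp_assoc[OF mor_ShM[OF \<iota>[OF i]] mor_ShM[OF F(1)] w(1)] ShM_comp[OF \<iota>[OF i] F(1)] by simp
      also have "\<dots> = w \<cdot> (ShM C (\<epsilon> i) \<cdot> ShM C (f i))" using F(2)[OF i] ShM_comp[OF m(1)[OF i] \<epsilon>[OF i]] by simp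
      also have "\<dots> = u \<cdot> ShM C (\<iota> i)"
        using comp_assoc[OF mor_ShM[OF m(1)[OF i]] mor_ShM[OF \<epsilon>[OF i]] w(1)] w(2)[OF i] v(2)[OF i] by simp
      finally show "u \<cdot> ShM C (\<iota> i) = (w \<cdot> ShM C F) \<cdot> ShM C (\<iota> i)" by simp
    qed
    then have "r = w \<cdot> (ShM C F \<cdot> H)"
      using u(2) comp_assoc[OF M(3) mor_ShM[OF F(1)] w(1)] by simp
    then have "r = Zero C V T" using Dist_comp_zero(3)[OF D] comp_Zero[OF w(1) VO] by simp
    then show "p = q" unfolding r_def using sub_eq_Zero_iff[OF p q] by simp
  qed
  then have "V \<in> B" using WB coprod_closedD[OF B I] by blast
  moreover have "S \<in> A" using XA coprod_closedD[OF A I S] by blast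
  ultimately show "Z \<in> star C A B" using triI[OF D] star_iff by blast
qed

lemma star_swap:
  assumes V: "ext_closed C V" and triv: "\<And>X Y. X \<in> V \<Longrightarrow> Y \<in> K \<Longrightarrow> Hom_trivial C Y (ShO C X)"
  shows "star C V K \<subseteq> star C K V"
proof
  fix Z assume "Z \<in> star C V K"
  then obtain X Y where XY: "X \<in> V" "Y \<in> K" "tri X Z Y" using star_iff by blast
  obtain N where N: "zero_object C N" using ex_zero_object by blast
  obtain W where "tri Y Z W" "tri X W N" using tri_swap[OF XY(3) triv[OF XY(1,2)] N] .
  moreover from this have "W \<in> V" using ext_closedD[OF V] XY(1) ext_closed_zero[OF V N] by blast
  ultimately show "Z \<in> star C K V" using XY(2) star_iff by blast
qed

lemma star_subset: "ext_closed C A \<Longrightarrow> star C A A \<subseteq> A"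
  unfolding star_iff subset_iff using ext_closedD by blast

lemma subset_star_left:
  assumes "ext_closed C B" "A \<subseteq> Obj C" shows "A \<subseteq> star C A B"
proof
  fix X assume "X \<in> A"
  moreover obtain N where N: "zero_object C N" using ex_zero_object by blast
  ultimately have "tri X X N" using tri_Id(1) assms(2) by blast
  then show "X \<in> star C A B" using \<open>X \<in> A\<close> ext_closed_zero[OF assms(1) N] star_iff by blast
qed

lemma subset_star_right:
  assumes "\<And>N. zero_object C N \<Longrightarrow> N \<in> A" "B \<subseteq> Obj C" shows "B \<subseteq> star C A B"
proof
  fix X assume "X \<in> B"
  moreover obtain N where N: "zero_object C N" using ex_zero_object by blast
  ultimately have "tri N X X" using tri_Id(2) assms(2) by blast
  then show "X \<in> star C A B" using \<open>X \<in> B\<close> assms(1)[OF N] star_iff by blast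
qed

text \<open>Associativity regroups the four factors as
  \<open>K \<star> (V \<star> K) \<star> V\<close>; the middle pair is swapped and equal neighbours
  are absorbed.\<close>

lemma ext_closed_star:
  assumes K: "ext_closed C K" and V: "ext_closed C V" "V \<subseteq> Obj C"
    and triv: "\<And>X Y. X \<in> V \<Longrightarrow> Y \<in> K \<Longrightarrow> Hom_trivial C Y (ShO C X)"
  shows "ext_closed C (star C K V)"
proof (rule ext_closedI)
  fix N assume "zero_object C N"
  then show "N \<in> star C K V"
    using ext_closed_zero[OF K] ext_closed_zero[OF V(1)] tri_Id[OF zero_object_Obj] star_iff by blast
next
  fix X Z Y assume "tri X Z Y" "X \<in> star C K V" "Y \<in> star C K V"
  then have "Z \<in> star C (star C K V) (star C K V)" using star_iff by blast
  also have "\<dots> = star C K (star C (star C V K) V)" by (simp only: star_assoc)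
  also have "\<dots> \<subseteq> star C K (star C (star C K V) V)"
    by (intro star_mono order_refl star_swap[OF V(1) triv])
  also have "\<dots> = star C (star C K K) (star C V V)" by (simp only: star_assoc)
  also have "\<dots> \<subseteq> star C K V" by (intro star_mono star_subset K V)
  finally show "Z \<in> star C K V" .
qed

section \<open>Homotopy colimits and truncation triangles\<close>


text \<open>The properties of a mapping telescope that are used later. The map \<open>k\<close> is
  only asserted to exist, since cones have a weak universal property. The last clause asks for
  stability under translation because \<open>H\<close> fits into a triangle between a coproduct
  \<open>S\<close> of the \<open>L n\<close> and \<open>S[1]\<close>.\<close>

definition is_hocolim :: "(nat \<Rightarrow> 'o) \<Rightarrow> (nat \<Rightarrow> 'm) \<Rightarrow> 'o \<Rightarrow> (nat \<Rightarrow> 'm) \<Rightarrow> bool" where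
  "is_hocolim L \<phi> H j \<longleftrightarrow> (\<forall>n. \<langle>j n : L n \<rightarrow> H\<rangle>) \<and> (\<forall>n. j (Suc n) \<cdot> \<phi> n = j n) \<and>
    (\<forall>M l. (\<forall>n. \<langle>l n : L n \<rightarrow> M\<rangle>) \<longrightarrow> (\<forall>n. l (Suc n) \<cdot> \<phi> n = l n) \<longrightarrow>
      (\<exists>k. \<langle>k : H \<rightarrow> M\<rangle> \<and> (\<forall>n. k \<cdot> j n = l n))) \<and>
    (\<forall>c x. compact_object \<kappa> C c \<longrightarrow> \<langle>x : c \<rightarrow> H\<rangle> \<longrightarrow> (\<exists>n x'. \<langle>x' : c \<rightarrow> L n\<rangle> \<and> x = j n \<cdot> x')) \<and>
    (\<forall>A. ext_closed C A \<longrightarrow> coprod_closed \<kappa> C A \<longrightarrow> ShO C ` A \<subseteq> A \<longrightarrow> range L \<subseteq> A \<longrightarrow> H \<in> A)"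

lemma ex_hocolim:
  fixes L :: "nat \<Rightarrow> 'o"
  assumes \<phi>: "\<And>n. \<langle>\<phi> n : L n \<rightarrow> L (Suc n)\<rangle>"
  obtains H j where "is_hocolim L \<phi> H j"
proof -
  have I: "small \<kappa> (UNIV :: nat set)" by (rule small_countable[OF smallness_cardinal]) simp
  have LO: "L n \<in> Obj C" for n using mor_Obj(1)[OF \<phi>] .
  obtain S \<iota> where S: "is_coproduct C UNIV L S \<iota>" using ex_coproduct[OF I, of L] LO by blast
  note SO = is_coproduct_Obj(1)[OF S] and \<iota> = is_coproduct_mor[OF S UNIV_I]
  have \<iota>\<phi>: "\<langle>\<iota> (Suc n) \<cdot> \<phi> n : L n \<rightarrow> S\<rangle>" for n using \<phi> \<iota> by (rule mor_comp)
  obtain \<sigma> where \<sigma>: "\<langle>\<sigma> : S \<rightarrow> S\<rangle>" "\<And>n. \<sigma> \<cdot> \<iota> n = \<iota> (Suc n) \<cdot> \<phi> n"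
    by (rule is_coproduct_desc[OF S SO, of "\<lambda>n. \<iota> (Suc n) \<cdot> \<phi> n"], rule \<iota>\<phi>, simp)
  \<comment> \<open>The map \<open>1 - shift\<close> on the coproduct of the sequence;
    \<open>H\<close> will be its cone.\<close>
  define \<delta> where "\<delta> = sub S S (Id C S) \<sigma>"
  have \<delta>: "\<langle>\<delta> : S \<rightarrow> S\<rangle>" unfolding \<delta>_def using SO \<sigma>(1) by (intro mor_sub mor_Id)
  have comp_\<delta>: "a \<cdot> \<delta> = sub S T a (a \<cdot> \<sigma>)" if "\<langle>a : S \<rightarrow> T\<rangle>" for a T
    unfolding \<delta>_def using comp_sub[OF mor_Id[OF SO] \<sigma>(1) that] comp_Id(2)[OF that] by simp
  obtain H q h where D: "(S, S, H, \<delta>, q, h) \<in> Dist C" using TR1_cone[OF SO SO mor_Hom[OF \<delta>]] by blast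
  note q = Dist_mor(2)[OF D] and h = Dist_mor(3)[OF D]
  note HO = mor_Obj(2)[OF q]
  define j where "j n = q \<cdot> \<iota> n" for n
  have j: "\<langle>j n : L n \<rightarrow> H\<rangle>" for n unfolding j_def using \<iota> q by (rule mor_comp)
  have q\<sigma>: "q \<cdot> \<sigma> = q"
    using Dist_comp_zero(1)[OF D] comp_\<delta>[OF q] sub_eq_Zero_iff[OF q mor_comp[OF \<sigma>(1) q]] by metis
  have j\<phi>: "j (Suc n) \<cdot> \<phi> n = j n" for n
  proof -
    have "j (Suc n) \<cdot> \<phi> n = q \<cdot> (\<sigma> \<cdot> \<iota> n)" unfolding j_def \<sigma>(2) by (rule comp_assoc[OF \<phi> \<iota> q])
    also have "\<dots> = j n" using comp_assoc[OF \<iota> \<sigma>(1) q] q\<sigma> by (simp add: j_def)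
    finally show ?thesis .
  qed
  have desc: "\<exists>k. \<langle>k : H \<rightarrow> M\<rangle> \<and> (\<forall>n. k \<cdot> j n = l n)"
    if l: "\<And>n. \<langle>l n : L n \<rightarrow> M\<rangle>" and l\<phi>: "\<And>n. l (Suc n) \<cdot> \<phi> n = l n" for M l
  proof -
    note MO = mor_Obj(2)[OF l]
    obtain a where a: "\<langle>a : S \<rightarrow> M\<rangle>" "\<And>n. a \<cdot> \<iota> n = l n"
      by (rule is_coproduct_desc[OF S MO, of l], rule l, simp)
    have a\<sigma>: "a = a \<cdot> \<sigma>"
    proof (rule is_coproduct_ext[OF S a(1) mor_comp[OF \<sigma>(1) a(1)]])
      fix n
      have "(a \<cdot> \<sigma>) \<cdot> \<iota> n = a \<cdot> (\<iota> (Suc n) \<cdot> \<phi> n)" using comp_assoc[OF \<iota> \<sigma>(1) a(1)] \<sigma>(2) by simp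
      also have "\<dots> = l (Suc n) \<cdot> \<phi> n" using comp_assoc[OF \<phi> \<iota> a(1)] a(2) by simp
      finally show "a \<cdot> \<iota> n = (a \<cdot> \<sigma>) \<cdot> \<iota> n" using a(2) l\<phi> by simp
    qed
    have "a \<cdot> \<delta> = Zero C S M"
      unfolding comp_\<delta>[OF a(1)] by (rule sub_eq_Zero_iff[OF a(1) mor_comp[OF \<sigma>(1) a(1)], THEN iffD2, OF a\<sigma>])
    then obtain k where k: "\<langle>k : H \<rightarrow> M\<rangle>" "k \<cdot> q = a" using Dist_weak_cokernel[OF D a(1)] by blast
    have "k \<cdot> j n = l n" for n unfolding j_def using comp_assoc[OF \<iota> q k(1)] k(2) a(2) by simp
    with k(1) show ?thesis by blast
  qed
  \<comment> \<open>The map \<open>x\<close> lifts to \<open>S\<close> once \<open>h x = 0\<close>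
    is known. By compactness the lift is then a finite sum through single stages, and these are
    moved to a common later stage.\<close>
  have factor: "\<exists>n x'. \<langle>x' : c \<rightarrow> L n\<rangle> \<and> x = j n \<cdot> x'" if c: "compact_object \<kappa> C c" and x: "\<langle>x : c \<rightarrow> H\<rangle>" for c x
  proof -
    note cO = compact_object_Obj[OF c]
    have "\<forall>n. \<exists>\<pi>. \<langle>\<pi> : S \<rightarrow> L n\<rangle> \<and> \<pi> \<cdot> \<iota> n = Id C (L n) \<and> (\<forall>m. m \<noteq> n \<longrightarrow> \<pi> \<cdot> \<iota> m = Zero C (L m) (L n))"
      using is_coproduct_proj[OF S UNIV_I] by (metis UNIV_I)
    then obtain \<pi> where \<pi>: "\<And>n. \<langle>\<pi> n : S \<rightarrow> L n\<rangle>" "\<And>n. \<pi> n \<cdot> \<iota> n = Id C (L n)"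
      "\<And>m n. m \<noteq> n \<Longrightarrow> \<pi> n \<cdot> \<iota> m = Zero C (L m) (L n)" by metis
    have \<pi>\<sigma>0: "\<pi> 0 \<cdot> \<sigma> = Zero C S (L 0)"
    proof (rule is_coproduct_ext[OF S mor_comp[OF \<sigma>(1) \<pi>(1)] mor_Zero[OF SO LO]])
      fix m
      have "(\<pi> 0 \<cdot> \<sigma>) \<cdot> \<iota> m = \<pi> 0 \<cdot> (\<iota> (Suc m) \<cdot> \<phi> m)" using comp_assoc[OF \<iota> \<sigma>(1) \<pi>(1)] \<sigma>(2) by simp
      also have "\<dots> = Zero C (L m) (L 0)"
        using comp_assoc[OF \<phi>[of m] \<iota> \<pi>(1)[of 0]] \<pi>(3)[of "Suc m" 0] Zero_comp[OF \<phi>[of m] LO] by simp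
      finally show "(\<pi> 0 \<cdot> \<sigma>) \<cdot> \<iota> m = Zero C S (L 0) \<cdot> \<iota> m" using Zero_comp[OF \<iota> LO] by simp
    qed
    have \<pi>\<sigma>: "\<pi> (Suc n) \<cdot> \<sigma> = \<phi> n \<cdot> \<pi> n" for n
    proof (rule is_coproduct_ext[OF S mor_comp[OF \<sigma>(1) \<pi>(1)] mor_comp[OF \<pi>(1) \<phi>]])
      fix m
      have "(\<pi> (Suc n) \<cdot> \<sigma>) \<cdot> \<iota> m = \<pi> (Suc n) \<cdot> (\<iota> (Suc m) \<cdot> \<phi> m)"
        using comp_assoc[OF \<iota> \<sigma>(1) \<pi>(1)] \<sigma>(2) by simp
      also have "\<dots> = (\<pi> (Suc n) \<cdot> \<iota> (Suc m)) \<cdot> \<phi> m" using comp_assoc[OF \<phi> \<iota> \<pi>(1)] by simp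
      also have "\<dots> = \<phi> n \<cdot> (\<pi> n \<cdot> \<iota> m)"
        using \<pi>(2)[of "Suc n"] \<pi>(3)[of "Suc m" "Suc n"] \<pi>(2)[of n] \<pi>(3)[of m n] comp_Id[OF \<phi>[of n]]
          Zero_comp[OF \<phi>[of m] LO] comp_Zero[OF \<phi>[of n] LO] by (cases "m = n") simp_all
      finally show "(\<pi> (Suc n) \<cdot> \<sigma>) \<cdot> \<iota> m = (\<phi> n \<cdot> \<pi> n) \<cdot> \<iota> m" using comp_assoc[OF \<iota> \<pi>(1) \<phi>] by simp
    qed
    define z where "z = h \<cdot> x"
    have z: "\<langle>z : c \<rightarrow> ShO C S\<rangle>" unfolding z_def using x h by (rule mor_comp)
    note S\<pi> = mor_ShM[OF \<pi>(1)]
    have \<pi>z: "\<langle>ShM C (\<pi> n) \<cdot> z : c \<rightarrow> ShO C (L n)\<rangle>" for n using z S\<pi> by (rule mor_comp)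
    have \<delta>z: "ShM C \<delta> \<cdot> z = Zero C c (ShO C S)"
      unfolding z_def using comp_assoc[OF x h mor_ShM[OF \<delta>]] Dist_comp_zero(3)[OF D]
        Zero_comp[OF x ShO_Obj[OF SO]] by simp
    \<comment> \<open>Since \<delta> is \<open>1 - shift\<close>, the vanishing of its translate on
      \<open>z\<close> says that \<open>z\<close> is fixed by the shift. Its component at
      \<open>0\<close> is therefore zero, and each further component is the image of the preceding
      one.\<close>
    have eq: "ShM C (\<pi> n) \<cdot> z = ShM C (\<pi> n \<cdot> \<sigma>) \<cdot> z" for n
    proof -
      have *: "\<langle>ShM C (\<pi> n \<cdot> \<sigma>) : ShO C S \<rightarrow> ShO C (L n)\<rangle>" by (intro mor_ShM mor_comp[OF \<sigma>(1) \<pi>(1)])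
      have "sub c (ShO C (L n)) (ShM C (\<pi> n) \<cdot> z) (ShM C (\<pi> n \<cdot> \<sigma>) \<cdot> z) = ShM C (\<pi> n \<cdot> \<delta>) \<cdot> z"
        using comp_\<delta>[OF \<pi>(1)] ShM_sub[OF \<pi>(1) mor_comp[OF \<sigma>(1) \<pi>(1)]] sub_comp[OF z S\<pi> *] by simp
      also have "\<dots> = Zero C c (ShO C (L n))"
        using ShM_comp[OF \<delta> \<pi>(1)] comp_assoc[OF z mor_ShM[OF \<delta>] S\<pi>] \<delta>z comp_Zero[OF S\<pi> cO] by simp
      finally show ?thesis by (rule sub_eq_Zero_iff[OF \<pi>z mor_comp[OF z *], THEN iffD1])
    qed
    have "ShM C (\<pi> n) \<cdot> z = Zero C c (ShO C (L n))" for n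
    proof (induction n)
      case 0
      show ?case using eq[of 0] \<pi>\<sigma>0 ShM_Zero[OF SO LO] Zero_comp[OF z ShO_Obj[OF LO]] by simp
    next
      case (Suc n)
      have "ShM C (\<pi> (Suc n)) \<cdot> z = ShM C (\<phi> n) \<cdot> (ShM C (\<pi> n) \<cdot> z)"
        using eq[of "Suc n"] \<pi>\<sigma> ShM_comp[OF \<pi>(1) \<phi>] comp_assoc[OF z S\<pi> mor_ShM[OF \<phi>]] by simp
      then show ?case using Suc comp_Zero[OF mor_ShM[OF \<phi>] cO] by simp
    qed
    moreover have "ShM C (\<pi> n) \<cdot> ShM C (\<iota> n) = Id C (ShO C (L n))" for n
      using ShM_comp[OF \<iota> \<pi>(1)] \<pi>(2)[of n] ShM_Id[OF LO] by metis
    moreover have "ShM C (\<pi> n) \<cdot> ShM C (\<iota> m) = Zero C (ShO C (L m)) (ShO C (L n))" if "m \<noteq> n" for m n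
      using ShM_comp[OF \<iota> \<pi>(1)] \<pi>(3)[OF that] ShM_Zero[OF LO LO] by metis
    ultimately have "z = Zero C c (ShO C S)"
      using S\<pi> by (intro compact_object_eq_Zero[OF c I is_coproduct_ShO[OF S] z, where p = "\<lambda>n. ShM C (\<pi> n)"])
    then obtain y where y: "\<langle>y : c \<rightarrow> S\<rangle>" "q \<cdot> y = x"
      using Dist_weak_kernel2[OF D x] unfolding z_def by blast
    have later: "\<exists>x''. \<langle>x'' : c \<rightarrow> L (n + k)\<rangle> \<and> j n \<cdot> x' = j (n + k) \<cdot> x''" if x': "\<langle>x' : c \<rightarrow> L n\<rangle>" for x' n k
    proof (induction k)
      case 0
      show ?case using x' by auto
    next
      case (Suc k)
      then obtain x'' where x'': "\<langle>x'' : c \<rightarrow> L (n + k)\<rangle>" "j n \<cdot> x' = j (n + k) \<cdot> x''" by blast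
      have "j (n + k) \<cdot> x'' = j (Suc (n + k)) \<cdot> (\<phi> (n + k) \<cdot> x'')"
        using comp_assoc[OF x''(1) \<phi> j] j\<phi> by simp
      with x''(2) mor_comp[OF x''(1) \<phi>] show ?case by auto
    qed
    have "\<exists>n x'. \<langle>x' : c \<rightarrow> L n\<rangle> \<and> q \<cdot> y = j n \<cdot> x'"
    proof (rule compact_object_induct[OF c I S y(1), where Q = "\<lambda>y. \<exists>n x'. \<langle>x' : c \<rightarrow> L n\<rangle> \<and> q \<cdot> y = j n \<cdot> x'"])
      show "\<exists>n x'. \<langle>x' : c \<rightarrow> L n\<rangle> \<and> q \<cdot> Zero C c S = j n \<cdot> x'"
        using comp_Zero[OF q cO] comp_Zero[OF j cO] mor_Zero[OF cO LO] by metis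
      show "\<exists>m x'. \<langle>x' : c \<rightarrow> L m\<rangle> \<and> q \<cdot> (\<iota> n \<cdot> g) = j m \<cdot> x'" if g: "\<langle>g : c \<rightarrow> L n\<rangle>" for n g
        using comp_assoc[OF g \<iota> q] g unfolding j_def by metis
      fix a b assume ab: "\<langle>a : c \<rightarrow> S\<rangle>" "\<langle>b : c \<rightarrow> S\<rangle>"
        and "\<exists>n x'. \<langle>x' : c \<rightarrow> L n\<rangle> \<and> q \<cdot> a = j n \<cdot> x'" "\<exists>n x'. \<langle>x' : c \<rightarrow> L n\<rangle> \<and> q \<cdot> b = j n \<cdot> x'"
      then obtain n a' m b' where a': "\<langle>a' : c \<rightarrow> L n\<rangle>" "q \<cdot> a = j n \<cdot> a'" and b': "\<langle>b' : c \<rightarrow> L m\<rangle>" "q \<cdot> b = j m \<cdot> b'"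
        by blast
      obtain a'' where a'': "\<langle>a'' : c \<rightarrow> L (n + m)\<rangle>" "q \<cdot> a = j (n + m) \<cdot> a''" using later[OF a'(1)] a'(2) by metis
      obtain b'' where b'': "\<langle>b'' : c \<rightarrow> L (n + m)\<rangle>" "q \<cdot> b = j (n + m) \<cdot> b''"
        using later[OF b'(1), of n] b'(2) by (metis Groups.add.commute)
      have "q \<cdot> (a \<boxplus> b) = j (n + m) \<cdot> (a'' \<boxplus> b'')"
        using comp_add[OF ab q] comp_add[OF a''(1) b''(1) j] a''(2) b''(2) by simp
      with mor_add[OF a''(1) b''(1)] show "\<exists>n x'. \<langle>x' : c \<rightarrow> L n\<rangle> \<and> q \<cdot> (a \<boxplus> b) = j n \<cdot> x'" by blast
    qed
    then show ?thesis using y(2) by simp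
  qed
  have "H \<in> A" if A: "ext_closed C A" "coprod_closed \<kappa> C A" "ShO C ` A \<subseteq> A" "range L \<subseteq> A" for A
  proof -
    have "S \<in> A" using coprod_closedD[OF A(2) I S] A(4) by blast
    then show ?thesis using ext_closedD[OF A(1) tri_rotate[OF triI[OF D]]] A(3) by blast
  qed
  then have "is_hocolim L \<phi> H j"
    unfolding is_hocolim_def using j j\<phi> desc factor by (intro conjI allI impI) simp_all
  then show thesis by (rule that)
qed

lemma ShO_cl:
  assumes S: "S \<subseteq> Obj C" "ShO C ` S \<subseteq> S" and X: "X \<in> cl \<kappa> C S"
  shows "ShO C X \<in> cl \<kappa> C S"
proof -
  have "cl \<kappa> C S \<subseteq> {X \<in> Obj C. ShO C X \<in> cl \<kappa> C S}"
  proof (rule cl_least)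
    show "S \<subseteq> {X \<in> Obj C. ShO C X \<in> cl \<kappa> C S}" using S subset_cl by blast
    show "ext_closed C {X \<in> Obj C. ShO C X \<in> cl \<kappa> C S}"
    proof (rule ext_closedI)
      show "N \<in> {X \<in> Obj C. ShO C X \<in> cl \<kappa> C S}" if "zero_object C N" for N
        using ext_closed_zero[OF ext_closed_cl zero_object_ShO[OF that]] zero_object_Obj[OF that] by blast
      show "Z \<in> {X \<in> Obj C. ShO C X \<in> cl \<kappa> C S}" if t: "tri X Z Y"
        and "X \<in> {X \<in> Obj C. ShO C X \<in> cl \<kappa> C S}" "Y \<in> {X \<in> Obj C. ShO C X \<in> cl \<kappa> C S}" for X Z Y
        using ext_closedD[OF ext_closed_cl, of "ShO C X" "ShO C Z" "ShO C Y" S] that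
          tri_ShO_iff[OF tri_Obj[OF t]] tri_Obj[OF t] by simp
    qed
    show "coprod_closed \<kappa> C {X \<in> Obj C. ShO C X \<in> cl \<kappa> C S}"
      unfolding coprod_closed_def
      using coprod_closedD[OF coprod_closed_cl _ is_coproduct_ShO] is_coproduct_Obj(1) by blast
  qed blast
  then show ?thesis using X by blast
qed

text \<open>The left term of the truncation triangle is a homotopy colimit: start with a coproduct of
  generators that hits all morphisms from generators to \<open>M\<close>, and successively kill those
  morphisms from (desuspended) generators that become zero in \<open>M\<close>.\<close>

lemma truncation_triangle:
  assumes small: "small \<kappa> S" and S: "\<And>s. s \<in> S \<Longrightarrow> compact_object \<kappa> C s" "ShO C ` S \<subseteq> S"
    and M: "M \<in> Obj C"
  obtains L R where "L \<in> cl \<kappa> C S" "tri L M R" "\<And>s. s \<in> S \<Longrightarrow> Hom_trivial C s R"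
proof -
  let ?A = "cl \<kappa> C S"
  have SO: "S \<subseteq> Obj C" using S(1) compact_object_Obj by blast
  have AO: "?A \<subseteq> Obj C" using cl_Obj[OF SO] .
  \<comment> \<open>For \<open>s = c[1]\<close>, a map from \<open>s\<close> to the third term
    yields a map from \<open>c\<close> to the left term that becomes zero in \<open>M\<close>. So
    the maps to be killed start at desuspended generators.\<close>
  define T where "T = {c \<in> Obj C. ShO C c \<in> S}"
  have T_compact: "compact_object \<kappa> C c" if "c \<in> T" for c
    using compact_object_inv_ShO S(1) that by (auto simp: T_def)
  have "T \<subseteq> inv_into (Obj C) (ShO C) ` S"
  proof
    fix c assume c: "c \<in> T"
    then have "c = inv_into (Obj C) (ShO C) (ShO C c)"
      using ShO_bij by (simp add: T_def bij_betw_def)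
    then show "c \<in> inv_into (Obj C) (ShO C) ` S" using c by (auto simp: T_def)
  qed
  then have T_small: "small \<kappa> T" using small_image[OF small] small_subset by blast
  \<comment> \<open>Hitting all maps \<open>s -> M\<close> is demanded at stage \<open>0\<close>
    only: the \<open>l n\<close> are compatible, so the lifts persist to the homotopy
    colimit.\<close>
  let ?P = "\<lambda>(n :: nat) p. case p of (L, l) \<Rightarrow> L \<in> ?A \<and> \<langle>l : L \<rightarrow> M\<rangle> \<and>
    (n = 0 \<longrightarrow> (\<forall>s\<in>S. \<forall>f. \<langle>f : s \<rightarrow> M\<rangle> \<longrightarrow> (\<exists>x. \<langle>x : s \<rightarrow> L\<rangle> \<and> f = l \<cdot> x)))"
  let ?Q = "\<lambda>(n :: nat) p p'. case p of (L, l) \<Rightarrow> case p' of (L', l') \<Rightarrow> \<exists>\<phi>. \<langle>\<phi> : L \<rightarrow> L'\<rangle> \<and> l' \<cdot> \<phi> = l \<and>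
    (\<forall>c\<in>T. \<forall>y. \<langle>y : c \<rightarrow> L\<rangle> \<longrightarrow> l \<cdot> y = Zero C c M \<longrightarrow> \<phi> \<cdot> y = Zero C c L')"
  have init: "\<exists>p. ?P 0 p"
  proof -
    \<comment> \<open>One copy of \<open>s\<close> for each map \<open>s -> M\<close>; this index
      set is small because hom-sets out of compact objects are small.\<close>
    define I where "I = (SIGMA s:S. Hom C s M)"
    have I: "small \<kappa> I"
      unfolding I_def by (rule small_Sigma[OF smallness_cardinal small small_Hom[OF S(1) M]])
    have mor: "\<langle>snd p : fst p \<rightarrow> M\<rangle>" if "p \<in> I" for p
      using that SO M by (auto simp: mor_def I_def)
    obtain L \<iota> where L: "is_coproduct C I fst L \<iota>"
      using I mor_Obj(1)[OF mor] by (rule ex_coproduct)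
    obtain l where l: "\<langle>l : L \<rightarrow> M\<rangle>" "\<And>p. p \<in> I \<Longrightarrow> l \<cdot> \<iota> p = snd p"
      using is_coproduct_desc[OF L M, of snd] mor by blast
    have "fst p \<in> ?A" if "p \<in> I" for p
      using that subset_cl[of S] by (auto simp: subset_iff I_def)
    then have "L \<in> ?A" by (rule coprod_closedD[OF coprod_closed_cl I L])
    moreover have "\<exists>x. \<langle>x : s \<rightarrow> L\<rangle> \<and> f = l \<cdot> x" if "s \<in> S" "\<langle>f : s \<rightarrow> M\<rangle>" for s f
    proof -
      have "(s, f) \<in> I" using that mor_Hom by (simp add: I_def)
      then show ?thesis using is_coproduct_mor[OF L, of "(s, f)"] l(2)[of "(s, f)"] by (intro exI[of _ "\<iota> (s, f)"]) simp
    qed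
    ultimately show ?thesis using l(1) by (intro exI[of _ "(L, l)"]) simp
  qed
  have step: "\<exists>p'. ?P (Suc n) p' \<and> ?Q n p p'" if p: "?P n p" for n p
  proof -
    obtain L l where Ll: "p = (L, l)" by (cases p)
    then have LA: "L \<in> ?A" and l: "\<langle>l : L \<rightarrow> M\<rangle>" using p by auto
    note LO = mor_Obj(1)[OF l]
    define I where "I = (SIGMA c:T. {y \<in> Hom C c L. l \<cdot> y = Zero C c M})"
    have "small \<kappa> {y \<in> Hom C c L. l \<cdot> y = Zero C c M}" if "c \<in> T" for c
      using small_Hom[OF T_compact[OF that] LO] by (rule small_subset) blast
    then have I: "small \<kappa> I" unfolding I_def by (intro small_Sigma[OF smallness_cardinal T_small])
    have I_mor: "\<langle>snd i : fst i \<rightarrow> L\<rangle>" "l \<cdot> snd i = Zero C (fst i) M" "fst i \<in> T" if "i \<in> I" for i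
      using that LO by (auto simp: I_def mor_def T_def)
    obtain K \<iota> where K: "is_coproduct C I fst K \<iota>"
      using I mor_Obj(1)[OF I_mor(1)] by (rule ex_coproduct)
    note \<iota> = is_coproduct_mor[OF K] and KO = is_coproduct_Obj(1)[OF K]
    obtain k where k: "\<langle>k : K \<rightarrow> L\<rangle>" "\<And>i. i \<in> I \<Longrightarrow> k \<cdot> \<iota> i = snd i"
      using is_coproduct_desc[OF K LO, of snd] I_mor(1) by blast
    obtain L' \<phi> h where D: "(K, L, L', k, \<phi>, h) \<in> Dist C" using TR1_cone[OF KO LO mor_Hom[OF k(1)]] by blast
    note \<phi> = Dist_mor(2)[OF D]
    have "l \<cdot> k = Zero C K M"
    proof (rule is_coproduct_ext[OF K mor_comp[OF k(1) l] mor_Zero[OF KO M]])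
      show "(l \<cdot> k) \<cdot> \<iota> i = Zero C K M \<cdot> \<iota> i" if i: "i \<in> I" for i
        using comp_assoc[OF \<iota>[OF i] k(1) l] k(2)[OF i] I_mor(2)[OF i] Zero_comp[OF \<iota>[OF i] M] by simp
    qed
    then obtain l' where l': "\<langle>l' : L' \<rightarrow> M\<rangle>" "l' \<cdot> \<phi> = l" using Dist_weak_cokernel[OF D l] by blast
    \<comment> \<open>\<open>L'\<close> sits in a triangle between \<open>L\<close> and
      \<open>K[1]\<close>, and \<open>K[1]\<close> is a coproduct of elements of \<open>S\<close>,
      although \<open>K\<close> itself may lie outside \<open>?A\<close>.\<close>
    have "ShO C K \<in> ?A"
    proof (rule coprod_closedD[OF coprod_closed_cl I is_coproduct_ShO[OF K]])
      show "ShO C (fst i) \<in> ?A" if "i \<in> I" for i using I_mor(3)[OF that] subset_cl by (auto simp: T_def)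
    qed
    then have "L' \<in> ?A" using ext_closedD[OF ext_closed_cl tri_rotate[OF triI[OF D]] LA] by blast
    moreover have "\<phi> \<cdot> y = Zero C c L'" if c: "c \<in> T" and y: "\<langle>y : c \<rightarrow> L\<rangle>" "l \<cdot> y = Zero C c M" for c y
    proof -
      have i: "(c, y) \<in> I" using c y mor_Hom by (auto simp: I_def)
      have "\<phi> \<cdot> y = (\<phi> \<cdot> k) \<cdot> \<iota> (c, y)" using comp_assoc[OF \<iota>[OF i] k(1) \<phi>] k(2)[OF i] by simp
      then show ?thesis
        using Dist_comp_zero(1)[OF D] Zero_comp[OF \<iota>[OF i] mor_Obj(2)[OF \<phi>]] by simp
    qed
    ultimately show ?thesis
      unfolding Ll using l' \<phi> by (intro exI[of _ "(L', l')"]) auto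
  qed
  obtain p where p: "\<forall>n. ?P n (p n) \<and> ?Q n (p n) (p (Suc n))"
    using dependent_nat_choice[of ?P ?Q, OF init step] by (rule exE)
  define L where "L n = fst (p n)" for n
  define l where "l n = snd (p n)" for n
  have LA: "L n \<in> ?A" and l: "\<langle>l n : L n \<rightarrow> M\<rangle>" for n
    using conjunct1[OF spec[OF p, of n]] by (auto simp: L_def l_def split: prod.splits)
  have l0: "\<exists>x. \<langle>x : s \<rightarrow> L 0\<rangle> \<and> f = l 0 \<cdot> x" if "s \<in> S" "\<langle>f : s \<rightarrow> M\<rangle>" for s f
    using conjunct1[OF spec[OF p, of 0]] that by (auto simp: L_def l_def split: prod.splits)
  have "\<exists>\<phi>. \<langle>\<phi> : L n \<rightarrow> L (Suc n)\<rangle> \<and> l (Suc n) \<cdot> \<phi> = l n \<and>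
      (\<forall>c\<in>T. \<forall>y. \<langle>y : c \<rightarrow> L n\<rangle> \<longrightarrow> l n \<cdot> y = Zero C c M \<longrightarrow> \<phi> \<cdot> y = Zero C c (L (Suc n)))" for n
    using conjunct2[OF spec[OF p, of n]] by (simp add: L_def l_def case_prod_unfold)
  then obtain \<phi> where \<phi>: "\<And>n. \<langle>\<phi> n : L n \<rightarrow> L (Suc n)\<rangle>" "\<And>n. l (Suc n) \<cdot> \<phi> n = l n"
    "\<And>n c y. c \<in> T \<Longrightarrow> \<langle>y : c \<rightarrow> L n\<rangle> \<Longrightarrow> l n \<cdot> y = Zero C c M \<Longrightarrow> \<phi> n \<cdot> y = Zero C c (L (Suc n))"
    by metis
  obtain H j where H: "is_hocolim L \<phi> H j" using ex_hocolim[of \<phi> L, OF \<phi>(1)] .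
  have j: "\<langle>j n : L n \<rightarrow> H\<rangle>" "j (Suc n) \<cdot> \<phi> n = j n" for n using H by (simp_all add: is_hocolim_def)
  have HA: "H \<in> ?A"
    using H ext_closed_cl coprod_closed_cl ShO_cl[OF SO S(2)] LA
    unfolding is_hocolim_def by (metis image_subset_iff)
  note HO = mor_Obj(2)[OF j(1)]
  obtain k where k: "\<langle>k : H \<rightarrow> M\<rangle>" "\<And>n. k \<cdot> j n = l n" using H l \<phi>(2) unfolding is_hocolim_def by metis
  obtain R g h where D: "(H, M, R, k, g, h) \<in> Dist C" using TR1_cone[OF HO M mor_Hom[OF k(1)]] by blast
  note g = Dist_mor(2)[OF D] and h = Dist_mor(3)[OF D]
  note RO = mor_Obj(2)[OF g]
  have "Hom_trivial C s R" if s: "s \<in> S" for s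
  proof -
    have sO: "s \<in> Obj C" using s SO by blast
    have "r = Zero C s R" if r: "\<langle>r : s \<rightarrow> R\<rangle>" for r
    proof -
      obtain c where c: "c \<in> Obj C" "s = ShO C c" using sO by (rule ShO_cases)
      have cT: "c \<in> T" using c s by (simp add: T_def)
      obtain y where y: "\<langle>y : c \<rightarrow> H\<rangle>" "h \<cdot> r = ShM C y"
        using mor_comp[OF r h, unfolded c(2)] c(1) HO by (rule ShM_cases)
      have "ShM C (k \<cdot> y) = Zero C (ShO C c) (ShO C M)"
        using ShM_comp[OF y(1) k(1)] y(2) comp_assoc[OF r h mor_ShM[OF k(1)]] Dist_comp_zero(3)[OF D]
          Zero_comp[OF r ShO_Obj[OF M]] c(2) by simp
      then have ky: "k \<cdot> y = Zero C c M" using ShM_eq_Zero[OF mor_comp[OF y(1) k(1)]] by blast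
      \<comment> \<open>\<open>y\<close> comes from some stage \<open>n\<close>, where it is among
        the maps killed at the next step, so \<open>y = 0\<close> and \<open>h r = 0\<close>. Hence
        \<open>r\<close> lifts to a map \<open>s -> M\<close>; this factors through
        \<open>L 0\<close>, and so through \<open>k\<close>, which \<open>g\<close>
        annihilates.\<close>
      obtain n y' where y': "\<langle>y' : c \<rightarrow> L n\<rangle>" "y = j n \<cdot> y'" 
        using H T_compact[OF cT] y(1) unfolding is_hocolim_def by metis
      have "l n \<cdot> y' = Zero C c M" using comp_assoc[OF y'(1) j(1) k(1)] k(2) y'(2) ky by simp
      then have "\<phi> n \<cdot> y' = Zero C c (L (Suc n))" using \<phi>(3)[OF cT y'(1)] by blast
      moreover have "y = j (Suc n) \<cdot> (\<phi> n \<cdot> y')" using comp_assoc[OF y'(1) \<phi>(1) j(1)] j(2) y'(2) by simp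
      ultimately have "y = Zero C c H" using comp_Zero[OF j(1) c(1)] by simp
      then have "h \<cdot> r = Zero C s (ShO C H)" using y(2) ShM_Zero[OF c(1) HO] c(2) by simp
      then obtain f where f: "\<langle>f : s \<rightarrow> M\<rangle>" "g \<cdot> f = r" using Dist_weak_kernel2[OF D r] by blast
      obtain x where x: "\<langle>x : s \<rightarrow> L 0\<rangle>" "f = l 0 \<cdot> x" using l0[OF s f(1)] by blast
      have jx: "\<langle>j 0 \<cdot> x : s \<rightarrow> H\<rangle>" using x(1) j(1) by (rule mor_comp)
      have "f = k \<cdot> (j 0 \<cdot> x)" using comp_assoc[OF x(1) j(1) k(1)] k(2) x(2) by simp
      then have "r = (g \<cdot> k) \<cdot> (j 0 \<cdot> x)" using comp_assoc[OF jx k(1) g] f(2) by simp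
      then show ?thesis using Dist_comp_zero(1)[OF D] Zero_comp[OF jx RO] by simp
    qed
    then show ?thesis using Hom_trivial_iff[OF sO RO] by blast
  qed
  with HA triI[OF D] show thesis by (rule that)
qed

section \<open>The generated t-structure\<close>


definition gens :: "'o set \<Rightarrow> 'o set" where
  "gens P = (\<Union>i\<in>{0..}. shift C i ` P)"

text \<open>\<open>aisle P\<close> and \<open>coaisle P\<close> will be \<open>C\<^bsup>t\<le>0\<^esup>\<close> and \<open>C\<^bsup>t\<ge>0\<^esup>\<close>.\<close>

definition aisle :: "'o set \<Rightarrow> 'o set" where
  "aisle P = cl \<kappa> C (gens P)"

definition coaisle :: "'o set \<Rightarrow> 'o set" where
  "coaisle P = {R \<in> Obj C. \<forall>s\<in>gens P. Hom_trivial C (ShO C s) R}"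

lemma Hom_trivial_retract_left:
  assumes i: "\<langle>i : X \<rightarrow> Z\<rangle>" and p: "\<langle>p : Z \<rightarrow> X\<rangle>" and pi: "p \<cdot> i = Id C X"
    and R: "R \<in> Obj C" and triv: "Hom_trivial C Z R"
  shows "Hom_trivial C X R"
proof -
  have "r = Zero C X R" if r: "\<langle>r : X \<rightarrow> R\<rangle>" for r
  proof -
    have "r = (r \<cdot> p) \<cdot> i" using comp_assoc[OF i p r] pi comp_Id(2)[OF r] by simp
    also have "r \<cdot> p = Zero C Z R" using Hom_trivialD[OF triv mor_comp[OF p r]] .
    finally show ?thesis using Zero_comp[OF i R] by simp
  qed
  then show ?thesis using Hom_trivial_iff[OF mor_Obj(1)[OF i] R] by blast
qed

lemma Hom_trivial_retract_right:
  assumes i: "\<langle>i : X \<rightarrow> Z\<rangle>" and p: "\<langle>p : Z \<rightarrow> X\<rangle>" and pi: "p \<cdot> i = Id C X"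
    and S: "S \<in> Obj C" and triv: "Hom_trivial C S Z"
  shows "Hom_trivial C S X"
proof -
  have "r = Zero C S X" if r: "\<langle>r : S \<rightarrow> X\<rangle>" for r
  proof -
    have "r = p \<cdot> (i \<cdot> r)" using comp_assoc[OF r i p] pi comp_Id(1)[OF r] by simp
    also have "i \<cdot> r = Zero C S Z" using Hom_trivialD[OF triv mor_comp[OF r i]] .
    finally show ?thesis using comp_Zero[OF p S] by simp
  qed
  then show ?thesis using Hom_trivial_iff[OF S mor_Obj(1)[OF i]] by blast
qed

lemma is_iso_retract:
  assumes "is_iso C X Y f" "X \<in> Obj C" "Y \<in> Obj C"
  obtains i where "\<langle>i : Y \<rightarrow> X\<rangle>" "\<langle>f : X \<rightarrow> Y\<rangle>" "f \<cdot> i = Id C Y"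
  using assms unfolding is_iso_def mor_def by blast

text \<open>Since \<open>g\<close> is zero, the identity of \<open>R\<close> factors through
  \<open>L[1]\<close>, from which every map to \<open>R\<close> vanishes.\<close>

lemma truncation_zero:
  assumes D: "(L, X, R, f, g, h) \<in> Dist C" and X: "Hom_trivial C X R" and L: "Hom_trivial C (ShO C L) R"
  shows "zero_object C R"
proof -
  note m = Dist_mor[OF D]
  note RO = mor_Obj(2)[OF m(2)]
  have "Id C R \<cdot> g = Zero C X R" using Hom_trivialD[OF X m(2)] comp_Id(1)[OF m(2)] by simp
  then obtain u where u: "\<langle>u : ShO C L \<rightarrow> R\<rangle>" "u \<cdot> h = Id C R"
    using Dist_weak_cokernel2[OF D mor_Id[OF RO]] by blast
  then have "Id C R = Zero C R R" using Hom_trivialD[OF L u(1)] Zero_comp[OF m(3) RO] by simp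
  then show ?thesis using RO by (simp add: zero_object_iff)
qed

end

locale compact_family = cocomplete_triangulated_category C \<kappa>
  for C :: "('o, 'm, 'z) tri_category_scheme" (structure) and \<kappa> :: "'u rel" +
  fixes P :: "'o set"
  assumes P_finite: "finite P" and P_compact: "\<And>M. M \<in> P \<Longrightarrow> compact_object \<kappa> C M"
begin

lemma P_Obj: "P \<subseteq> Obj C"
  using P_compact compact_object_Obj by blast

lemma gens_iff: "s \<in> gens P \<longleftrightarrow> (\<exists>i\<ge>0. \<exists>M\<in>P. s = shift C i M)"
  by (auto simp: gens_def)

lemma gens_compact: "s \<in> gens P \<Longrightarrow> compact_object \<kappa> C s"
  using P_compact compact_object_shift by (auto simp: gens_def)

lemma gens_Obj: "gens P \<subseteq> Obj C"
  using gens_compact compact_object_Obj by blast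

lemma ShO_gens: "ShO C ` gens P \<subseteq> gens P"
proof (rule image_subsetI)
  fix s assume "s \<in> gens P"
  then obtain i M where iM: "i \<ge> 0" "M \<in> P" "s = shift C i M" by (auto simp: gens_iff)
  then have "ShO C s = shift C (i + 1) M" using ShO_shift P_Obj by blast
  then show "ShO C s \<in> gens P"
    unfolding gens_iff using iM by (intro exI[of _ "i + 1"] conjI bexI[of _ M]) auto
qed

lemma gens_small: "small \<kappa> (gens P)"
  unfolding gens_def using P_finite
  by (intro small_countable[OF smallness_cardinal]) (simp add: countable_finite)

lemma subset_gens: "P \<subseteq> gens P"
  by (auto simp: gens_iff intro!: exI[of _ 0])

lemma aisle_Obj: "aisle P \<subseteq> Obj C"
  unfolding aisle_def by (rule cl_Obj[OF gens_Obj])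

lemma ext_closed_aisle: "ext_closed C (aisle P)"
  unfolding aisle_def by (rule ext_closed_cl)

lemma coprod_closed_aisle: "coprod_closed \<kappa> C (aisle P)"
  unfolding aisle_def by (rule coprod_closed_cl)

lemma ShO_aisle: "X \<in> aisle P \<Longrightarrow> ShO C X \<in> aisle P"
  unfolding aisle_def by (rule ShO_cl[OF gens_Obj ShO_gens])

lemma shift_aisle: "X \<in> aisle P \<Longrightarrow> shift C (int n) X \<in> aisle P"
proof (induction n)
  case (Suc n)
  then have "ShO C (shift C (int n) X) \<in> aisle P" using ShO_aisle by blast
  then show ?case using ShO_shift[of X "int n"] Suc.prems aisle_Obj by (auto simp: ac_simps)
qed simp

lemma cl_subset_aisle: "cl \<kappa> C P \<subseteq> aisle P"
  unfolding aisle_def by (rule cl_mono) (use subset_gens subset_cl gens_Obj in blast)+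

text \<open>Describing the aisle as a left orthogonal makes its closure under retracts evident,
  which is not built into \<open>cl\<close>. For the converse direction the truncation term
  \<open>R\<close> is zero, because both \<open>X\<close> and \<open>L[1]\<close> are orthogonal to
  it.\<close>

lemma aisle_iff:
  "X \<in> aisle P \<longleftrightarrow> X \<in> Obj C \<and> (\<forall>R\<in>Obj C. (\<forall>s\<in>gens P. Hom_trivial C s R) \<longrightarrow> Hom_trivial C X R)"
proof (intro iffI conjI ballI impI)
  assume X: "X \<in> aisle P"
  then show "X \<in> Obj C" using aisle_Obj by blast
  fix R assume R: "R \<in> Obj C" "\<forall>s\<in>gens P. Hom_trivial C s R"
  have "cl \<kappa> C (gens P) \<subseteq> {X \<in> Obj C. Hom_trivial C X R}"
    by (rule cl_least[OF _ _ ext_closed_left_perp coprod_closed_left_perp]) (use R gens_Obj in auto)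
  then show "Hom_trivial C X R" using X by (auto simp: aisle_def)
next
  assume X: "X \<in> Obj C \<and> (\<forall>R\<in>Obj C. (\<forall>s\<in>gens P. Hom_trivial C s R) \<longrightarrow> Hom_trivial C X R)"
  obtain L R where L: "L \<in> aisle P" "tri L X R" and R: "\<And>s. s \<in> gens P \<Longrightarrow> Hom_trivial C s R"
    using truncation_triangle[OF gens_small gens_compact ShO_gens] X unfolding aisle_def by blast
  obtain f g h where D: "(L, X, R, f, g, h) \<in> Dist C" using L(2) by (auto simp: tri_def)
  note RO = tri_Obj(3)[OF L(2)]
  have "cl \<kappa> C (gens P) \<subseteq> {X \<in> Obj C. Hom_trivial C X R}"
    by (rule cl_least[OF _ _ ext_closed_left_perp coprod_closed_left_perp]) (use R RO gens_Obj in auto)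
  then have "Hom_trivial C (ShO C L) R" using ShO_aisle[OF L(1)] by (auto simp: aisle_def)
  then have "zero_object C R" using truncation_zero[OF D] X R RO by blast
  then show "X \<in> aisle P" using ext_closedD[OF ext_closed_aisle L(2,1)] ext_closed_zero[OF ext_closed_aisle] by blast
qed

lemma aisle_retract:
  assumes "\<langle>i : X \<rightarrow> Z\<rangle>" "\<langle>p : Z \<rightarrow> X\<rangle>" "p \<cdot> i = Id C X" "Z \<in> aisle P"
  shows "X \<in> aisle P"
  unfolding aisle_iff
  using Hom_trivial_retract_left[OF assms(1-3)] assms(4)[unfolded aisle_iff] mor_Obj(1)[OF assms(1)] by blast

lemma t_structure_aisle: "t_structure C (coaisle P) (aisle P)"
  unfolding t_structure_def shift_1
proof (intro conjI ballI)
  show "coaisle P \<subseteq> Obj C" by (auto simp: coaisle_def)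
  show "aisle P \<subseteq> Obj C" by (rule aisle_Obj)
  show "iso_closed C (coaisle P)"
    unfolding iso_closed_def
  proof (intro ballI impI)
    fix X Y assume X: "X \<in> coaisle P" and Y: "Y \<in> Obj C" and "\<exists>f. is_iso C X Y f"
    then obtain f where f: "is_iso C X Y f" by blast
    have XO: "X \<in> Obj C" using X by (simp add: coaisle_def)
    obtain i where i: "\<langle>i : Y \<rightarrow> X\<rangle>" "\<langle>f : X \<rightarrow> Y\<rangle>" "f \<cdot> i = Id C Y" using f XO Y by (rule is_iso_retract)
    have "Hom_trivial C (ShO C s) Y" if "s \<in> gens P" for s
      by (rule Hom_trivial_retract_right[OF i]) (use that X gens_Obj in \<open>auto simp: coaisle_def\<close>)
    then show "Y \<in> coaisle P" using Y by (simp add: coaisle_def)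
  qed
  show "iso_closed C (aisle P)"
    unfolding iso_closed_def
  proof (intro ballI impI)
    fix X Y assume X: "X \<in> aisle P" and Y: "Y \<in> Obj C" and "\<exists>f. is_iso C X Y f"
    then obtain f where f: "is_iso C X Y f" by blast
    have XO: "X \<in> Obj C" using X aisle_Obj by blast
    obtain i where i: "\<langle>i : Y \<rightarrow> X\<rangle>" "\<langle>f : X \<rightarrow> Y\<rangle>" "f \<cdot> i = Id C Y" using f XO Y by (rule is_iso_retract)
    show "Y \<in> aisle P" by (rule aisle_retract[OF i X])
  qed
  show "coaisle P \<subseteq> ShO C ` coaisle P"
  proof
    fix Y assume Y: "Y \<in> coaisle P"
    then have YO: "Y \<in> Obj C" by (simp add: coaisle_def)
    obtain Y' where Y': "Y' \<in> Obj C" "Y = ShO C Y'" using YO by (rule ShO_cases)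
    have "Hom_trivial C (ShO C s) Y'" if s: "s \<in> gens P" for s
    proof -
      have "Hom_trivial C (ShO C (ShO C s)) (ShO C Y')"
        using Y Y'(2) ShO_gens s by (auto simp: coaisle_def)
      then show ?thesis using Hom_trivial_ShO[of "ShO C s" Y'] Y'(1) s gens_Obj by blast
    qed
    then show "Y \<in> ShO C ` coaisle P" using Y' by (auto simp: coaisle_def)
  qed
  show "ShO C ` aisle P \<subseteq> aisle P" using ShO_aisle by blast
  show "Hom_trivial C X Y" if X: "X \<in> ShO C ` aisle P" and Y: "Y \<in> coaisle P" for X Y
  proof -
    obtain X' where X': "X' \<in> aisle P" "X = ShO C X'" using X by blast
    have YO: "Y \<in> Obj C" using Y by (simp add: coaisle_def)
    obtain Y' where Y': "Y' \<in> Obj C" "Y = ShO C Y'" using YO by (rule ShO_cases)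
    have "Hom_trivial C s Y'" if s: "s \<in> gens P" for s
    proof -
      have "Hom_trivial C (ShO C s) (ShO C Y')" using Y Y'(2) s by (simp add: coaisle_def)
      then show ?thesis using Hom_trivial_ShO[of s Y'] s gens_Obj Y'(1) by blast
    qed
    then have "Hom_trivial C X' Y'" using X'(1)[unfolded aisle_iff] Y'(1) by blast
    then show ?thesis using X' Y' Hom_trivial_ShO[of X' Y'] aisle_Obj by blast
  qed
  fix M assume M: "M \<in> Obj C"
  obtain L R where L: "L \<in> aisle P" "tri L M R" and R: "\<And>s. s \<in> gens P \<Longrightarrow> Hom_trivial C s R"
    using truncation_triangle[OF gens_small gens_compact ShO_gens M] unfolding aisle_def by blast
  note RO = tri_Obj(3)[OF L(2)]
  \<comment> \<open>\<open>R\<close> is orthogonal to the generators, whereas membership in the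
    coaisle tests their translates; hence the shift of the coaisle by \<open>-1\<close>.\<close>
  have "Hom_trivial C (ShO C s) (ShO C R)" if s: "s \<in> gens P" for s
    using Hom_trivial_ShO[of s R] R[OF s] s gens_Obj RO by blast
  then have "ShO C R \<in> coaisle P" using RO by (simp add: coaisle_def)
  moreover have "R = shift C (- 1) (ShO C R)" using shift_shift[OF RO, of "- 1" 1] by simp
  ultimately have "R \<in> shift C (- 1) ` coaisle P" by blast
  then show "\<exists>L\<in>aisle P. \<exists>R\<in>shift C (- 1) ` coaisle P. \<exists>f g h. (L, M, R, f, g, h) \<in> Dist C"
    using L unfolding tri_def by blast
qed

text \<open>A generator \<open>M'[k]\<close> with \<open>k \<ge> 0\<close> only raises the exponent,
  so weak negativity applies to \<open>i + k > 1\<close>; the rest is devissage.\<close>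

lemma Hom_trivial_aisle:
  assumes "weakly_negative C P" "X \<in> cl \<kappa> C P" "Y \<in> aisle P" "i > 1"
  shows "Hom_trivial C X (shift C i Y)"
proof (rule Hom_trivial_cl[OF P_compact gens_Obj _ assms(2) assms(3)[unfolded aisle_def]])
  fix M N assume M: "M \<in> P" and "N \<in> gens P"
  then obtain k M' where k: "k \<ge> 0" "M' \<in> P" "N = shift C k M'" by (auto simp: gens_iff)
  have "shift C i N = shift C (i + k) M'" using k P_Obj shift_shift by blast
  moreover have "Hom_trivial C M (shift C (i + k) M')"
    using assms(1,4) M k unfolding weakly_negative_def by simp
  ultimately show "Hom_trivial C M (shift C i N)" by simp
qed

lemma Hom_trivial_ShO_aisle:
  assumes "weakly_negative C P" "X \<in> ShO C ` aisle P" "Y \<in> cl \<kappa> C P"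
  shows "Hom_trivial C Y (ShO C X)"
proof -
  obtain X' where X': "X' \<in> aisle P" "X = ShO C X'" using assms(2) by blast
  then have "ShO C X = shift C 2 X'"
    using ShO_shift[of X' 1] aisle_Obj by auto
  then show ?thesis using Hom_trivial_aisle[OF assms(1,3) X'(1), of 2] by simp
qed

text \<open>The conditions force \<open>K\<close> to equal \<open>[P]^cl\<close>. Keeping
  \<open>K\<close> as a parameter lets the approximability argument insert an explicit
  \<open>\<star>\<close>-product.\<close>

lemma aisle_subset_star:
  assumes wn: "weakly_negative C P" and K: "ext_closed C K" "coprod_closed \<kappa> C K" "P \<subseteq> K" "K \<subseteq> cl \<kappa> C P"
  shows "aisle P \<subseteq> star C K (ShO C ` aisle P)"
proof -
  let ?V = "ShO C ` aisle P"
  have V: "ext_closed C ?V" "coprod_closed \<kappa> C ?V" "?V \<subseteq> Obj C"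
    using ext_closed_ShO[OF ext_closed_aisle aisle_Obj] coprod_closed_ShO[OF coprod_closed_aisle aisle_Obj]
      aisle_Obj by auto
  have KO: "K \<subseteq> Obj C" using K(4) cl_Obj[OF P_Obj] by blast
  have "gens P \<subseteq> star C K ?V"
  proof
    fix s assume "s \<in> gens P"
    then obtain i M where iM: "i \<ge> 0" "M \<in> P" "s = shift C i M" by (auto simp: gens_iff)
    \<comment> \<open>Generators of shift \<open>0\<close> lie in \<open>K\<close>, those of
      positive shift in \<open>U[1]\<close>; a zero object supplies the other factor.\<close>
    show "s \<in> star C K ?V"
    proof (cases "i = 0")
      case True
      then show ?thesis using iM K(3) subset_star_left[OF V(1) KO] by auto
    next
      case False
      have "s = ShO C (shift C (i - 1) M)" using ShO_shift[of M "i - 1"] iM P_Obj by auto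
      moreover have "shift C (i - 1) M \<in> gens P" 
        unfolding gens_iff using iM False by (intro exI[of _ "i - 1"] conjI bexI[of _ M]) auto
      ultimately have "s \<in> ?V" using subset_cl unfolding aisle_def by blast
      then show ?thesis using subset_star_right[OF ext_closed_zero[OF K(1)] V(3)] by blast
    qed
  qed
  then show ?thesis
    unfolding aisle_def
    by (rule cl_least[OF star_Obj])
      (use ext_closed_star[OF K(1) V(1,3)] coprod_closed_star[OF K(2) V(2)] Hom_trivial_ShO_aisle[OF wn] K(4)
        in \<open>unfold aisle_def, blast+\<close>)
qed

text \<open>Maps \<open>G[-m] -> X\<close> correspond to maps \<open>G -> X[m]\<close>, and these
  vanish from exponent \<open>2\<close> on; this is the source of \<open>m > 1\<close>.\<close>

lemma approx_orthogonality_aisle: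
  assumes "weakly_negative C P" "G \<in> cl \<kappa> C P" "m > 1"
  shows "approx_orthogonality C G (aisle P) m"
  unfolding approx_orthogonality_def
proof (intro conjI ballI)
  have G: "G \<in> aisle P" using assms(2) cl_subset_aisle by blast
  show "shift C (int m) G \<in> aisle P" by (rule shift_aisle[OF G])
  fix X assume X: "X \<in> aisle P"
  have "Hom_trivial C G (shift C (int m) X)"
    by (rule Hom_trivial_aisle[OF assms(1,2) X]) (use assms(3) in simp)
  then show "Hom_trivial C (shift C (- int m) G) X"
    using Hom_trivial_shift_left[of G X "- int m"] G X aisle_Obj by auto
qed

end

section \<open>A single compact generator\<close>

context cocomplete_triangulated_category
begin

lemma compact_object_zero: "zero_object C N \<Longrightarrow> compact_object \<kappa> C N"
  by (rule compact_objectI) (auto simp: zero_object_Obj dest: zero_object_from)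

text \<open>The projections come from the universal property, and both sides of the last identity
  agree on the two summand inclusions.\<close>

lemma biproduct_sum:
  assumes G: "is_coproduct C (UNIV :: bool set) (\<lambda>b. if b then X else Y) G \<iota>"
  obtains p q where "\<langle>p : G \<rightarrow> X\<rangle>" "\<langle>q : G \<rightarrow> Y\<rangle>" "p \<cdot> \<iota> True = Id C X" "q \<cdot> \<iota> False = Id C Y"
    "\<iota> True \<cdot> p \<boxplus> \<iota> False \<cdot> q = Id C G"
proof -
  note GO = is_coproduct_Obj(1)[OF G]
  have XO: "X \<in> Obj C" and YO: "Y \<in> Obj C"
    using is_coproduct_Obj(2)[OF G UNIV_I, of True] is_coproduct_Obj(2)[OF G UNIV_I, of False] by simp_all
  have i: "\<langle>\<iota> True : X \<rightarrow> G\<rangle>" and j: "\<langle>\<iota> False : Y \<rightarrow> G\<rangle>"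
    using is_coproduct_mor[OF G UNIV_I, of True] is_coproduct_mor[OF G UNIV_I, of False] by simp_all
  obtain p where "\<langle>p : G \<rightarrow> (if True then X else Y)\<rangle>"
    "p \<cdot> \<iota> True = Id C (if True then X else Y)"
    "\<And>b. b \<in> UNIV \<Longrightarrow> b \<noteq> True \<Longrightarrow> p \<cdot> \<iota> b = Zero C (if b then X else Y) (if True then X else Y)"
    using is_coproduct_proj[OF G UNIV_I, of True] by blast
  then have p: "\<langle>p : G \<rightarrow> X\<rangle>" "p \<cdot> \<iota> True = Id C X" "p \<cdot> \<iota> False = Zero C Y X" by auto
  obtain q where "\<langle>q : G \<rightarrow> (if False then X else Y)\<rangle>"
    "q \<cdot> \<iota> False = Id C (if False then X else Y)"
    "\<And>b. b \<in> UNIV \<Longrightarrow> b \<noteq> False \<Longrightarrow> q \<cdot> \<iota> b = Zero C (if b then X else Y) (if False then X else Y)"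
    using is_coproduct_proj[OF G UNIV_I, of False] by blast
  then have q: "\<langle>q : G \<rightarrow> Y\<rangle>" "q \<cdot> \<iota> False = Id C Y" "q \<cdot> \<iota> True = Zero C X Y" by auto
  have ip: "\<langle>\<iota> True \<cdot> p : G \<rightarrow> G\<rangle>" using p(1) i by (rule mor_comp)
  have jq: "\<langle>\<iota> False \<cdot> q : G \<rightarrow> G\<rangle>" using q(1) j by (rule mor_comp)
  have "(\<iota> True \<cdot> p \<boxplus> \<iota> False \<cdot> q) \<cdot> \<iota> b = Id C G \<cdot> \<iota> b" for b
  proof (cases b)
    case True
    have "(\<iota> True \<cdot> p \<boxplus> \<iota> False \<cdot> q) \<cdot> \<iota> True = \<iota> True \<cdot> Id C X \<boxplus> \<iota> False \<cdot> Zero C X Y"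
      using add_comp[OF i ip jq] comp_assoc[OF i p(1) i] comp_assoc[OF i q(1) j] p(2) q(3) by simp
    then show ?thesis
      using True comp_Id[OF i] comp_Zero[OF j XO] add_Zero(1)[OF i] by simp
  next
    case False
    have "(\<iota> True \<cdot> p \<boxplus> \<iota> False \<cdot> q) \<cdot> \<iota> False = \<iota> True \<cdot> Zero C Y X \<boxplus> \<iota> False \<cdot> Id C Y"
      using add_comp[OF j ip jq] comp_assoc[OF j p(1) i] comp_assoc[OF j q(1) j] p(3) q(2) by simp
    then show ?thesis
      using False comp_Id[OF j] comp_Zero[OF i YO] add_Zero(2)[OF j] by simp
  qed
  then have "\<iota> True \<cdot> p \<boxplus> \<iota> False \<cdot> q = Id C G"
    by (intro is_coproduct_ext[OF G mor_add[OF ip jq] mor_Id[OF GO]])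
  with p(1) q(1) p(2) q(2) show thesis by (rule that)
qed

text \<open>Writing the identity of \<open>G\<close> as in \<open>biproduct_sum\<close> splits
  \<open>f\<close> into two maps, each passing through one of the compact summands, where the
  induction principle is available.\<close>

lemma compact_object_biproduct:
  assumes X: "compact_object \<kappa> C X" and Y: "compact_object \<kappa> C Y"
    and G: "is_coproduct C (UNIV :: bool set) (\<lambda>b. if b then X else Y) G \<iota>"
  shows "compact_object \<kappa> C G"
proof -
  obtain p q where p: "\<langle>p : G \<rightarrow> X\<rangle>" and q: "\<langle>q : G \<rightarrow> Y\<rangle>" and sum: "\<iota> True \<cdot> p \<boxplus> \<iota> False \<cdot> q = Id C G"
    using biproduct_sum[OF G] by blast
  have i: "\<langle>\<iota> True : X \<rightarrow> G\<rangle>" and j: "\<langle>\<iota> False : Y \<rightarrow> G\<rangle>"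
    using is_coproduct_mor[OF G UNIV_I, of True] is_coproduct_mor[OF G UNIV_I, of False] by simp_all
  note GO = is_coproduct_Obj(1)[OF G]
  show ?thesis
  proof (rule compact_objectI[OF GO])
    fix I :: "'u set" and A Z \<epsilon> f Q
    assume I: "small \<kappa> I" and Z: "is_coproduct C I A Z \<epsilon>" and f: "\<langle>f : G \<rightarrow> Z\<rangle>"
      and zero: "Q (Zero C G Z)"
      and add: "\<And>a b. \<langle>a : G \<rightarrow> Z\<rangle> \<Longrightarrow> \<langle>b : G \<rightarrow> Z\<rangle> \<Longrightarrow> Q a \<Longrightarrow> Q b \<Longrightarrow> Q (a \<boxplus> b)"
      and gen: "\<And>i g. i \<in> I \<Longrightarrow> \<langle>g : G \<rightarrow> A i\<rangle> \<Longrightarrow> Q (\<epsilon> i \<cdot> g)"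
    note ZO = is_coproduct_Obj(1)[OF Z]
    have *: "Q (u \<cdot> r)" if W: "compact_object \<kappa> C W" and r: "\<langle>r : G \<rightarrow> W\<rangle>" and u: "\<langle>u : W \<rightarrow> Z\<rangle>" for W r u
    proof (rule compact_object_induct[OF W I Z u, where Q = "\<lambda>u. Q (u \<cdot> r)"])
      show "Q (Zero C W Z \<cdot> r)" using zero Zero_comp[OF r ZO] by simp
      show "Q ((a \<boxplus> b) \<cdot> r)" if "\<langle>a : W \<rightarrow> Z\<rangle>" "\<langle>b : W \<rightarrow> Z\<rangle>" "Q (a \<cdot> r)" "Q (b \<cdot> r)" for a b
        using add[OF mor_comp[OF r that(1)] mor_comp[OF r that(2)] that(3,4)] add_comp[OF r that(1,2)] by simp
      show "Q ((\<epsilon> i \<cdot> g) \<cdot> r)" if "i \<in> I" "\<langle>g : W \<rightarrow> A i\<rangle>" for i g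
        using gen[OF that(1) mor_comp[OF r that(2)]] comp_assoc[OF r that(2) is_coproduct_mor[OF Z that(1)]] by simp
    qed
    have fi: "\<langle>f \<cdot> \<iota> True : X \<rightarrow> Z\<rangle>" using i f by (rule mor_comp)
    have fj: "\<langle>f \<cdot> \<iota> False : Y \<rightarrow> Z\<rangle>" using j f by (rule mor_comp)
    have "Q ((f \<cdot> \<iota> True) \<cdot> p \<boxplus> (f \<cdot> \<iota> False) \<cdot> q)"
      by (rule add[OF mor_comp[OF p fi] mor_comp[OF q fj] *[OF X p fi] *[OF Y q fj]])
    also have "(f \<cdot> \<iota> True) \<cdot> p \<boxplus> (f \<cdot> \<iota> False) \<cdot> q = f \<cdot> (\<iota> True \<cdot> p \<boxplus> \<iota> False \<cdot> q)"
      using comp_add[OF mor_comp[OF p i] mor_comp[OF q j] f] comp_assoc[OF p i f] comp_assoc[OF q j f] by simp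
    also have "\<dots> = f" using sum comp_Id(2)[OF f] by simp
    finally show "Q f" .
  qed
qed

text \<open>Iterated binary coproducts, starting from a zero object. Membership in \<open>cl\<close>
  transfers vanishing from \<open>P\<close> to \<open>G\<close>, and the retractions transfer
  generation.\<close>

lemma ex_compact_sum:
  assumes "finite P" "\<And>M. M \<in> P \<Longrightarrow> compact_object \<kappa> C M"
  shows "\<exists>G. compact_object \<kappa> C G \<and> G \<in> cl \<kappa> C P \<and>
    (\<forall>M\<in>P. \<exists>i p. \<langle>i : M \<rightarrow> G\<rangle> \<and> \<langle>p : G \<rightarrow> M\<rangle> \<and> p \<cdot> i = Id C M)"
  using assms
proof (induction P rule: finite_induct)
  case empty
  obtain N where N: "zero_object C N" using ex_zero_object by blast
  then show ?case using compact_object_zero[OF N] ext_closed_zero[OF ext_closed_cl N] by blast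
next
  case (insert M P)
  obtain G where G: "compact_object \<kappa> C G" "G \<in> cl \<kappa> C P"
    "\<forall>M\<in>P. \<exists>i p. \<langle>i : M \<rightarrow> G\<rangle> \<and> \<langle>p : G \<rightarrow> M\<rangle> \<and> p \<cdot> i = Id C M"
    using insert by blast
  have M: "compact_object \<kappa> C M" using insert.prems by blast
  have PO: "insert M P \<subseteq> Obj C" using insert.prems compact_object_Obj by blast
  obtain H \<iota> where H: "is_coproduct C (UNIV :: bool set) (\<lambda>b. if b then G else M) H \<iota>"
    using ex_binary_coproduct[OF compact_object_Obj[OF G(1)] compact_object_Obj[OF M]] by blast
  have i: "\<langle>\<iota> True : G \<rightarrow> H\<rangle>" and j: "\<langle>\<iota> False : M \<rightarrow> H\<rangle>"
    using is_coproduct_mor[OF H UNIV_I, of True] is_coproduct_mor[OF H UNIV_I, of False] by simp_all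
  obtain p q where p: "\<langle>p : H \<rightarrow> G\<rangle>" "p \<cdot> \<iota> True = Id C G" and q: "\<langle>q : H \<rightarrow> M\<rangle>" "q \<cdot> \<iota> False = Id C M"
    using biproduct_sum[OF H] by blast
  have "compact_object \<kappa> C H" using G(1) M H by (rule compact_object_biproduct)
  moreover have "H \<in> cl \<kappa> C (insert M P)"
  proof (rule coprod_closedD[OF coprod_closed_cl _ H])
    show "small \<kappa> (UNIV :: bool set)" by (rule small_countable[OF smallness_cardinal]) (simp add: countable_finite)
    have "cl \<kappa> C P \<subseteq> cl \<kappa> C (insert M P)" by (rule cl_mono[OF _ PO]) (use subset_cl in blast)
    then show "(if b then G else M) \<in> cl \<kappa> C (insert M P)" for b
      using G(2) subset_cl[of "insert M P"] by auto
  qed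
  moreover have "\<exists>i p. \<langle>i : M' \<rightarrow> H\<rangle> \<and> \<langle>p : H \<rightarrow> M'\<rangle> \<and> p \<cdot> i = Id C M'" if "M' \<in> insert M P" for M'
  proof (cases "M' = M")
    case True
    then show ?thesis using j q by blast
  next
    case False
    then obtain i' p' where ip': "\<langle>i' : M' \<rightarrow> G\<rangle>" "\<langle>p' : G \<rightarrow> M'\<rangle>" "p' \<cdot> i' = Id C M'" using G(3) \<open>M' \<in> insert M P\<close> by blast
    have "(p' \<cdot> p) \<cdot> (\<iota> True \<cdot> i') = p' \<cdot> (p \<cdot> (\<iota> True \<cdot> i'))"
      by (rule comp_assoc[OF mor_comp[OF ip'(1) i] p(1) ip'(2)])
    also have "p \<cdot> (\<iota> True \<cdot> i') = i'" using comp_assoc[OF ip'(1) i p(1)] p(2) comp_Id(1)[OF ip'(1)] by simp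
    finally have "(p' \<cdot> p) \<cdot> (\<iota> True \<cdot> i') = Id C M'" using ip'(3) by simp
    then show ?thesis using mor_comp[OF ip'(1) i] mor_comp[OF p(1) ip'(2)] by blast
  qed
  ultimately show ?case by blast
qed

text \<open>Since retracts are not built into \<open>cl\<close>, the argument uses truncation with
  respect to all shifts of \<open>G\<close>: its third term is orthogonal to every
  \<open>G[i]\<close>, hence to all shifts of \<open>P\<close>, hence to every object, so it is
  zero.\<close>

lemma compactly_generates_retracts:
  assumes P: "compactly_generates \<kappa> C P" and G: "compact_object \<kappa> C G"
    and ret: "\<And>M. M \<in> P \<Longrightarrow> \<exists>i p. \<langle>i : M \<rightarrow> G\<rangle> \<and> \<langle>p : G \<rightarrow> M\<rangle> \<and> p \<cdot> i = Id C M"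
  shows "compactly_generates \<kappa> C {G}"
proof -
  let ?S = "\<Union>i. shift C i ` {G}"
  note GO = compact_object_Obj[OF G]
  have SO: "?S \<subseteq> Obj C" using GO by auto
  have S: "compact_object \<kappa> C s" if "s \<in> ?S" for s using that compact_object_shift[OF G] by auto
  have small: "small \<kappa> ?S" by (rule small_countable[OF smallness_cardinal]) simp
  have ShO: "ShO C ` ?S \<subseteq> ?S" using ShO_shift[OF GO] by auto
  have "X \<in> cl \<kappa> C ?S" if X: "X \<in> Obj C" for X
  proof -
    obtain L R where L: "L \<in> cl \<kappa> C ?S" "tri L X R" and R: "\<And>s. s \<in> ?S \<Longrightarrow> Hom_trivial C s R"
      using truncation_triangle[OF small S ShO X] by blast
    note RO = tri_Obj(3)[OF L(2)]
    have PO: "M \<in> Obj C" if "M \<in> P" for M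
      using P that compact_object_Obj unfolding compactly_generates_def by blast
    have "Hom_trivial C (shift C i M) R" if M: "M \<in> P" for i M
    proof -
      obtain j p where jp: "\<langle>j : M \<rightarrow> G\<rangle>" "\<langle>p : G \<rightarrow> M\<rangle>" "p \<cdot> j = Id C M" using ret[OF M] by blast
      have "shift C i G \<in> ?S" by blast
      then have "Hom_trivial C G (shift C (- i) R)"
        using R Hom_trivial_shift_left[OF GO RO, of i] by (simp only:)
      then have "Hom_trivial C M (shift C (- i) R)"
        by (rule Hom_trivial_retract_left[OF jp shift_Obj[OF RO]])
      then show ?thesis using Hom_trivial_shift_left[OF PO[OF M] RO, of i] by simp
    qed
    then have "cl \<kappa> C (\<Union>i. shift C i ` P) \<subseteq> {X \<in> Obj C. Hom_trivial C X R}"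
      using PO by (intro cl_least ext_closed_left_perp[OF RO] coprod_closed_left_perp[OF RO]) auto
    then have triv: "Hom_trivial C Y R" if "Y \<in> Obj C" for Y
      using P that unfolding compactly_generates_def by blast
    obtain f g h where D: "(L, X, R, f, g, h) \<in> Dist C" using L(2) by (auto simp: tri_def)
    have "zero_object C R"
      by (rule truncation_zero[OF D triv[OF X] triv[OF ShO_Obj[OF tri_Obj(1)[OF L(2)]]]])
    then show ?thesis using ext_closedD[OF ext_closed_cl L(2,1)] ext_closed_zero[OF ext_closed_cl] by blast
  qed
  then show ?thesis
    unfolding compactly_generates_def using G cl_Obj[OF SO] by (intro conjI equalityI subsetI) auto
qed


section \<open>Approximability\<close>

lemma subset_retracts: "A \<subseteq> Obj C \<Longrightarrow> A \<subseteq> retracts C A"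
proof
  fix X assume "A \<subseteq> Obj C" "X \<in> A"
  then have X: "X \<in> Obj C" "X \<in> A" by blast+
  have "Id C X \<in> Hom C X X" "Id C X \<cdot> Id C X = Id C X"
    using mor_Hom[OF mor_Id[OF X(1)]] comp_Id(1)[OF mor_Id[OF X(1)]] by auto
  then show "X \<in> retracts C A" using X unfolding retracts_def by blast
qed

lemma weakly_approximable_single:
  assumes gen: "compactly_generates \<kappa> C {G}" and wn: "weakly_negative C {G}"
  shows "weakly_approximable \<kappa> C"
proof -
  have G: "compact_object \<kappa> C G" using gen by (simp add: compactly_generates_def)
  interpret compact_family C \<kappa> "{G}" by unfold_locales (use G in auto)
  have GO: "G \<in> Obj C" by (rule compact_object_Obj[OF G])
  have GK: "{G} \<subseteq> cl \<kappa> C {G}" by (rule subset_cl)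
  let ?T = "(\<lambda>s. shift C s G) ` {- int 2..int 2}"
  have TO: "?T \<subseteq> Obj C" using GO by auto
  have "G \<in> ?T" using image_eqI[of G "\<lambda>s. shift C s G" 0 "{- int 2..int 2}"] by simp
  then have "cl \<kappa> C {G} \<subseteq> cl \<kappa> C ?T" using subset_cl[of ?T] TO by (intro cl_mono) blast+
  then have cl_gen: "cl \<kappa> C {G} \<subseteq> gen \<kappa> C G 2"
    unfolding gen_def using subset_retracts[OF cl_Obj[OF TO]] by blast
  have star: "aisle {G} \<subseteq> star C (cl \<kappa> C {G}) (ShO C ` aisle {G})"
    by (rule aisle_subset_star[OF wn ext_closed_cl coprod_closed_cl GK order_refl])
  have "\<exists>E\<in>gen \<kappa> C G 2. \<exists>D\<in>t_le C (aisle {G}) (- 1). \<exists>f g h. (E, F, D, f, g, h) \<in> Dist C" if "F \<in> aisle {G}" for F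
  proof -
    have "F \<in> star C (cl \<kappa> C {G}) (ShO C ` aisle {G})" using that star by blast
    then obtain E D f g h where "E \<in> cl \<kappa> C {G}" "D \<in> ShO C ` aisle {G}" "(E, F, D, f, g, h) \<in> Dist C"
      unfolding star_def by blast
    then have "E \<in> gen \<kappa> C G 2" "D \<in> t_le C (aisle {G}) (- 1)" "(E, F, D, f, g, h) \<in> Dist C"
      using cl_gen by (auto simp: t_le_def)
    then show ?thesis by blast
  qed
  moreover have "approx_orthogonality C G (aisle {G}) 2"
    by (rule approx_orthogonality_aisle[OF wn]) (use GK in auto)
  ultimately show ?thesis
    unfolding weakly_approximable_def using GO gen t_structure_aisle
    by (intro bexI[of _ G] exI[of _ "coaisle {G}"] exI[of _ "aisle {G}"] exI[of _ 2]) auto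
qed

section \<open>Classes of coproducts of members of a set, and split extensions\<close>

definition coprods :: "'o set \<Rightarrow> 'o set" where
  "coprods S = {Z. \<exists>(I :: 'u set) X \<iota>. small \<kappa> I \<and> (\<forall>i\<in>I. X i \<in> S) \<and> is_coproduct C I X Z \<iota>}"

lemma coprodsI:
  assumes "small \<kappa> I" "is_coproduct C I X Z \<iota>" "\<And>i. i \<in> I \<Longrightarrow> X i \<in> S"
  shows "Z \<in> coprods S"
proof -
  obtain J :: "'u set" and \<phi> where J: "small \<kappa> J" "bij_betw \<phi> J I" "is_coproduct C J (X \<circ> \<phi>) Z (\<iota> \<circ> \<phi>)"
    using reindex_coproduct[OF assms(1,2)] .
  moreover have "\<forall>j\<in>J. (X \<circ> \<phi>) j \<in> S" using J(2) assms(3) by (auto simp: bij_betw_def)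
  ultimately show ?thesis unfolding coprods_def by blast
qed

lemma coprods_subset: "coprod_closed \<kappa> C A \<Longrightarrow> S \<subseteq> A \<Longrightarrow> coprods S \<subseteq> A"
  unfolding coprods_def coprod_closed_def by blast

lemma zero_in_coprods: "zero_object C N \<Longrightarrow> N \<in> coprods S"
  by (rule coprodsI[OF small_countable[OF smallness_cardinal] zero_object_coproduct]) auto

lemma coprods_Obj: "coprods S \<subseteq> Obj C"
  using is_coproduct_Obj(1) unfolding coprods_def by blast

lemma subset_coprods:
  assumes "S \<subseteq> Obj C" shows "S \<subseteq> coprods S"
proof
  fix X assume X: "X \<in> S"
  then have XO: "X \<in> Obj C" using assms by blast
  have "is_coproduct C {()} (\<lambda>_. X) X (\<lambda>_. Id C X)"
  proof (rule is_coproductI[OF XO])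
    show "\<exists>h. \<langle>h : X \<rightarrow> Y\<rangle> \<and> (\<forall>i\<in>{()}. h \<cdot> Id C X = f i)" if "\<And>i. i \<in> {()} \<Longrightarrow> \<langle>f i : X \<rightarrow> Y\<rangle>" for Y f
      using that[of "()"] comp_Id(2)[of "f ()" X Y] by auto
    show "h = h'" if "\<langle>h : X \<rightarrow> Y\<rangle>" "\<langle>h' : X \<rightarrow> Y\<rangle>" "\<And>i. i \<in> {()} \<Longrightarrow> h \<cdot> Id C X = h' \<cdot> Id C X" for Y h h'
      using that(3)[of "()"] comp_Id(2)[OF that(1)] comp_Id(2)[OF that(2)] by simp
  qed (use XO in simp)
  then show "X \<in> coprods S"
    by (rule coprodsI[rotated]) (use X small_countable[OF smallness_cardinal] in auto)
qed

lemma coprod_closed_coprods: "coprod_closed \<kappa> C (coprods S)"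
  unfolding coprod_closed_def
proof (intro allI impI)
  fix I :: "'u set" and Y Z \<iota>
  assume I: "small \<kappa> I" and Y: "\<forall>i\<in>I. Y i \<in> coprods S" and Z: "is_coproduct C I Y Z \<iota>"
  have "\<exists>(J :: 'u set) X \<epsilon>. small \<kappa> J \<and> (\<forall>j\<in>J. X j \<in> S) \<and> is_coproduct C J X (Y i) \<epsilon>" if "i \<in> I" for i
    using bspec[OF Y that] unfolding coprods_def by blast
  then obtain J :: "'u \<Rightarrow> 'u set" and X \<epsilon> where J: "\<And>i. i \<in> I \<Longrightarrow> small \<kappa> (J i)"
    and X: "\<And>i. i \<in> I \<Longrightarrow> \<forall>j\<in>J i. X i j \<in> S" and \<epsilon>: "\<And>i. i \<in> I \<Longrightarrow> is_coproduct C (J i) (X i) (Y i) (\<epsilon> i)"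
    by metis
  show "Z \<in> coprods S"
    by (rule coprodsI[OF small_Sigma[OF smallness_cardinal I J] is_coproduct_Sigma[OF Z \<epsilon>]]) (use X in auto)
qed

lemma small_Plus:
  assumes "small \<kappa> I" "small \<kappa> J" shows "small \<kappa> (I <+> J)"
proof -
  define F where "F b = (if b then Inl ` I else Inr ` J)" for b
  have "small \<kappa> (F b)" for b
    unfolding F_def using small_image[OF assms(1)] small_image[OF assms(2)] by (cases b) (simp_all only: if_True if_False)
  moreover have "small \<kappa> (UNIV :: bool set)"
    by (rule small_countable[OF smallness_cardinal]) (simp add: countable_finite)
  ultimately have "small \<kappa> (snd ` Sigma UNIV F)"
    by (intro small_image small_Sigma[OF smallness_cardinal])
  moreover have "I <+> J = snd ` Sigma UNIV F"
    by (simp add: snd_image_Sigma UNIV_bool F_def Plus_def Un_commute)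
  ultimately show ?thesis by simp
qed

text \<open>The connecting map vanishes, so \<open>Z\<close> is the sum of its two ends, with
  summand inclusions given by \<open>f\<close> and by a section of \<open>g\<close>.\<close>

lemma is_coproduct_split_triangle:
  assumes D: "(X, Z, Y, f, g, h) \<in> Dist C" and h: "h = Zero C Y (ShO C X)"
    and X: "is_coproduct C I A X \<iota>" and Y: "is_coproduct C J B Y \<epsilon>"
  obtains \<eta> where "is_coproduct C (I <+> J) (case_sum A B) Z \<eta>"
proof -
  note m = Dist_mor[OF D] and gf = Dist_comp_zero(1)[OF D]
  note \<iota> = is_coproduct_mor[OF X] and \<epsilon> = is_coproduct_mor[OF Y]
  note XO = mor_Obj(1)[OF m(1)] and ZO = mor_Obj(2)[OF m(1)]
  obtain s where s: "\<langle>s : Y \<rightarrow> Z\<rangle>" "g \<cdot> s = Id C Y" using Dist_split[OF D h] .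
  obtain r where r: "\<langle>r : Z \<rightarrow> X\<rangle>" "r \<cdot> f = Id C X" using Dist_split'[OF D h] .
  let ?\<eta> = "case_sum (\<lambda>i. f \<cdot> \<iota> i) (\<lambda>j. s \<cdot> \<epsilon> j)"
  have "is_coproduct C (I <+> J) (case_sum A B) Z ?\<eta>"
  proof (rule is_coproductI[OF ZO])
    show "\<langle>?\<eta> k : case_sum A B k \<rightarrow> Z\<rangle>" if "k \<in> I <+> J" for k
      using that mor_comp[OF \<iota> m(1)] mor_comp[OF \<epsilon> s(1)] by (auto split: sum.splits)
  next
    fix T k assume T: "T \<in> Obj C" and k: "\<And>i. i \<in> I <+> J \<Longrightarrow> \<langle>k i : case_sum A B i \<rightarrow> T\<rangle>"
    have kA: "\<langle>(k \<circ> Inl) i : A i \<rightarrow> T\<rangle>" if "i \<in> I" for i using k[of "Inl i"] that by auto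
    have kB: "\<langle>(k \<circ> Inr) j : B j \<rightarrow> T\<rangle>" if "j \<in> J" for j using k[of "Inr j"] that by auto
    obtain a where a: "\<langle>a : X \<rightarrow> T\<rangle>" "\<And>i. i \<in> I \<Longrightarrow> a \<cdot> \<iota> i = (k \<circ> Inl) i"
      using is_coproduct_desc[OF X T, of "k \<circ> Inl"] kA by blast
    obtain b where b: "\<langle>b : Y \<rightarrow> T\<rangle>" "\<And>j. j \<in> J \<Longrightarrow> b \<cdot> \<epsilon> j = (k \<circ> Inr) j"
      using is_coproduct_desc[OF Y T, of "k \<circ> Inr"] kB by blast
    have ar: "\<langle>a \<cdot> r : Z \<rightarrow> T\<rangle>" using r(1) a(1) by (rule mor_comp)
    have ars: "\<langle>(a \<cdot> r) \<cdot> s : Y \<rightarrow> T\<rangle>" using s(1) ar by (rule mor_comp)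
    \<comment> \<open>The retraction \<open>r\<close> and the section \<open>s\<close> are chosen
      independently, so \<open>r s\<close> need not vanish; \<open>d\<close> is \<open>b\<close>
      minus the resulting cross term.\<close>
    define d where "d = sub Y T b ((a \<cdot> r) \<cdot> s)"
    have d: "\<langle>d : Y \<rightarrow> T\<rangle>" unfolding d_def using b(1) ars by (rule mor_sub)
    have dg: "\<langle>d \<cdot> g : Z \<rightarrow> T\<rangle>" using m(2) d by (rule mor_comp)
    define t where "t = a \<cdot> r \<boxplus> d \<cdot> g"
    have t: "\<langle>t : Z \<rightarrow> T\<rangle>" unfolding t_def using ar dg by (rule mor_add)
    have "t \<cdot> f = (a \<cdot> r) \<cdot> f \<boxplus> (d \<cdot> g) \<cdot> f" unfolding t_def by (rule add_comp[OF m(1) ar dg])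
    also have "(a \<cdot> r) \<cdot> f = a" using comp_assoc[OF m(1) r(1) a(1)] r(2) comp_Id(2)[OF a(1)] by simp
    also have "(d \<cdot> g) \<cdot> f = Zero C X T" using comp_assoc[OF m(1,2) d] gf comp_Zero[OF d XO] by simp
    finally have tf: "t \<cdot> f = a" using add_Zero(1)[OF a(1)] by simp
    have "t \<cdot> s = (a \<cdot> r) \<cdot> s \<boxplus> (d \<cdot> g) \<cdot> s" unfolding t_def by (rule add_comp[OF s(1) ar dg])
    also have "(d \<cdot> g) \<cdot> s = d" using comp_assoc[OF s(1) m(2) d] s(2) comp_Id(2)[OF d] by simp
    also have "(a \<cdot> r) \<cdot> s \<boxplus> d = b" unfolding d_def by (rule add_sub[OF b(1) ars])
    finally have ts: "t \<cdot> s = b" .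
    have "t \<cdot> (f \<cdot> \<iota> i) = k (Inl i)" if "i \<in> I" for i
      using comp_assoc[OF \<iota>[OF that] m(1) t] tf a(2)[OF that] by simp
    moreover have "t \<cdot> (s \<cdot> \<epsilon> j) = k (Inr j)" if "j \<in> J" for j
      using comp_assoc[OF \<epsilon>[OF that] s(1) t] ts b(2)[OF that] by simp
    ultimately have "\<forall>i\<in>I <+> J. t \<cdot> ?\<eta> i = k i" by (auto split: sum.splits)
    with t show "\<exists>t. \<langle>t : Z \<rightarrow> T\<rangle> \<and> (\<forall>i\<in>I <+> J. t \<cdot> ?\<eta> i = k i)" by blast
  next
    fix T t t' assume t: "\<langle>t : Z \<rightarrow> T\<rangle>" and t': "\<langle>t' : Z \<rightarrow> T\<rangle>" and eq: "\<And>i. i \<in> I <+> J \<Longrightarrow> t \<cdot> ?\<eta> i = t' \<cdot> ?\<eta> i"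
    note T = mor_Obj(2)[OF t]
    have tf: "t \<cdot> f = t' \<cdot> f"
    proof (rule is_coproduct_ext[OF X mor_comp[OF m(1) t] mor_comp[OF m(1) t']])
      show "(t \<cdot> f) \<cdot> \<iota> i = (t' \<cdot> f) \<cdot> \<iota> i" if i: "i \<in> I" for i
        using eq[of "Inl i"] i comp_assoc[OF \<iota>[OF i] m(1) t] comp_assoc[OF \<iota>[OF i] m(1) t'] by auto
    qed
    have ts: "t \<cdot> s = t' \<cdot> s"
    proof (rule is_coproduct_ext[OF Y mor_comp[OF s(1) t] mor_comp[OF s(1) t']])
      show "(t \<cdot> s) \<cdot> \<epsilon> j = (t' \<cdot> s) \<cdot> \<epsilon> j" if j: "j \<in> J" for j
        using eq[of "Inr j"] j comp_assoc[OF \<epsilon>[OF j] s(1) t] comp_assoc[OF \<epsilon>[OF j] s(1) t'] by auto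
    qed
    define d where "d = sub Z T t t'"
    have d: "\<langle>d : Z \<rightarrow> T\<rangle>" unfolding d_def using t t' by (rule mor_sub)
    have df: "d \<cdot> f = Zero C X T"
      unfolding d_def sub_comp[OF m(1) t t'] tf
      by (rule sub_eq_Zero_iff[THEN iffD2, OF mor_comp[OF m(1) t'] mor_comp[OF m(1) t'] refl])
    have ds: "d \<cdot> s = Zero C Y T"
      unfolding d_def sub_comp[OF s(1) t t'] ts
      by (rule sub_eq_Zero_iff[THEN iffD2, OF mor_comp[OF s(1) t'] mor_comp[OF s(1) t'] refl])
    \<comment> \<open>A map vanishing on \<open>f\<close> factors through \<open>g\<close>, and
      \<open>g s = 1\<close> identifies the factor with \<open>d s\<close>, which is zero as
      well.\<close>
    obtain u where u: "\<langle>u : Y \<rightarrow> T\<rangle>" "u \<cdot> g = d" using Dist_weak_cokernel[OF D d df] by blast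
    have "u = d \<cdot> s" using comp_assoc[OF s(1) m(2) u(1)] s(2) u(2) comp_Id(2)[OF u(1)] by simp
    then have "d = Zero C Z T" using ds u(2) Zero_comp[OF m(2) T] by simp
    then show "t = t'" unfolding d_def by (rule sub_eq_Zero_iff[OF t t', THEN iffD1])
  qed
  then show thesis by (rule that)
qed

lemma coprods_subset_cl: "coprods S \<subseteq> cl \<kappa> C S"
  by (rule coprods_subset[OF coprod_closed_cl subset_cl])

text \<open>The connecting map is zero by devissage, so an extension is a coproduct over the
  disjoint union of the two index sets. For one layer of the filtration, \<open>triv\<close> is the
  case \<open>i = j\<close> of the hypothesis.\<close>

lemma ext_closed_coprods:
  assumes S: "\<And>M. M \<in> S \<Longrightarrow> compact_object \<kappa> C M"
    and triv: "\<And>M N. M \<in> S \<Longrightarrow> N \<in> S \<Longrightarrow> Hom_trivial C M (ShO C N)"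
  shows "ext_closed C (coprods S)"
proof (rule ext_closedI)
  show "N \<in> coprods S" if "zero_object C N" for N using zero_in_coprods[OF that] .
  fix X Z Y assume t: "tri X Z Y" and X: "X \<in> coprods S" and Y: "Y \<in> coprods S"
  have SO: "S \<subseteq> Obj C" using S compact_object_Obj by blast
  have "Hom_trivial C Y (shift C 1 X)"
    by (rule Hom_trivial_cl[OF S SO]) (use triv X Y coprods_subset_cl in auto)
  moreover obtain f g h where D: "(X, Z, Y, f, g, h) \<in> Dist C" using t by (auto simp: tri_def)
  ultimately have h: "h = Zero C Y (ShO C X)" using Hom_trivialD Dist_mor(3)[OF D] by simp
  obtain I :: "'u set" and A \<iota> where I: "small \<kappa> I" "\<forall>i\<in>I. A i \<in> S" "is_coproduct C I A X \<iota>"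
    using X unfolding coprods_def by blast
  obtain J :: "'u set" and B \<epsilon> where J: "small \<kappa> J" "\<forall>j\<in>J. B j \<in> S" "is_coproduct C J B Y \<epsilon>"
    using Y unfolding coprods_def by blast
  obtain \<eta> where "is_coproduct C (I <+> J) (case_sum A B) Z \<eta>"
    using is_coproduct_split_triangle[OF D h I(3) J(3)] .
  then show "Z \<in> coprods S"
    by (rule coprodsI[OF small_Plus[OF I(1) J(1)]]) (use I(2) J(2) in auto)
qed

lemma coprods_subset_shift_coproducts: "coprods {G} \<subseteq> shift_coproducts \<kappa> C G m"
proof
  fix Z assume "Z \<in> coprods {G}"
  then obtain I :: "'u set" and X \<iota> where I: "small \<kappa> I" "\<forall>i\<in>I. X i \<in> {G}" "is_coproduct C I X Z \<iota>"
    unfolding coprods_def by blast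
  have "is_coproduct C I (\<lambda>i. shift C ((\<lambda>_. 0) i) G) Z \<iota>"
    by (rule is_coproduct_cong[OF I(3)]) (use I(2) in auto)
  moreover have "\<forall>i\<in>I. - int m \<le> (\<lambda>_. 0) i \<and> (\<lambda>_. 0) i \<le> int m" by simp
  ultimately show "Z \<in> shift_coproducts \<kappa> C G m"
    unfolding shift_coproducts_def using I(1)
    by (intro CollectI exI[of _ I] exI[of _ "\<lambda>_. 0"] exI[of _ \<iota>] conjI) simp_all
qed

text \<open>\<open>star_power\<close> is meaningful from exponent \<open>1\<close> on, so exponents
  are written as successors here and below.\<close>

lemma star_power_Suc: "star_power C A (Suc (Suc k)) = star C A (star_power C A (Suc k))"
  by (simp add: star_power_def)

lemma star_power_1: "star_power C A (Suc 0) = A"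
  by (simp add: star_power_def)

lemma star_power_mono: "A \<subseteq> B \<Longrightarrow> star_power C A (Suc k) \<subseteq> star_power C B (Suc k)"
  by (induction k) (simp_all add: star_power_1 star_power_Suc star_mono)

lemma star_power_subset: "ext_closed C K \<Longrightarrow> A \<subseteq> K \<Longrightarrow> star_power C A (Suc k) \<subseteq> K"
proof (induction k)
  case (Suc k)
  then have "star C A (star_power C A (Suc k)) \<subseteq> star C K K" by (intro star_mono) auto
  then show ?case using star_subset[OF Suc.prems(1)] by (simp add: star_power_Suc)
qed (simp add: star_power_1)

lemma star_power_Obj: "A \<subseteq> Obj C \<Longrightarrow> star_power C A (Suc k) \<subseteq> Obj C"
  by (cases k) (simp_all add: star_power_1 star_power_Suc star_Obj)

end

section \<open>Replacing the layers of the filtration by coproducts of copies of the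
  generator\<close>

context compact_family
begin

text \<open>The class on the right is closed under coproducts, so it is enough to treat a single
  \<open>M\<close> and the cone of the retraction onto it.\<close>

lemma coprods_subset_star:
  assumes G: "compact_object \<kappa> C G" "G \<in> cl \<kappa> C P"
    and ret: "\<And>M. M \<in> P \<Longrightarrow> \<exists>i p. \<langle>i : M \<rightarrow> G\<rangle> \<and> \<langle>p : G \<rightarrow> M\<rangle> \<and> p \<cdot> i = Id C M"
    and S: "S \<subseteq> P"
  shows "coprods S \<subseteq> star C (coprods {G}) (ShO C ` aisle P)"
proof (rule coprods_subset)
  show "coprod_closed \<kappa> C (star C (coprods {G}) (ShO C ` aisle P))"
    by (rule coprod_closed_star[OF coprod_closed_coprods coprod_closed_ShO[OF coprod_closed_aisle aisle_Obj]])
  show "S \<subseteq> star C (coprods {G}) (ShO C ` aisle P)"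
  proof
    fix M assume "M \<in> S"
    then have MP: "M \<in> P" using S by blast
    obtain i p where i: "\<langle>i : M \<rightarrow> G\<rangle>" and p: "\<langle>p : G \<rightarrow> M\<rangle>" and pi: "p \<cdot> i = Id C M" using ret[OF MP] by blast
    note GO = mor_Obj(1)[OF p] and MO = mor_Obj(2)[OF p]
    obtain E g h where D: "(G, M, E, p, g, h) \<in> Dist C" using TR1_cone[OF GO MO mor_Hom[OF p]] by blast
    note m = Dist_mor[OF D]
    note EO = mor_Obj(2)[OF m(2)]
    \<comment> \<open>\<open>p\<close> is split by \<open>i\<close>, so
      \<open>g = g p i = 0\<close>; the identity of the cone \<open>E\<close> then factors through
      \<open>h\<close>, and \<open>E\<close> is a retract of \<open>G[1]\<close>. The retraction is
      desuspended because closure under retracts is known for the aisle itself.\<close>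
    have "g = (g \<cdot> p) \<cdot> i" using comp_assoc[OF i p m(2)] pi comp_Id(2)[OF m(2)] by simp
    then have "g = Zero C M E" using Dist_comp_zero(1)[OF D] Zero_comp[OF i EO] by simp
    then have "Id C E \<cdot> g = Zero C M E" using comp_Id(1)[OF m(2)] by simp
    then obtain u where u: "\<langle>u : ShO C G \<rightarrow> E\<rangle>" "u \<cdot> h = Id C E"
      using Dist_weak_cokernel2[OF D mor_Id[OF EO]] by blast
    obtain E' where E': "E' \<in> Obj C" "E = ShO C E'" using EO by (rule ShO_cases)
    obtain h' where h': "\<langle>h' : E' \<rightarrow> G\<rangle>" "h = ShM C h'" using m(3)[unfolded E'(2)] E'(1) GO by (rule ShM_cases)
    obtain u' where u': "\<langle>u' : G \<rightarrow> E'\<rangle>" "u = ShM C u'" using u(1)[unfolded E'(2)] GO E'(1) by (rule ShM_cases)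
    have "u' \<cdot> h' = Id C E'"
      by (rule ShM_inj[OF mor_comp[OF h'(1) u'(1)] mor_Id[OF E'(1)]])
        (use ShM_comp[OF h'(1) u'(1)] ShM_Id[OF E'(1)] u(2) h'(2) u'(2) E'(2) in simp)
    then have "E' \<in> aisle P"
      using aisle_retract[OF h'(1) u'(1)] G(2) cl_subset_aisle by blast
    moreover have "G \<in> coprods {G}" using subset_coprods[of "{G}"] GO by blast
    ultimately show "M \<in> star C (coprods {G}) (ShO C ` aisle P)"
      using triI[OF D] E'(2) star_iff by blast
  qed
qed

text \<open>The classes of coproducts of the \<open>Q i\<close> are reordered by splitting extensions, so that their
  \<open>\<star>\<close>-product in increasing order of \<open>i\<close> is again extension-closed.\<close>

lemma filtered_extension_closure:
  fixes n :: nat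
  assumes wn: "weakly_negative C P"
    and P: "P = (\<Union>i\<in>{0..n}. Q i)"
    and triv: "\<forall>i\<in>{0..n}. \<forall>j\<in>{0..n}. i \<le> j \<longrightarrow> (\<forall>M\<in>Q i. \<forall>M'\<in>Q j. Hom_trivial C M (ShO C M'))"
    and G: "compact_object \<kappa> C G" "G \<in> cl \<kappa> C P"
    and ret: "\<And>M. M \<in> P \<Longrightarrow> \<exists>i p. \<langle>i : M \<rightarrow> G\<rangle> \<and> \<langle>p : G \<rightarrow> M\<rangle> \<and> p \<cdot> i = Id C M"
  shows "k \<le> n \<Longrightarrow> \<exists>K. ext_closed C K \<and> coprod_closed \<kappa> C K \<and>
    (\<Union>j\<in>{n - k..n}. Q j) \<subseteq> K \<and> K \<subseteq> cl \<kappa> C (\<Union>j\<in>{n - k..n}. Q j) \<and>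
    K \<subseteq> star C (star_power C (coprods {G}) (Suc k)) (ShO C ` aisle P)"
proof (induction k)
  have QP: "Q i \<subseteq> P" if "i \<le> n" for i using P that by auto
  have B: "ext_closed C (coprods (Q i))" if "i \<le> n" for i
    by (rule ext_closed_coprods) (use QP[OF that] P_compact triv that in auto)
  have B_star: "coprods (Q i) \<subseteq> star C (coprods {G}) (ShO C ` aisle P)" if "i \<le> n" for i
    by (rule coprods_subset_star[OF G ret QP[OF that]])
  have Q_B: "Q i \<subseteq> coprods (Q i)" if "i \<le> n" for i
    by (rule subset_coprods) (use QP[OF that] P_Obj in blast)
  {
    case 0
    then show ?case
      by (intro exI[of _ "coprods (Q n)"])
        (use B[of n] B_star[of n] Q_B[of n] coprod_closed_coprods coprods_subset_cl in \<open>auto simp: star_power_1\<close>)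
  next
    case (Suc k)
    \<comment> \<open>The induction starts at the top index and adds \<open>Q i\<close> on the left:
      for \<open>j \<ge> i\<close> there are no nonzero maps from \<open>Q i\<close> to
      \<open>Q j[1]\<close>, so \<open>K \<star> B\<close> can be rewritten as
      \<open>B \<star> K\<close>.\<close>
    define i where "i = n - Suc k"
    have i: "i \<le> n" unfolding i_def by simp
    let ?T = "\<Union>j\<in>{n - k..n}. Q j" and ?T' = "\<Union>j\<in>{n - Suc k..n}. Q j"
    have "{n - Suc k..n} = insert i {n - k..n}" using Suc.prems by (auto simp: i_def)
    then have T': "?T' = Q i \<union> ?T" by auto
    have TP: "?T \<subseteq> P" and T'P: "?T' \<subseteq> P" using P by auto
    obtain K where K: "ext_closed C K" "coprod_closed \<kappa> C K" "?T \<subseteq> K" "K \<subseteq> cl \<kappa> C ?T"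
      and K_star: "K \<subseteq> star C (star_power C (coprods {G}) (Suc k)) (ShO C ` aisle P)"
      using Suc.IH Suc.prems by auto
    have KO: "K \<subseteq> Obj C" using K(4) cl_Obj[of ?T] TP P_Obj by blast
    let ?B = "coprods (Q i)" and ?V = "ShO C ` aisle P" and ?S = "star_power C (coprods {G}) (Suc k)"
    have orth: "Hom_trivial C Y (ShO C X)" if "X \<in> K" "Y \<in> ?B" for X Y
    proof -
      have "Hom_trivial C Y (shift C 1 X)"
      proof (rule Hom_trivial_cl)
        show "Hom_trivial C M (shift C 1 N)" if "M \<in> Q i" "N \<in> ?T" for M N
        proof -
          obtain j where j: "j \<in> {n - k..n}" "N \<in> Q j" using \<open>N \<in> ?T\<close> by blast
          have "i \<le> j" using j(1) by (auto simp: i_def)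
          then show ?thesis using triv[rule_format, of i j M N] i j that(1) by simp
        qed
        show "Y \<in> cl \<kappa> C (Q i)" using that(2) coprods_subset_cl by blast
        show "X \<in> cl \<kappa> C ?T" using that(1) K(4) by blast
      qed (use QP[OF i] P_compact TP P_Obj in blast)+
      then show ?thesis by simp
    qed
    have V: "ext_closed C ?V" "?V \<subseteq> Obj C"
      using ext_closed_ShO[OF ext_closed_aisle aisle_Obj] aisle_Obj by auto
    have "coprods {G} \<subseteq> cl \<kappa> C P" using coprods_subset[OF coprod_closed_cl] G(2) by blast
    then have S_cl: "?S \<subseteq> cl \<kappa> C P" by (rule star_power_subset[OF ext_closed_cl])
    have "ext_closed C (star C ?B K)" by (rule ext_closed_star[OF B[OF i] K(1) KO orth])
    moreover have "coprod_closed \<kappa> C (star C ?B K)" by (rule coprod_closed_star[OF coprod_closed_coprods K(2)])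
    moreover have "?T' \<subseteq> star C ?B K"
      using T' Q_B[OF i] K(3) subset_star_left[OF K(1) coprods_Obj, of "Q i"]
        subset_star_right[OF zero_in_coprods KO, of "Q i"] by blast
    moreover have "star C ?B K \<subseteq> cl \<kappa> C ?T'"
    proof -
      have "T'' \<subseteq> cl \<kappa> C ?T'" if "T'' \<subseteq> cl \<kappa> C S''" "S'' \<subseteq> ?T'" for T'' S''
        using that cl_mono[of S'' ?T'] subset_cl[of ?T'] T'P P_Obj by blast
      then have "star C ?B K \<subseteq> star C (cl \<kappa> C ?T') (cl \<kappa> C ?T')"
        using coprods_subset_cl[of "Q i"] K(4) T' by (intro star_mono) blast+
      then show ?thesis using star_subset[OF ext_closed_cl] by blast
    qed
    moreover have "star C ?B K \<subseteq> star C (star_power C (coprods {G}) (Suc (Suc k))) ?V"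
    proof -
      \<comment> \<open>Both factors contribute a \<open>U[1]\<close>. The inner one is swapped past
        \<open>?S\<close>, which is allowed since \<open>?S\<close> lies in \<open>[P]^cl\<close>,
        and then the two copies merge.\<close>
      have "star C ?B K \<subseteq> star C (star C (coprods {G}) ?V) (star C ?S ?V)"
        by (rule star_mono[OF B_star[OF i] K_star])
      also have "\<dots> = star C (coprods {G}) (star C (star C ?V ?S) ?V)" by (simp only: star_assoc)
      also have "\<dots> \<subseteq> star C (coprods {G}) (star C (star C ?S ?V) ?V)"
        by (intro star_mono order_refl star_swap[OF V(1)] Hom_trivial_ShO_aisle[OF wn]) (use S_cl in blast)+
      also have "\<dots> = star C (star C (coprods {G}) ?S) (star C ?V ?V)" by (simp only: star_assoc)
      also have "\<dots> \<subseteq> star C (star C (coprods {G}) ?S) ?V"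
        by (intro star_mono order_refl star_subset[OF V(1)])
      finally show ?thesis by (simp only: star_power_Suc)
    qed
    ultimately show ?case by blast
  }
qed

lemma approximable_filtered:
  fixes n :: nat
  assumes wn: "weakly_negative C P" and gen: "compactly_generates \<kappa> C {G}"
    and P: "P = (\<Union>i\<in>{0..n}. Q i)"
    and triv: "\<forall>i\<in>{0..n}. \<forall>j\<in>{0..n}. i \<le> j \<longrightarrow> (\<forall>M\<in>Q i. \<forall>M'\<in>Q j. Hom_trivial C M (ShO C M'))"
    and G: "compact_object \<kappa> C G" "G \<in> cl \<kappa> C P"
    and ret: "\<And>M. M \<in> P \<Longrightarrow> \<exists>i p. \<langle>i : M \<rightarrow> G\<rangle> \<and> \<langle>p : G \<rightarrow> M\<rangle> \<and> p \<cdot> i = Id C M"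
  shows "approximable \<kappa> C"
proof -
  \<comment> \<open>\<open>n + 1\<close> factors arise and orthogonality asks for
    \<open>m > 1\<close> even when \<open>n = 0\<close>; \<open>n + 2\<close> serves both, with a
    zero object padding the extra factor.\<close>
  let ?V = "ShO C ` aisle P" and ?m = "Suc (Suc n)"
  have V: "ext_closed C ?V" using ext_closed_ShO[OF ext_closed_aisle aisle_Obj] .
  have "\<exists>K. ext_closed C K \<and> coprod_closed \<kappa> C K \<and>
      (\<Union>j\<in>{n - n..n}. Q j) \<subseteq> K \<and> K \<subseteq> cl \<kappa> C (\<Union>j\<in>{n - n..n}. Q j) \<and>
      K \<subseteq> star C (star_power C (coprods {G}) (Suc n)) ?V"
    by (rule filtered_extension_closure[OF wn P triv G ret]) auto
  then obtain K where K: "ext_closed C K" "coprod_closed \<kappa> C K" "P \<subseteq> K" "K \<subseteq> cl \<kappa> C P"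
    and K_star: "K \<subseteq> star C (star_power C (coprods {G}) (Suc n)) ?V"
    unfolding P by auto
  have "aisle P \<subseteq> star C K ?V" by (rule aisle_subset_star[OF wn K])
  also have "\<dots> \<subseteq> star C (star C (star_power C (coprods {G}) (Suc n)) ?V) ?V"
    by (rule star_mono[OF K_star order_refl])
  also have "\<dots> = star C (star_power C (coprods {G}) (Suc n)) (star C ?V ?V)" by (rule star_assoc)
  also have "\<dots> \<subseteq> star C (star_power C (coprods {G}) (Suc n)) ?V"
    by (intro star_mono order_refl star_subset[OF V])
  finally have aisle: "aisle P \<subseteq> star C (star_power C (coprods {G}) (Suc n)) ?V" .
  have "star_power C (coprods {G}) (Suc n) \<subseteq> star_power C (coprods {G}) ?m"
    unfolding star_power_Suc by (rule subset_star_right[OF zero_in_coprods star_power_Obj[OF coprods_Obj]])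
  also have "\<dots> \<subseteq> star_power C (shift_coproducts \<kappa> C G ?m) ?m"
    by (rule star_power_mono[OF coprods_subset_shift_coproducts])
  also have "\<dots> \<subseteq> gen_bounded \<kappa> C G ?m ?m"
    unfolding gen_bounded_def by (rule subset_retracts) (simp add: star_power_Suc star_Obj)
  finally have "star_power C (coprods {G}) (Suc n) \<subseteq> gen_bounded \<kappa> C G ?m ?m" .
  then have aisle': "aisle P \<subseteq> star C (gen_bounded \<kappa> C G ?m ?m) ?V"
    using aisle star_mono[OF _ order_refl] by blast
  have t_le: "t_le C (aisle P) (- 1) = ?V" by (simp add: t_le_def)
  have "\<exists>E\<in>gen_bounded \<kappa> C G ?m ?m. \<exists>D\<in>t_le C (aisle P) (- 1). \<exists>f g h. (E, F, D, f, g, h) \<in> Dist C"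
    if "F \<in> aisle P" for F
    using subsetD[OF aisle' that] unfolding t_le star_def by blast
  moreover have "approx_orthogonality C G (aisle P) ?m"
    by (rule approx_orthogonality_aisle[OF wn G(2)]) simp
  ultimately show ?thesis
    unfolding approximable_def using gen t_structure_aisle compact_object_Obj[OF G(1)]
    by (intro bexI[of _ G] exI[of _ "coaisle P"] exI[of _ "aisle P"] exI[of _ ?m]) auto
qed

end

theorem corollary4p3:
  fixes C :: "('o, 'm) tri_category" and \<kappa> :: "'u rel" and P :: "'o set"
  assumes "smallness_cardinal \<kappa>"
    and "triangulated_category C"
    and "compact_homs_small \<kappa> C"
    and "has_small_coproducts \<kappa> C"
    and "P \<subseteq> Obj C"
    and "finite P"
    and "weakly_negative C P"
    and "compactly_generates \<kappa> C P"
  shows "weakly_approximable \<kappa> C \<and>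
    (\<forall>(n :: nat) Q. P = (\<Union>i\<in>{0..n}. Q i) \<longrightarrow>
       (\<forall>i\<in>{0..n}. \<forall>j\<in>{0..n}. i \<le> j \<longrightarrow>
          (\<forall>M\<in>Q i. \<forall>M'\<in>Q j. Hom_trivial C M (shift C 1 M'))) \<longrightarrow>
       approximable \<kappa> C)"
proof -
  interpret compact_family C \<kappa> P
  proof (rule compact_family.intro)
    show "cocomplete_triangulated_category C \<kappa>"
      by (intro cocomplete_triangulated_category.intro cocomplete_triangulated_category_axioms.intro assms)
    show "compact_family_axioms C \<kappa> P"
      using assms(6,8) by (intro compact_family_axioms.intro) (auto simp: compactly_generates_def)
  qed
  obtain G where G: "compact_object \<kappa> C G" "G \<in> cl \<kappa> C P"
    and ret: "\<And>M. M \<in> P \<Longrightarrow> \<exists>i p. \<langle>i : M \<rightarrow> G\<rangle> \<and> \<langle>p : G \<rightarrow> M\<rangle> \<and> p \<cdot>\<^bsub>C\<^esub> i = Id C M"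
    using ex_compact_sum[OF P_finite P_compact] by blast
  have gen: "compactly_generates \<kappa> C {G}"
    by (rule compactly_generates_retracts[OF assms(8) G(1) ret])
  \<comment> \<open>Weak negativity passes from \<open>P\<close> to \<open>G\<close> by devissage,
    because \<open>G\<close> lies in \<open>[P]^cl\<close>.\<close>
  have "Hom_trivial C G (shift C i G)" if "i > 1" for i
    by (rule Hom_trivial_cl[OF P_compact P_Obj _ G(2) G(2)])
      (use assms(7) that in \<open>auto simp: weakly_negative_def\<close>)
  then have "weakly_approximable \<kappa> C"
    using weakly_approximable_single[OF gen] by (simp add: weakly_negative_def)
  \<comment> \<open>The first part used the t-structure generated by \<open>G\<close>; here it is
    the one generated by \<open>P\<close>, to whose layers the hypothesis refers.\<close>
  moreover have "approximable \<kappa> C"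
    if "P = (\<Union>i\<in>{0..n}. Q i)" "\<forall>i\<in>{0..n}. \<forall>j\<in>{0..n}. i \<le> j \<longrightarrow>
      (\<forall>M\<in>Q i. \<forall>M'\<in>Q j. Hom_trivial C M (shift C 1 M'))" for n :: nat and Q
    by (rule approximable_filtered[OF assms(7) gen that(1) that(2)[unfolded shift_1] G ret])
  ultimately show ?thesis by blast
qed

end
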